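(* Let $p$ be an odd prime. Let $G$ be a group of order $p^n$, $n\ge 2$, with an abelian normal subgroup $H$ of order $p^{n-1}$, and let $G$ be of exponent $p^e$. Assume that $H=H_1\times H_2\times\cdots\times H_s$ (internal direct product) for some $s\ge 1$, where for each $1\le j\le s$ the subgroup $H_j$ is normal in $G$ and $H_j\simeq C_{p^{i_j}}\times (C_p)^{k_j}$ with $k_j\ge 0$, and $1\le i_1\le i_2\le\cdots\le i_s$. Let $K$ be a field such that either (i) $\operatorname{char} K=p>0$, or (ii) $\operatorname{char} K\ne p$ and $K$ contains a primitive $p^e$-th root of unity. Then $K(G)$ is rational over $K$.
   Context: $C_m$ denotes the cyclic group of order $m$. For a field $K$ and a finite group $G$, let $G$ act on the rational function field $K(x(g):g\in G)$ (in $|G|$ independent variables indexed by $G$) by $K$-automorphisms defined by $g\cdot x(h)=x(gh)$ for all $g,h\in G$. $K(G)$ denotes the fixed field $K(x(g):g\in G)^G$. A field extension of $K$ is called rational over $K$ if it is purely transcendental over $K$. *)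

theory Defs
  imports
    "HOL.Hull"
    "HOL-Library.Poly_Mapping"
    "HOL-Computational_Algebra.Fraction_Field"
    "HOL-Computational_Algebra.Primes"
    "HOL-Algebra.Elementary_Groups"
    "HOL-Algebra.Product_Groups"
begin

section \<open>Polynomials in a family of variables\<close>

text \<open>The monoid algebra of HOL-Library is only an integral domain for linearly ordered
  monoids of exponents, so the variables would have to be linearly ordered. A copy of the type
  can be made an integral domain for an arbitrary type of variables.\<close>

typedef (overloaded) ('v, 'k::zero) mpoly = "UNIV :: (('v \<Rightarrow>\<^sub>0 nat) \<Rightarrow>\<^sub>0 'k) set"
  morphisms coeffs MPoly
  by simp

setup_lifting type_definition_mpoly

instantiation mpoly :: (type, comm_ring_1) comm_ring_1
begin
lift_definition zero_mpoly :: "('a, 'b) mpoly" is 0 .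
lift_definition one_mpoly :: "('a, 'b) mpoly" is 1 .
lift_definition plus_mpoly :: "('a, 'b) mpoly \<Rightarrow> ('a, 'b) mpoly \<Rightarrow> ('a, 'b) mpoly" is "(+)" .
lift_definition minus_mpoly :: "('a, 'b) mpoly \<Rightarrow> ('a, 'b) mpoly \<Rightarrow> ('a, 'b) mpoly" is "(-)" .
lift_definition uminus_mpoly :: "('a, 'b) mpoly \<Rightarrow> ('a, 'b) mpoly" is uminus .
lift_definition times_mpoly :: "('a, 'b) mpoly \<Rightarrow> ('a, 'b) mpoly \<Rightarrow> ('a, 'b) mpoly" is "(*)" .
instance
  by standard (transfer; simp add: algebra_simps)+
end

lift_definition Const :: "'k::comm_ring_1 \<Rightarrow> ('v, 'k) mpoly"
  is "\<lambda>c. Poly_Mapping.single 0 c" .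

lift_definition Var :: "'v \<Rightarrow> ('v, 'k::comm_ring_1) mpoly"
  is "\<lambda>v. Poly_Mapping.single (Poly_Mapping.single v 1) 1" .

definition coeff :: "('v, 'k::zero) mpoly \<Rightarrow> ('v \<Rightarrow>\<^sub>0 nat) \<Rightarrow> 'k" where
  "coeff P = Poly_Mapping.lookup (coeffs P)"

definition vars :: "('v, 'k::zero) mpoly \<Rightarrow> 'v set" where
  "vars P = (\<Union>m\<in>Poly_Mapping.keys (coeffs P). Poly_Mapping.keys m)"

definition monom_eval :: "('v \<Rightarrow> 'r::comm_ring_1) \<Rightarrow> ('v \<Rightarrow>\<^sub>0 nat) \<Rightarrow> 'r" where
  "monom_eval a m = (\<Prod>v\<in>Poly_Mapping.keys m. a v ^ Poly_Mapping.lookup m v)"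

definition pm_eval ::
    "('k::zero \<Rightarrow> 'r) \<Rightarrow> ('v \<Rightarrow> 'r::comm_ring_1) \<Rightarrow> (('v \<Rightarrow>\<^sub>0 nat) \<Rightarrow>\<^sub>0 'k) \<Rightarrow> 'r" where
  "pm_eval c a P =
     (\<Sum>m\<in>Poly_Mapping.keys P. c (Poly_Mapping.lookup P m) * monom_eval a m)"

text \<open>Evaluation at the point \<open>a\<close>, with the coefficients mapped by \<open>c\<close>.\<close>

lift_definition poly_eval ::
    "('k::zero \<Rightarrow> 'r) \<Rightarrow> ('v \<Rightarrow> 'r::comm_ring_1) \<Rightarrow> ('v, 'k) mpoly \<Rightarrow> 'r"
  is pm_eval .

definition ring_map :: "('k::comm_ring_1 \<Rightarrow> 'r::comm_ring_1) \<Rightarrow> bool" where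
  "ring_map c \<longleftrightarrow> c 1 = 1 \<and> (\<forall>x y. c (x + y) = c x + c y) \<and> (\<forall>x y. c (x * y) = c x * c y)"

lemma ring_map_0: "ring_map c \<Longrightarrow> c 0 = 0"
  unfolding ring_map_def by (metis add_cancel_right_right)

lemma monom_eval_superset:
  assumes "finite A" "Poly_Mapping.keys m \<subseteq> A"
  shows "monom_eval a m = (\<Prod>v\<in>A. a v ^ Poly_Mapping.lookup m v)"
  unfolding monom_eval_def using assms
  by (intro prod.mono_neutral_left) (auto simp: in_keys_iff)

lemma monom_eval_add: "monom_eval a (m + n) = monom_eval a m * monom_eval a n"
proof -
  let ?A = "Poly_Mapping.keys m \<union> Poly_Mapping.keys n"
  have "monom_eval a (m + n) = (\<Prod>v\<in>?A. a v ^ Poly_Mapping.lookup (m + n) v)"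
    using keys_add[of m n] by (intro monom_eval_superset) auto
  also have "\<dots> = (\<Prod>v\<in>?A. a v ^ Poly_Mapping.lookup m v) * (\<Prod>v\<in>?A. a v ^ Poly_Mapping.lookup n v)"
    by (simp add: lookup_add power_add prod.distrib)
  also have "\<dots> = monom_eval a m * monom_eval a n"
    by (simp add: monom_eval_superset[of ?A])
  finally show ?thesis .
qed

lemma monom_eval_0 [simp]: "monom_eval a 0 = 1"
  by (simp add: monom_eval_def)

lemma monom_eval_single [simp]: "monom_eval a (Poly_Mapping.single v k) = a v ^ k"
  by (simp add: monom_eval_def)

lemma pm_eval_superset:
  assumes "c 0 = 0" "finite A" "Poly_Mapping.keys P \<subseteq> A"
  shows "pm_eval c a P = (\<Sum>m\<in>A. c (Poly_Mapping.lookup P m) * monom_eval a m)"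
  unfolding pm_eval_def using assms
  by (intro sum.mono_neutral_left) (auto simp: in_keys_iff)

lemma pm_eval_0 [simp]: "pm_eval c a 0 = 0"
  by (simp add: pm_eval_def)

lemma pm_eval_single: "c 0 = 0 \<Longrightarrow> pm_eval c a (Poly_Mapping.single m k) = c k * monom_eval a m"
  by (simp add: pm_eval_def)

lemma pm_eval_add:
  assumes "ring_map c"
  shows "pm_eval c a (P + Q) = pm_eval c a P + pm_eval c a Q"
proof -
  let ?A = "Poly_Mapping.keys P \<union> Poly_Mapping.keys Q"
  have c: "c 0 = 0" "\<And>x y. c (x + y) = c x + c y"
    using assms by (auto simp: ring_map_0 ring_map_def)
  have "pm_eval c a (P + Q) = (\<Sum>m\<in>?A. c (Poly_Mapping.lookup (P + Q) m) * monom_eval a m)"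
    using keys_add[of P Q] by (intro pm_eval_superset) (auto simp: c)
  also have "\<dots> = (\<Sum>m\<in>?A. c (Poly_Mapping.lookup P m) * monom_eval a m)
      + (\<Sum>m\<in>?A. c (Poly_Mapping.lookup Q m) * monom_eval a m)"
    by (simp add: lookup_add c distrib_right sum.distrib)
  also have "\<dots> = pm_eval c a P + pm_eval c a Q"
    by (simp add: pm_eval_superset[of c ?A] c)
  finally show ?thesis .
qed

lemma pm_eval_sum:
  assumes "ring_map c"
  shows "pm_eval c a (\<Sum>i\<in>I. f i) = (\<Sum>i\<in>I. pm_eval c a (f i))"
  by (induction I rule: infinite_finite_induct) (simp_all add: pm_eval_add[OF assms])

lemma pm_expand: "P = (\<Sum>m\<in>Poly_Mapping.keys P. Poly_Mapping.single m (Poly_Mapping.lookup P m))"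
  by (rule poly_mapping_eqI) (auto simp: lookup_sum lookup_single when_def in_keys_iff)

lemma pm_eval_mult:
  assumes "ring_map c"
  shows "pm_eval c a (P * Q) = pm_eval c a P * pm_eval c a Q"
proof -
  let ?p = "Poly_Mapping.lookup P" and ?q = "Poly_Mapping.lookup Q"
  have c: "c 0 = 0" "\<And>x y. c (x * y) = c x * c y"
    using assms by (auto simp: ring_map_0 ring_map_def)
  have "P * Q = (\<Sum>m\<in>Poly_Mapping.keys P. Poly_Mapping.single m (?p m))
      * (\<Sum>n\<in>Poly_Mapping.keys Q. Poly_Mapping.single n (?q n))"
    by (simp flip: pm_expand)
  also have "\<dots> = (\<Sum>m\<in>Poly_Mapping.keys P. \<Sum>n\<in>Poly_Mapping.keys Q.
      Poly_Mapping.single (m + n) (?p m * ?q n))"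
    by (simp add: sum_product mult_single)
  finally have "pm_eval c a (P * Q) = (\<Sum>m\<in>Poly_Mapping.keys P. \<Sum>n\<in>Poly_Mapping.keys Q.
      c (?p m * ?q n) * monom_eval a (m + n))"
    by (simp add: pm_eval_sum[OF assms] pm_eval_single[of c, OF c(1)])
  also have "\<dots> = pm_eval c a P * pm_eval c a Q"
    by (simp add: pm_eval_def sum_product monom_eval_add c mult_ac)
  finally show ?thesis .
qed

lemma poly_eval_hom:
  assumes "ring_map c"
  shows "poly_eval c a 0 = 0" "poly_eval c a 1 = 1"
    "poly_eval c a (P + Q) = poly_eval c a P + poly_eval c a Q"
    "poly_eval c a (P * Q) = poly_eval c a P * poly_eval c a Q"
    "poly_eval c a (Const k) = c k" "poly_eval c a (Var v) = a v"
proof -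
  have c: "c 0 = 0" "c 1 = 1" using assms by (auto simp: ring_map_0 ring_map_def)
  show "poly_eval c a 0 = 0" by transfer simp
  show "poly_eval c a 1 = 1"
    by (simp add: poly_eval.rep_eq one_mpoly.rep_eq c pm_eval_single del: single_one flip: single_one)
  show "poly_eval c a (P + Q) = poly_eval c a P + poly_eval c a Q"
    using assms by transfer (rule pm_eval_add)
  show "poly_eval c a (P * Q) = poly_eval c a P * poly_eval c a Q"
    using assms by transfer (rule pm_eval_mult)
  show "poly_eval c a (Const k) = c k"
    using c by transfer (simp add: pm_eval_single)
  show "poly_eval c a (Var v) = a v"
    using c by transfer (simp add: pm_eval_single)
qed

text \<open>Injectively renaming the variables of a nonzero polynomial gives a nonzero polynomial.\<close>

definition pm_rename ::
    "('v \<Rightarrow> 'w) \<Rightarrow> (('v \<Rightarrow>\<^sub>0 nat) \<Rightarrow>\<^sub>0 'k::comm_ring_1) \<Rightarrow> (('w \<Rightarrow>\<^sub>0 nat) \<Rightarrow>\<^sub>0 'k)" where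
  "pm_rename f = pm_eval (Poly_Mapping.single 0)
     (\<lambda>v. Poly_Mapping.single (Poly_Mapping.single (f v) 1) 1)"

lemma ring_map_single: "ring_map (Poly_Mapping.single (0 :: 'v \<Rightarrow>\<^sub>0 nat) :: 'k::comm_ring_1 \<Rightarrow> _)"
  by (simp add: ring_map_def single_add mult_single)

lemma prod_single: "(\<Prod>i\<in>I. Poly_Mapping.single (m i :: 'v \<Rightarrow>\<^sub>0 nat) (1 :: 'k::comm_ring_1))
    = Poly_Mapping.single (\<Sum>i\<in>I. m i) 1"
  by (induction I rule: infinite_finite_induct) (simp_all add: mult_single)

lemma pm_rename_neq_0:
  fixes P :: "('v \<Rightarrow>\<^sub>0 nat) \<Rightarrow>\<^sub>0 'k::comm_ring_1" and f :: "'v \<Rightarrow> 'w"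
  assumes inj: "inj_on f (\<Union>m\<in>Poly_Mapping.keys P. Poly_Mapping.keys m)" and "P \<noteq> 0"
  shows "pm_rename f P \<noteq> 0"
proof -
  let ?V = "\<Union>m\<in>Poly_Mapping.keys P. Poly_Mapping.keys m"
  define a where "a = (\<lambda>v. Poly_Mapping.single (Poly_Mapping.single (f v) (1::nat)) (1::'k))"
  define \<mu> where "\<mu> = (\<lambda>m :: 'v \<Rightarrow>\<^sub>0 nat.
    \<Sum>v\<in>Poly_Mapping.keys m. Poly_Mapping.single (f v) (Poly_Mapping.lookup m v))"
  have pow: "Poly_Mapping.single (Poly_Mapping.single w (1::nat)) (1::'k) ^ k
      = Poly_Mapping.single (Poly_Mapping.single w k) 1" for w :: 'w and k
    by (induction k) (simp_all only: power_0 power_Suc single_zero single_one mult_single mult_1_left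
        plus_1_eq_Suc flip: single_add)
  have mon: "monom_eval a m = Poly_Mapping.single (\<mu> m) 1" for m
    by (simp only: monom_eval_def a_def pow prod_single \<mu>_def)
  have lookup_\<mu>: "Poly_Mapping.lookup (\<mu> m) (f v) = Poly_Mapping.lookup m v"
    if "m \<in> Poly_Mapping.keys P" "v \<in> ?V" for m v
  proof -
    have "Poly_Mapping.lookup (\<mu> m) (f v)
        = (\<Sum>u\<in>Poly_Mapping.keys m. Poly_Mapping.lookup m u when f u = f v)"
      by (simp add: \<mu>_def lookup_sum lookup_single)
    also have "\<dots> = (\<Sum>u\<in>Poly_Mapping.keys m. if u = v then Poly_Mapping.lookup m u else 0)"
    proof (rule sum.cong[OF refl])
      fix u assume "u \<in> Poly_Mapping.keys m"
      then have "u \<in> ?V" using that(1) by blast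
      then have "f u = f v \<longleftrightarrow> u = v" using inj_on_eq_iff[OF inj] that(2) by blast
      then show "(Poly_Mapping.lookup m u when f u = f v)
          = (if u = v then Poly_Mapping.lookup m u else 0)" by (simp add: when_def)
    qed
    also have "\<dots> = Poly_Mapping.lookup m v"
      by (simp add: in_keys_iff)
    finally show ?thesis .
  qed
  have inj\<mu>: "m = n" if "m \<in> Poly_Mapping.keys P" "n \<in> Poly_Mapping.keys P" "\<mu> m = \<mu> n" for m n
  proof (rule poly_mapping_eqI)
    fix v
    show "Poly_Mapping.lookup m v = Poly_Mapping.lookup n v"
    proof (cases "v \<in> ?V")
      case True
      then show ?thesis using lookup_\<mu> that by metis
    next
      case False
      then show ?thesis using that by (auto simp: in_keys_iff)
    qed
  qed
  obtain n where n: "n \<in> Poly_Mapping.keys P" using \<open>P \<noteq> 0\<close> by (metis keys_eq_empty ex_in_conv)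
  have "Poly_Mapping.lookup (pm_rename f P) (\<mu> n)
      = (\<Sum>m\<in>Poly_Mapping.keys P. Poly_Mapping.lookup P m when \<mu> m = \<mu> n)"
    by (simp only: pm_rename_def pm_eval_def mon mult_single lookup_sum lookup_single
        add_0_left mult_1_right flip: a_def)
  also have "\<dots> = (\<Sum>m\<in>Poly_Mapping.keys P. if m = n then Poly_Mapping.lookup P m else 0)"
    using inj\<mu> n by (intro sum.cong) (auto simp: when_def)
  also have "\<dots> = Poly_Mapping.lookup P n" using n by simp
  also have "\<dots> \<noteq> 0" using n by (simp add: in_keys_iff)
  finally show ?thesis by auto
qed

instance mpoly :: (type, idom) idom
proof
  fix P Q :: "('a, 'b) mpoly"
  assume "P \<noteq> 0" "Q \<noteq> 0"
  then show "P * Q \<noteq> 0"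
  proof transfer
    fix P Q :: "('a \<Rightarrow>\<^sub>0 nat) \<Rightarrow>\<^sub>0 'b"
    assume nz: "P \<noteq> 0" "Q \<noteq> 0"
    let ?V = "\<lambda>P :: ('a \<Rightarrow>\<^sub>0 nat) \<Rightarrow>\<^sub>0 'b. \<Union>m\<in>Poly_Mapping.keys P. Poly_Mapping.keys m"
    have "finite (?V P \<union> ?V Q)" by simp
    then obtain f :: "'a \<Rightarrow> nat" where "inj_on f (?V P \<union> ?V Q)"
      using finite_imp_inj_to_nat_seg by metis
    then have "inj_on f (?V P)" "inj_on f (?V Q)" by (auto intro: inj_on_subset)
    with nz have "pm_rename f P \<noteq> 0" "pm_rename f Q \<noteq> 0" using pm_rename_neq_0 by blast+
    then have "pm_rename f (P * Q) \<noteq> 0"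
      by (simp add: pm_rename_def pm_eval_mult[OF ring_map_single])
    then show "P * Q \<noteq> 0" by (auto simp: pm_rename_def)
  qed
qed


section \<open>Subfields and purely transcendental extensions\<close>

definition is_subfield :: "'l::field set \<Rightarrow> bool" where
  "is_subfield F \<longleftrightarrow> 0 \<in> F \<and> 1 \<in> F \<and>
     (\<forall>x\<in>F. \<forall>y\<in>F. x - y \<in> F \<and> x * y \<in> F) \<and> (\<forall>x\<in>F. inverse x \<in> F)"

text \<open>Hence \<open>is_subfield hull (K \<union> B)\<close> is the field \<open>K(B)\<close> inside the ambient field.\<close>

lemma is_subfield_hull: "is_subfield (is_subfield hull S)"
  by (rule hull_in) (auto simp: is_subfield_def)

definition algebraically_independent :: "'l::field set \<Rightarrow> 'l set \<Rightarrow> bool" where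
  "algebraically_independent K B \<longleftrightarrow>
     (\<forall>P :: ('l, 'l) mpoly. range (coeff P) \<subseteq> K \<longrightarrow> vars P \<subseteq> B \<longrightarrow>
        poly_eval (\<lambda>c. c) (\<lambda>b. b) P = 0 \<longrightarrow> P = 0)"

definition rational_over :: "'l::field set \<Rightarrow> 'l set \<Rightarrow> bool" where
  "rational_over K F \<longleftrightarrow>
     is_subfield K \<and> (\<exists>B. algebraically_independent K B \<and> F = is_subfield hull (K \<union> B))"


section \<open>Rational function fields and the fixed field of the regular action\<close>

type_synonym ('v, 'k) ratfun = "('v, 'k) mpoly fract"

definition rconst :: "'k::field \<Rightarrow> ('v, 'k) ratfun" where
  "rconst c = Fraction_Field.Fract (Const c) 1"

definition rvar :: "'v \<Rightarrow> ('v, 'k::field) ratfun" where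
  "rvar v = Fraction_Field.Fract (Var v) 1"

definition poly_rename :: "('v \<Rightarrow> 'v) \<Rightarrow> ('v, 'k::field) mpoly \<Rightarrow> ('v, 'k) mpoly" where
  "poly_rename \<sigma> = poly_eval Const (\<lambda>v. Var (\<sigma> v))"

text \<open>The substitution of \<open>\<sigma> v\<close> for every variable \<open>v\<close>; it is well defined on fractions
  when \<open>\<sigma>\<close> is injective.\<close>

definition ratfun_rename :: "('v \<Rightarrow> 'v) \<Rightarrow> ('v, 'k::field) ratfun \<Rightarrow> ('v, 'k) ratfun" where
  "ratfun_rename \<sigma> f = (THE r. \<forall>P Q. Q \<noteq> 0 \<longrightarrow> f = Fraction_Field.Fract P Q \<longrightarrow>
     r = Fraction_Field.Fract (poly_rename \<sigma> P) (poly_rename \<sigma> Q))"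

text \<open>The variables are indexed by the type of the elements of \<open>G\<close>; only those with index in
  \<open>carrier G\<close> belong to the rational function field of interest, and the others are left fixed.\<close>

definition regular_action ::
    "('g, 'b) monoid_scheme \<Rightarrow> 'g \<Rightarrow> ('g, 'k::field) ratfun \<Rightarrow> ('g, 'k) ratfun" where
  "regular_action G g =
     ratfun_rename (\<lambda>h. if h \<in> carrier G then g \<otimes>\<^bsub>G\<^esub> h else h)"

definition group_ratfuns :: "('g, 'b) monoid_scheme \<Rightarrow> ('g, 'k::field) ratfun set" where
  "group_ratfuns G = is_subfield hull (range rconst \<union> rvar ` carrier G)"

text \<open>The field \<open>K(G)\<close>, where \<open>K\<close> is the type \<open>'k\<close>.\<close>

definition noether_field :: "('g, 'b) monoid_scheme \<Rightarrow> ('g, 'k::field) ratfun set" where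
  "noether_field G = {f \<in> group_ratfuns G. \<forall>g\<in>carrier G. regular_action G g f = f}"

lemma ring_map_Const: "ring_map (Const :: 'k::comm_ring_1 \<Rightarrow> ('v, 'k) mpoly)"
  unfolding ring_map_def
  by (intro conjI allI; transfer; simp add: single_add mult_single)

lemma poly_rename_hom:
  "poly_rename \<sigma> 0 = 0" "poly_rename \<sigma> 1 = 1"
  "poly_rename \<sigma> (P + Q) = poly_rename \<sigma> P + poly_rename \<sigma> Q"
  "poly_rename \<sigma> (P * Q) = poly_rename \<sigma> P * poly_rename \<sigma> Q"
  "poly_rename \<sigma> (Const k) = Const k" "poly_rename \<sigma> (Var v) = Var (\<sigma> v)"
  by (simp_all add: poly_rename_def poly_eval_hom[OF ring_map_Const])

lemma poly_rename_neq_0: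
  fixes P :: "('v, 'k::field) mpoly"
  assumes "inj \<sigma>" "P \<noteq> 0"
  shows "poly_rename \<sigma> P \<noteq> 0"
proof -
  have sum: "coeffs (\<Sum>i\<in>I. h i) = (\<Sum>i\<in>I. coeffs (h i))" for I and h :: "'c \<Rightarrow> ('v, 'k) mpoly"
    by (induction I rule: infinite_finite_induct) (simp_all add: zero_mpoly.rep_eq plus_mpoly.rep_eq)
  have pow: "coeffs (p ^ n) = coeffs p ^ n" for p :: "('v, 'k) mpoly" and n
    by (induction n) (simp_all add: one_mpoly.rep_eq times_mpoly.rep_eq)
  have prod: "coeffs (\<Prod>i\<in>I. h i) = (\<Prod>i\<in>I. coeffs (h i))" for I and h :: "'c \<Rightarrow> ('v, 'k) mpoly"
    by (induction I rule: infinite_finite_induct) (simp_all add: one_mpoly.rep_eq times_mpoly.rep_eq)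
  have "coeffs (poly_rename \<sigma> P) = pm_rename \<sigma> (coeffs P)"
    by (simp add: poly_rename_def pm_rename_def poly_eval.rep_eq pm_eval_def monom_eval_def
        sum pow prod times_mpoly.rep_eq Const.rep_eq Var.rep_eq)
  moreover have "coeffs P \<noteq> 0" using assms(2) by transfer
  then have "pm_rename \<sigma> (coeffs P) \<noteq> 0"
    using assms(1) by (intro pm_rename_neq_0) (auto intro: inj_on_subset)
  ultimately show ?thesis by (auto simp: zero_mpoly.rep_eq)
qed

lemma ratfun_rename_Fract:
  fixes P Q :: "('v, 'k::field) mpoly"
  assumes "inj \<sigma>" "Q \<noteq> 0"
  shows "ratfun_rename \<sigma> (Fraction_Field.Fract P Q) = Fraction_Field.Fract (poly_rename \<sigma> P) (poly_rename \<sigma> Q)"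
  unfolding ratfun_rename_def
proof (rule the_equality)
  show "\<forall>P' Q'. Q' \<noteq> 0 \<longrightarrow> Fraction_Field.Fract P Q = Fraction_Field.Fract P' Q' \<longrightarrow>
      Fraction_Field.Fract (poly_rename \<sigma> P) (poly_rename \<sigma> Q) = Fraction_Field.Fract (poly_rename \<sigma> P') (poly_rename \<sigma> Q')"
    using assms by (simp add: eq_fract poly_rename_neq_0 flip: poly_rename_hom(4))
qed (use assms in blast)

lemma ratfun_rename_hom:
  fixes f :: "('v, 'k::field) ratfun"
  assumes "inj \<sigma>"
  shows "ratfun_rename \<sigma> (f + f') = ratfun_rename \<sigma> f + ratfun_rename \<sigma> f'"
    "ratfun_rename \<sigma> (f * f') = ratfun_rename \<sigma> f * ratfun_rename \<sigma> f'"
    "ratfun_rename \<sigma> (rconst c) = (rconst c :: ('v, 'k) ratfun)"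
    "ratfun_rename \<sigma> (rvar v) = (rvar (\<sigma> v) :: ('v, 'k) ratfun)"
proof -
  show "ratfun_rename \<sigma> (f + f') = ratfun_rename \<sigma> f + ratfun_rename \<sigma> f'"
    by (cases f; cases f')
      (simp add: ratfun_rename_Fract[OF assms] poly_rename_neq_0[OF assms] poly_rename_hom)
  show "ratfun_rename \<sigma> (f * f') = ratfun_rename \<sigma> f * ratfun_rename \<sigma> f'"
    by (cases f; cases f') (simp add: ratfun_rename_Fract[OF assms] poly_rename_hom)
  show "ratfun_rename \<sigma> (rconst c) = (rconst c :: ('v, 'k) ratfun)"
    by (simp add: rconst_def ratfun_rename_Fract[OF assms] poly_rename_hom)
  show "ratfun_rename \<sigma> (rvar v) = (rvar (\<sigma> v) :: ('v, 'k) ratfun)"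
    by (simp add: rvar_def ratfun_rename_Fract[OF assms] poly_rename_hom)
qed

lemma is_subfield_range_rconst: "is_subfield (range (rconst :: 'k::field \<Rightarrow> ('v, 'k) ratfun))"
proof -
  have C: "Const 0 = (0 :: ('v, 'k) mpoly)" "Const 1 = (1 :: ('v, 'k) mpoly)"
    "Const (x * y) = (Const x * Const y :: ('v, 'k) mpoly)"
    "Const (x - y) = (Const x - Const y :: ('v, 'k) mpoly)" for x y
    by (transfer; simp add: mult_single single_diff)+
  have r0: "(rconst 0 :: ('v, 'k) ratfun) = 0" and r1: "(rconst 1 :: ('v, 'k) ratfun) = 1"
    and d: "(rconst x - rconst y :: ('v, 'k) ratfun) = rconst (x - y)"
    and m: "(rconst x * rconst y :: ('v, 'k) ratfun) = rconst (x * y)" for x y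
    by (simp_all add: rconst_def C fract_collapse)
  have inv: "inverse (rconst x :: ('v, 'k) ratfun) = rconst (inverse x)" for x
  proof (cases "x = 0")
    case False
    then have "(rconst (inverse x) * rconst x :: ('v, 'k) ratfun) = 1" by (simp add: m r1)
    then show ?thesis by (metis inverse_unique mult.commute)
  qed (simp add: r0)
  show ?thesis
    unfolding is_subfield_def
  proof (intro conjI ballI)
    show "0 \<in> range (rconst :: 'k \<Rightarrow> ('v, 'k) ratfun)" by (metis r0 rangeI)
    show "1 \<in> range (rconst :: 'k \<Rightarrow> ('v, 'k) ratfun)" by (metis r1 rangeI)
  qed (auto simp: d m inv)
qed

lemma regular_action_hom:
  fixes f :: "('g, 'k::field) ratfun"
  assumes "group G" "g \<in> carrier G"
  shows "regular_action G g (f + f') = regular_action G g f + regular_action G g f'"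
    "regular_action G g (f * f') = regular_action G g f * regular_action G g f'"
    "regular_action G g (rconst c) = (rconst c :: ('g, 'k) ratfun)"
    "h \<in> carrier G \<Longrightarrow> regular_action G g (rvar h) = (rvar (g \<otimes>\<^bsub>G\<^esub> h) :: ('g, 'k) ratfun)"
proof -
  interpret group G by fact
  have "inj (\<lambda>h. if h \<in> carrier G then g \<otimes>\<^bsub>G\<^esub> h else h)"
    using assms(2) by (auto simp: inj_def)
  note * = ratfun_rename_hom[OF this]
  show "regular_action G g (f + f') = regular_action G g f + regular_action G g f'"
    "regular_action G g (f * f') = regular_action G g f * regular_action G g f'"
    "regular_action G g (rconst c) = (rconst c :: ('g, 'k) ratfun)"
    "h \<in> carrier G \<Longrightarrow> regular_action G g (rvar h) = (rvar (g \<otimes>\<^bsub>G\<^esub> h) :: ('g, 'k) ratfun)"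
    by (simp_all add: regular_action_def *)
qed


section \<open>Groups and roots of unity\<close>

definition group_exponent :: "('g, 'b) monoid_scheme \<Rightarrow> nat" where
  "group_exponent G = (LEAST m. 0 < m \<and> (\<forall>x\<in>carrier G. x [^]\<^bsub>G\<^esub> m = \<one>\<^bsub>G\<^esub>))"

definition internal_direct_product ::
    "('g, 'b) monoid_scheme \<Rightarrow> 'g set \<Rightarrow> 'i set \<Rightarrow> ('i \<Rightarrow> 'g set) \<Rightarrow> bool" where
  "internal_direct_product G H I Hs \<longleftrightarrow>
     (\<forall>j\<in>I. Hs j \<lhd> (G\<lparr>carrier := H\<rparr>)) \<and>
     H = generate G (\<Union>j\<in>I. Hs j) \<and>
     (\<forall>j\<in>I. Hs j \<inter> generate G (\<Union>i\<in>I - {j}. Hs i) = {\<one>\<^bsub>G\<^esub>})"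

definition primitive_root_of_unity :: "nat \<Rightarrow> 'k::field \<Rightarrow> bool" where
  "primitive_root_of_unity m \<zeta> \<longleftrightarrow>
     0 < m \<and> \<zeta> ^ m = 1 \<and> (\<forall>l. 0 < l \<and> l < m \<longrightarrow> \<zeta> ^ l \<noteq> 1)"

end

theory Submission
  imports
    "HOL-Algebra.Multiplicative_Group"
    "HOL-Library.Function_Algebras"
    "HOL-Computational_Algebra.Polynomial"
    Defs
begin

text \<open>Only the normal abelian subgroup \<open>H\<close> of index \<open>p\<close> matters, not the shape of its factors. Since the
  fixed field \<open>F\<close> has transcendence degree \<open>|G|\<close> over \<open>K\<close>, it is enough to generate it by \<open>|G|\<close> elements.

  Let \<open>K\<close> contain the roots of unity and let \<open>a\<close> generate \<open>G\<close> modulo \<open>H\<close>. The regular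
  representation has a basis of \<open>H\<close>-eigenvectors, which \<open>a\<close> permutes, up to constants, in orbits
  of length \<open>p\<close>. The \<open>H\<close>-invariant monomials in this basis generate the \<open>H\<close>-invariants, and their
  exponents form a sublattice of \<open>p\<close>-power index in a free \<open>\<int>[C\<^sub>p]\<close>-module. By induction on the index,
  such a lattice is generated by copies of \<open>\<int>\<close>, \<open>\<int>[C\<^sub>p]\<close> and \<open>\<int>[\<zeta>\<^sub>p]\<close> of total rank \<open>|G|\<close>. Each copy of \<open>\<int>[\<zeta>\<^sub>p]\<close>
  generates a field on which \<open>a\<close> acts in a linearizable way, so all generators can be replaced
  by eigenvectors of \<open>a\<close>. A lattice of monomials fixed by a diagonal action remains, which is free.

  In characteristic \<open>p\<close> the regular representation has a complete flag of invariant subspaces with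
  trivial successive quotients, and Miyata's lemma adds one generator per step.\<close>

text \<open>For a general lattice over \<int>[C_p] the argument would meet the ideal classes of
  \<int>[\<zeta>_p], a classical obstruction to the rationality of such fixed fields. Since the
  index is a power of p, the induction only passes through maximal submodules of index p; these
  contain (X - 1) M and p M, and the only prime ideal of \<int>[\<zeta>_p] that enters is the one
  generated by \<zeta>_p - 1, which is principal.

  The roots of unity serve three times: to diagonalize \<open>H\<close>; to extract p-th roots of
  the eigenvalues of the p-th power of \<open>a\<close>, so that \<open>a\<close> acts on exponents
  through C_p although it may have larger order; and to diagonalize the cyclic permutations obtained
  from the lattice. Oddness of p enters through the sign of -1 in the expansion of (X - 1)^p and
  through the divisibility of p (p - 1) / 2 by p in the twist that linearizes \<int>[\<zeta>_p].
  Where p vanishes, no such diagonalization is available; there the same expansion says that every g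
  - 1 is nilpotent, which produces the flag.\<close>

abbreviation adjoin :: "'l::field set \<Rightarrow> 'l set \<Rightarrow> 'l set" where
  "adjoin K S \<equiv> is_subfield hull (K \<union> S)"

section \<open>Subfields of the ambient field and adjunction\<close>

lemma is_subfieldI:
  assumes "0 \<in> F" "1 \<in> F" "\<And>x y. x \<in> F \<Longrightarrow> y \<in> F \<Longrightarrow> x - y \<in> F"
    "\<And>x y. x \<in> F \<Longrightarrow> y \<in> F \<Longrightarrow> x * y \<in> F" "\<And>x. x \<in> F \<Longrightarrow> inverse x \<in> F"
  shows "is_subfield F"
  using assms unfolding is_subfield_def by blast

lemma
  assumes "is_subfield F"
  shows subfield_0: "0 \<in> F" and subfield_1: "1 \<in> F"
    and subfield_diff: "x \<in> F \<Longrightarrow> y \<in> F \<Longrightarrow> x - y \<in> F"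
    and subfield_mult: "x \<in> F \<Longrightarrow> y \<in> F \<Longrightarrow> x * y \<in> F"
    and subfield_inverse: "x \<in> F \<Longrightarrow> inverse x \<in> F"
  using assms unfolding is_subfield_def by blast+

lemma subfield_uminus: "is_subfield F \<Longrightarrow> x \<in> F \<Longrightarrow> - x \<in> F"
  using subfield_diff[of F 0 x] subfield_0 by force

lemma subfield_add: "is_subfield F \<Longrightarrow> x \<in> F \<Longrightarrow> y \<in> F \<Longrightarrow> x + y \<in> F"
  using subfield_diff[of F x "- y"] subfield_uminus by force

lemma subfield_divide: "is_subfield F \<Longrightarrow> x \<in> F \<Longrightarrow> y \<in> F \<Longrightarrow> x / y \<in> F"
  by (simp add: divide_inverse subfield_mult subfield_inverse)

lemma subfield_power: "is_subfield F \<Longrightarrow> x \<in> F \<Longrightarrow> x ^ n \<in> F"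
  by (induction n) (auto intro: subfield_1 subfield_mult)

lemma subfield_power_int: "is_subfield F \<Longrightarrow> x \<in> F \<Longrightarrow> x powi n \<in> F"
  by (auto simp: power_int_def intro: subfield_power subfield_inverse)

lemma subfield_sum: "is_subfield F \<Longrightarrow> (\<And>i. i \<in> I \<Longrightarrow> f i \<in> F) \<Longrightarrow> sum f I \<in> F"
  by (induction I rule: infinite_finite_induct) (auto intro: subfield_0 subfield_add)

lemma subfield_prod: "is_subfield F \<Longrightarrow> (\<And>i. i \<in> I \<Longrightarrow> f i \<in> F) \<Longrightarrow> prod f I \<in> F"
  by (induction I rule: infinite_finite_induct) (auto intro: subfield_1 subfield_mult)

lemma subfield_of_nat: "is_subfield F \<Longrightarrow> of_nat n \<in> F"
  by (induction n) (auto intro: subfield_0 subfield_1 subfield_add)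

lemmas subfield_intros = subfield_0 subfield_1 subfield_diff subfield_mult subfield_inverse
  subfield_uminus subfield_add subfield_divide subfield_power subfield_power_int
  subfield_sum subfield_prod subfield_of_nat

lemma adjoin_insert: "adjoin K (insert x S) = adjoin (adjoin K S) {x}"
  using hull_Un_left[of is_subfield "K \<union> S" "{x}"] by (simp add: Un_commute)

lemma adjoin_subset_iff: "is_subfield F \<Longrightarrow> adjoin K S \<subseteq> F \<longleftrightarrow> K \<subseteq> F \<and> S \<subseteq> F"
  by (simp add: subset_hull)

lemma adjoin_base: "x \<in> K \<Longrightarrow> x \<in> adjoin K S" and adjoin_gen: "x \<in> S \<Longrightarrow> x \<in> adjoin K S"
  by (auto intro: hull_inc)

lemma adjoin_mono: "K \<subseteq> K' \<Longrightarrow> S \<subseteq> S' \<Longrightarrow> adjoin K S \<subseteq> adjoin K' S'"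
  by (intro hull_mono) auto

section \<open>Algebraic elements\<close>

definition polys_over :: "'l::field set \<Rightarrow> 'l poly set" where
  "polys_over F = {P. \<forall>i. Polynomial.coeff P i \<in> F}"

definition alg_over :: "'l::field set \<Rightarrow> 'l \<Rightarrow> bool" where
  "alg_over F x \<longleftrightarrow> (\<exists>P\<in>polys_over F. P \<noteq> 0 \<and> poly P x = 0)"

text \<open>Meaningful for finite \<open>S\<close> only: a sum over an infinite set is 0. Coinciding
  members of an indexed family are merged in \<open>S\<close>, which only lowers the bound on the
  dimension.\<close>

definition lin_span :: "'l::field set \<Rightarrow> 'l set \<Rightarrow> 'l set" where
  "lin_span F S = {\<Sum>s\<in>S. c s * s |c. \<forall>s\<in>S. c s \<in> F}"

lemma alg_over_mono: "F \<subseteq> F' \<Longrightarrow> alg_over F x \<Longrightarrow> alg_over F' x"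
  unfolding alg_over_def polys_over_def by blast

lemma polys_over_pCons [simp]: "pCons a P \<in> polys_over F \<longleftrightarrow> a \<in> F \<and> P \<in> polys_over F"
  unfolding polys_over_def by (auto simp: coeff_pCons split: nat.splits)

lemma polys_over_intros:
  assumes "is_subfield F"
  shows "0 \<in> polys_over F" "1 \<in> polys_over F"
    "P \<in> polys_over F \<Longrightarrow> Q \<in> polys_over F \<Longrightarrow> P + Q \<in> polys_over F"
    "P \<in> polys_over F \<Longrightarrow> Q \<in> polys_over F \<Longrightarrow> P - Q \<in> polys_over F"
    "P \<in> polys_over F \<Longrightarrow> Q \<in> polys_over F \<Longrightarrow> P * Q \<in> polys_over F"
    "c \<in> F \<Longrightarrow> P \<in> polys_over F \<Longrightarrow> smult c P \<in> polys_over F"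
    "c \<in> F \<Longrightarrow> Polynomial.monom c n \<in> polys_over F"
  using assms unfolding polys_over_def
  by (auto simp: coeff_1 coeff_mult coeff_monom intro!: subfield_intros)

lemma polys_over_sum:
  "is_subfield F \<Longrightarrow> (\<And>i. i \<in> I \<Longrightarrow> f i \<in> polys_over F) \<Longrightarrow> sum f I \<in> polys_over F"
  by (induction I rule: infinite_finite_induct) (auto intro: polys_over_intros)

lemma polys_over_prod:
  "is_subfield F \<Longrightarrow> (\<And>i. i \<in> I \<Longrightarrow> f i \<in> polys_over F) \<Longrightarrow> prod f I \<in> polys_over F"
  by (induction I rule: infinite_finite_induct) (auto intro: polys_over_intros)

lemma poly_in_subfield:
  "is_subfield E \<Longrightarrow> P \<in> polys_over E \<Longrightarrow> x \<in> E \<Longrightarrow> poly P x \<in> E"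
  by (induction P) (auto intro!: subfield_intros)

lemma polys_over_mono: "F \<subseteq> F' \<Longrightarrow> polys_over F \<subseteq> polys_over F'"
  unfolding polys_over_def by blast

lemma alg_over_base: "is_subfield F \<Longrightarrow> x \<in> F \<Longrightarrow> alg_over F x"
  unfolding alg_over_def
  by (rule bexI[of _ "[:- x, 1:]"]) (auto intro: polys_over_intros subfield_intros)

context
  fixes F :: "'l::field set"
  assumes F: "is_subfield F"
begin

lemma lin_span_add: "x \<in> lin_span F S \<Longrightarrow> y \<in> lin_span F S \<Longrightarrow> x + y \<in> lin_span F S"
  unfolding lin_span_def
proof clarify
  fix c d assume "\<forall>s\<in>S. c s \<in> F" "\<forall>s\<in>S. d s \<in> F"
  then show "\<exists>e. (\<Sum>s\<in>S. c s * s) + (\<Sum>s\<in>S. d s * s) = (\<Sum>s\<in>S. e s * s) \<and> (\<forall>s\<in>S. e s \<in> F)"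
    by (intro exI[of _ "\<lambda>s. c s + d s"]) (auto simp: sum.distrib distrib_right intro: subfield_add[OF F])
qed

lemma lin_span_scale: "a \<in> F \<Longrightarrow> x \<in> lin_span F S \<Longrightarrow> a * x \<in> lin_span F S"
  unfolding lin_span_def
proof clarify
  fix c assume "a \<in> F" "\<forall>s\<in>S. c s \<in> F"
  then show "\<exists>e. a * (\<Sum>s\<in>S. c s * s) = (\<Sum>s\<in>S. e s * s) \<and> (\<forall>s\<in>S. e s \<in> F)"
    by (intro exI[of _ "\<lambda>s. a * c s"])
      (auto simp: sum_distrib_left mult.assoc intro: subfield_mult[OF F])
qed

lemma lin_span_0: "0 \<in> lin_span F S"
  unfolding lin_span_def using subfield_0[OF F] by (auto intro!: exI[of _ "\<lambda>_. 0"])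

lemma lin_span_sum: "(\<And>i. i \<in> I \<Longrightarrow> f i \<in> lin_span F S) \<Longrightarrow> sum f I \<in> lin_span F S"
  by (induction I rule: infinite_finite_induct) (auto intro: lin_span_0 lin_span_add)

lemma lin_span_gen: "finite S \<Longrightarrow> s \<in> S \<Longrightarrow> s \<in> lin_span F S"
proof -
  assume "finite S" "s \<in> S"
  then have "s = (\<Sum>t\<in>S. (if t = s then 1 else 0) * t)"
    by (simp add: if_distrib[of "\<lambda>c. c * _"] cong: if_cong)
  then show ?thesis unfolding lin_span_def
    using subfield_0[OF F] subfield_1[OF F] by (auto intro!: exI[of _ "\<lambda>t. if t = s then 1 else 0"])
qed

lemma lin_span_insertD:
  assumes "finite S" "s \<notin> S" "x \<in> lin_span F (insert s S)"
  shows "\<exists>a\<in>F. x - a * s \<in> lin_span F S"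
proof -
  obtain c where c: "x = (\<Sum>t\<in>insert s S. c t * t)" "\<forall>t\<in>insert s S. c t \<in> F"
    using assms(3) unfolding lin_span_def by blast
  then have "x - c s * s = (\<Sum>t\<in>S. c t * t)" using assms(1,2) by simp
  then show ?thesis using c(2) unfolding lin_span_def by (intro bexI[of _ "c s"]) auto
qed

text \<open>Gaussian elimination, removing one element of the spanning set at a time. The vectors
  are an indexed family, so a repeated vector already counts as a relation; this matters for powers
  of an element that may coincide.\<close>

lemma linear_relation:
  assumes "finite S" "finite I" "card S < card I" "\<And>i. i \<in> I \<Longrightarrow> v i \<in> lin_span F S"
  shows "\<exists>c. (\<forall>i\<in>I. c i \<in> F) \<and> (\<exists>i\<in>I. c i \<noteq> 0) \<and> (\<Sum>i\<in>I. c i * v i) = 0"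
  using assms
proof (induction S arbitrary: I v rule: finite_induct)
  case empty
  then have "\<And>i. i \<in> I \<Longrightarrow> v i = 0" by (auto simp: lin_span_def)
  moreover have "I \<noteq> {}" using empty by auto
  ultimately show ?case by (intro exI[of _ "\<lambda>_. 1"]) (auto intro: subfield_1[OF F])
next
  case (insert s S)
  have "\<forall>i\<in>I. \<exists>a\<in>F. v i - a * s \<in> lin_span F S"
    using lin_span_insertD insert by blast
  then obtain a where a: "\<And>i. i \<in> I \<Longrightarrow> a i \<in> F" "\<And>i. i \<in> I \<Longrightarrow> v i - a i * s \<in> lin_span F S"
    by metis
  show ?case
  proof (cases "\<forall>i\<in>I. a i = 0")
    case True
    then have "\<And>i. i \<in> I \<Longrightarrow> v i \<in> lin_span F S" using a by fastforce
    then show ?thesis using insert.IH[of I v] insert by simp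
  next
    case False
    then obtain j where j: "j \<in> I" "a j \<noteq> 0" by blast
    define w where "w i = v i - a i / a j * v j" for i
    have "w i \<in> lin_span F S" if "i \<in> I" for i
    proof -
      have "w i = (v i - a i * s) + (- (a i / a j)) * (v j - a j * s)"
        using j by (simp add: w_def field_simps)
      moreover have "- (a i / a j) \<in> F" using a that j by (intro subfield_uminus subfield_divide F)
      ultimately show ?thesis using a(2)[OF that] a(2)[OF j(1)] lin_span_add lin_span_scale by presburger
    qed
    moreover have "card S < card (I - {j})" using insert j by simp
    ultimately obtain c where c: "\<forall>i\<in>I-{j}. c i \<in> F" "\<exists>i\<in>I-{j}. c i \<noteq> 0"
      "(\<Sum>i\<in>I-{j}. c i * w i) = 0"
      using insert.IH[of "I - {j}" w] insert by auto
    \<comment> \<open>The pivot \<open>j\<close> receives the coefficient that cancels the multiples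
      of \<open>v j\<close> subtracted in the \<open>w i\<close>.\<close>
    define d where "d = (\<lambda>i. if i = j then - (\<Sum>i\<in>I-{j}. c i * (a i / a j)) else c i)"
    have "(\<Sum>i\<in>I. d i * v i) = d j * v j + (\<Sum>i\<in>I-{j}. c i * v i)"
      using j insert by (subst sum.remove[of _ j]) (auto simp: d_def)
    also have "(\<Sum>i\<in>I-{j}. c i * v i) = (\<Sum>i\<in>I-{j}. c i * w i) + (\<Sum>i\<in>I-{j}. c i * (a i / a j)) * v j"
      by (simp add: w_def right_diff_distrib sum_subtractf sum_distrib_right mult.assoc)
    finally have "(\<Sum>i\<in>I. d i * v i) = 0" using c(3) by (simp add: d_def)
    moreover have "\<forall>i\<in>I. d i \<in> F" using c(1) a j by (auto simp: d_def intro!: subfield_intros[OF F])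
    moreover have "\<exists>i\<in>I. d i \<noteq> 0" using c(2) by (auto simp: d_def)
    ultimately show ?thesis by blast
  qed
qed

text \<open>All powers of \<open>y\<close> stay in the span, and \<open>card S + 1\<close> of them
  cannot be linearly independent.\<close>

lemma alg_over_if_stable:
  assumes "finite S" "1 \<in> lin_span F S" "\<And>s. s \<in> S \<Longrightarrow> y * s \<in> lin_span F S"
  shows "alg_over F y"
proof -
  have pow: "y ^ j \<in> lin_span F S" for j
  proof (induction j)
    case (Suc j)
    then obtain c where "y ^ j = (\<Sum>s\<in>S. c s * s)" "\<forall>s\<in>S. c s \<in> F" unfolding lin_span_def by blast
    then have "y ^ Suc j = (\<Sum>s\<in>S. c s * (y * s))" by (simp add: sum_distrib_left algebra_simps)
    then show ?case using assms(3) \<open>\<forall>s\<in>S. c s \<in> F\<close> by (simp only:) (blast intro: lin_span_sum lin_span_scale)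
  qed (use assms in simp)
  obtain c where c: "\<forall>i\<le>card S. c i \<in> F" "\<exists>i\<le>card S. c i \<noteq> 0" "(\<Sum>i\<le>card S. c i * y ^ i) = 0"
    using linear_relation[of S "{..card S}" "\<lambda>i. y ^ i"] pow assms(1) by auto
  define P where "P = (\<Sum>i\<le>card S. Polynomial.monom (c i) i)"
  have "P \<in> polys_over F" using c(1) by (auto simp: P_def intro!: polys_over_sum[OF F] polys_over_intros[OF F])
  moreover have "P \<noteq> 0"
  proof -
    obtain i where i: "i \<le> card S" "c i \<noteq> 0" using c(2) by blast
    then have "Polynomial.coeff P i = c i" by (simp add: P_def coeff_sum coeff_monom)
    then show ?thesis using i by auto
  qed
  moreover have "poly P y = 0" using c(3) by (simp add: P_def poly_sum poly_monom)
  ultimately show ?thesis unfolding alg_over_def by blast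
qed

text \<open>\<open>n\<close> is the degree of any annihilating polynomial, which need not be
  minimal: the power \<open>y ^ n\<close> reduces to lower ones, so multiplication by
  \<open>y\<close> preserves the span of those below \<open>n\<close>.\<close>

lemma poly_in_lin_span:
  assumes "alg_over F y"
  obtains n where "0 < n" "\<And>P. P \<in> polys_over F \<Longrightarrow> poly P y \<in> lin_span F ((\<lambda>i. y ^ i) ` {..<n})"
proof -
  obtain A where A: "A \<in> polys_over F" "A \<noteq> 0" "poly A y = 0"
    using assms unfolding alg_over_def by blast
  let ?n = "Polynomial.degree A" and ?a = "lead_coeff A"
  let ?S = "(\<lambda>i. y ^ i) ` {..<?n}"
  have n: "0 < ?n"
  proof (rule ccontr)
    assume "\<not> 0 < ?n"
    then obtain a where "A = [:a:]" by (metis degree_eq_zeroE gr0I)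
    then show False using A by simp
  qed
  have "?a \<noteq> 0" using A by simp
  have "(\<Sum>i\<le>?n. Polynomial.coeff A i * y ^ i) = 0" using A(3) by (simp add: poly_altdef)
  moreover have "{..?n} = insert ?n {..<?n}" by auto
  ultimately have "?a * y ^ ?n = - (\<Sum>i<?n. Polynomial.coeff A i * y ^ i)"
    by (simp add: eq_neg_iff_add_eq_0)
  then have "y ^ ?n = inverse ?a * - (\<Sum>i<?n. Polynomial.coeff A i * y ^ i)"
    using \<open>?a \<noteq> 0\<close> by (simp add: field_simps)
  also have "\<dots> = (\<Sum>i<?n. - (inverse ?a * Polynomial.coeff A i) * y ^ i)"
    by (simp add: sum_distrib_left sum_negf mult.assoc)
  finally have top_eq: "y ^ ?n = (\<Sum>i<?n. - (inverse ?a * Polynomial.coeff A i) * y ^ i)" .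
  have top: "y ^ ?n \<in> lin_span F ?S"
    unfolding top_eq
  proof (intro lin_span_sum lin_span_scale lin_span_gen)
    fix i
    show "- (inverse ?a * Polynomial.coeff A i) \<in> F"
      using A(1) by (auto simp: polys_over_def intro!: subfield_intros[OF F])
  qed auto
  have step: "y * x \<in> lin_span F ?S" if x: "x \<in> lin_span F ?S" for x
  proof -
    obtain c where c: "x = (\<Sum>s\<in>?S. c s * s)" "\<forall>s\<in>?S. c s \<in> F" using x unfolding lin_span_def by blast
    have "y * s \<in> lin_span F ?S" if s: "s \<in> ?S" for s
    proof -
      obtain i where i: "i < ?n" "s = y ^ i" using s by blast
      show ?thesis
      proof (cases "Suc i = ?n")
        case True then show ?thesis using top i by (metis power_Suc)
      next
        case False
        then have "y * s \<in> ?S" using i by (auto intro!: image_eqI[of _ _ "Suc i"])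
        then show ?thesis by (intro lin_span_gen) auto
      qed
    qed
    moreover have "y * x = (\<Sum>s\<in>?S. c s * (y * s))" by (simp add: c sum_distrib_left algebra_simps)
    ultimately show ?thesis using c(2) by (simp only:) (blast intro: lin_span_sum lin_span_scale)
  qed
  have "1 \<in> ?S" using n by (auto intro!: image_eqI[of _ _ 0])
  then have one: "1 \<in> lin_span F ?S" by (intro lin_span_gen) auto
  have "poly P y \<in> lin_span F ?S" if "P \<in> polys_over F" for P
    using that
  proof (induction P)
    case (pCons a P)
    then have "a * 1 + y * poly P y \<in> lin_span F ?S"
      by (intro lin_span_add lin_span_scale one step) auto
    then show ?case by simp
  qed (simp add: lin_span_0)
  then show ?thesis using that n by blast
qed

text \<open>The polynomials in \<open>y\<close> already form a field: each of them preserves a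
  finite span, is therefore algebraic, and so has a polynomial inverse.\<close>

lemma alg_adjoin:
  assumes "alg_over F y" "z \<in> adjoin F {y}"
  shows "\<exists>P\<in>polys_over F. z = poly P y"
proof -
  let ?R = "{poly P y |P. P \<in> polys_over F}"
  note R = polys_over_intros[OF F]
  obtain n where n: "0 < n" "\<And>P. P \<in> polys_over F \<Longrightarrow> poly P y \<in> lin_span F ((\<lambda>i. y ^ i) ` {..<n})"
    using poly_in_lin_span[OF assms(1)] by metis
  have mult: "u * w \<in> ?R" if "u \<in> ?R" "w \<in> ?R" for u w
    using that by (smt (verit) mem_Collect_eq R(5) poly_mult)
  have diff: "u - w \<in> ?R" if "u \<in> ?R" "w \<in> ?R" for u w
    using that by (smt (verit) mem_Collect_eq R(4) poly_diff)
  have const: "a \<in> ?R" if "a \<in> F" for a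
    using that R(1) by (auto intro!: exI[of _ "[:a:]"])
  have "is_subfield ?R"
  proof (rule is_subfieldI)
    show "0 \<in> ?R" "1 \<in> ?R" using const subfield_0[OF F] subfield_1[OF F] by blast+
    fix u assume u: "u \<in> ?R"
    show "inverse u \<in> ?R"
    proof (cases "u = 0")
      case True then show ?thesis using \<open>0 \<in> ?R\<close> by simp
    next
      case False
      have "alg_over F u"
      proof (rule alg_over_if_stable)
        show "1 \<in> lin_span F ((\<lambda>i. y ^ i) ` {..<n})" using n(2)[of 1] R(2) by simp
        fix s assume "s \<in> (\<lambda>i. y ^ i) ` {..<n}"
        then obtain i where "s = poly (Polynomial.monom 1 i) y" by (auto simp: poly_monom)
        moreover obtain P where "P \<in> polys_over F" "u = poly P y" using u by blast
        ultimately have "u * s = poly (P * Polynomial.monom 1 i) y" "P * Polynomial.monom 1 i \<in> polys_over F"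
          using R(5)[OF _ R(7)] subfield_1[OF F] by auto
        then show "u * s \<in> lin_span F ((\<lambda>i. y ^ i) ` {..<n})" using n(2) by metis
      qed simp
      then obtain A where A: "A \<in> polys_over F" "A \<noteq> 0" "poly A u = 0" unfolding alg_over_def by blast
      \<comment> \<open>Dividing out powers of the variable leaves a relation with nonzero constant
        term \<open>a\<close>, from which \<open>inverse u\<close> is read off.\<close>
      then have "\<exists>a A'. a \<in> F \<and> a \<noteq> 0 \<and> A' \<in> polys_over F \<and> a + u * poly A' u = 0"
      proof (induction A)
        case (pCons a A)
        show ?case
        proof (cases "a = 0")
          case True
          then show ?thesis using pCons False by auto
        next
          case False
          then show ?thesis using pCons.prems by auto
        qed
      qed simp
      then obtain a A' where A': "a \<in> F" "a \<noteq> 0" "A' \<in> polys_over F" "a + u * poly A' u = 0" by blast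
      have "poly A' u \<in> ?R" using A'(3)
      proof (induction A')
        case (pCons b B)
        then have "b - (0 - u * poly B u) \<in> ?R" using const u \<open>0 \<in> ?R\<close> by (intro diff mult) auto
        then show ?case by simp
      qed (use \<open>0 \<in> ?R\<close> in simp)
      moreover have "inverse u = (0 - inverse a) * poly A' u"
      proof -
        have "u * poly A' u = - a" using A'(4) by (simp add: add_eq_0_iff)
        then have "u * ((0 - inverse a) * poly A' u) = 1" using A'(2)
          by (simp add: mult.left_commute[of u])
        then show ?thesis using inverse_unique by blast
      qed
      moreover have "inverse a \<in> ?R" using const subfield_inverse[OF F A'(1)] by blast
      ultimately show ?thesis by (simp only:) (intro mult diff \<open>0 \<in> ?R\<close>)
    qed
  qed (use mult diff in blast)+
  moreover have "y \<in> ?R" using subfield_0[OF F] subfield_1[OF F] R(1) by (auto intro!: exI[of _ "[:0, 1:]"])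
  ultimately have "adjoin F {y} \<subseteq> ?R" using const by (subst adjoin_subset_iff) blast+
  then show ?thesis using assms(2) by blast
qed

text \<open>As for the multiplicativity of degrees: the products \<open>x ^ i * y ^ j\<close> span a
  space stable under \<open>y\<close>.\<close>

lemma alg_over_trans_single:
  assumes "alg_over F x" "alg_over (adjoin F {x}) y"
  shows "alg_over F y"
proof -
  let ?E = "adjoin F {x}"
  have E: "is_subfield ?E" by (rule is_subfield_hull)
  obtain n where n: "0 < n" "\<And>P. P \<in> polys_over F \<Longrightarrow> poly P x \<in> lin_span F ((\<lambda>i. x ^ i) ` {..<n})"
    using poly_in_lin_span[OF assms(1)] by metis
  obtain m where m: "0 < m" "\<And>P. P \<in> polys_over ?E \<Longrightarrow> poly P y \<in> lin_span ?E ((\<lambda>i. y ^ i) ` {..<m})"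
    using Submission.poly_in_lin_span[OF E assms(2)] by metis
  let ?S = "(\<lambda>(i, j). x ^ i * y ^ j) ` ({..<n} \<times> {..<m})"
  have E1: "e * y ^ j \<in> lin_span F ?S" if "e \<in> ?E" "j < m" for e j
  proof -
    have "e \<in> lin_span F ((\<lambda>i. x ^ i) ` {..<n})" using alg_adjoin[OF assms(1) that(1)] n(2) by blast
    then obtain c where c: "e = (\<Sum>s\<in>(\<lambda>i. x ^ i) ` {..<n}. c s * s)" "\<forall>s\<in>(\<lambda>i. x ^ i) ` {..<n}. c s \<in> F"
      unfolding lin_span_def by blast
    have "e * y ^ j = (\<Sum>s\<in>(\<lambda>i. x ^ i) ` {..<n}. c s * (s * y ^ j))" by (simp add: c(1) sum_distrib_right mult.assoc)
    moreover have "s * y ^ j \<in> lin_span F ?S" if "s \<in> (\<lambda>i. x ^ i) ` {..<n}" for s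
      using that \<open>j < m\<close> by (intro lin_span_gen) auto
    ultimately show ?thesis using c(2) by (simp only:) (blast intro: lin_span_sum lin_span_scale)
  qed
  have P: "poly P y \<in> lin_span F ?S" if "P \<in> polys_over ?E" for P
  proof -
    obtain c where c: "poly P y = (\<Sum>s\<in>(\<lambda>i. y ^ i) ` {..<m}. c s * s)" "\<forall>s\<in>(\<lambda>i. y ^ i) ` {..<m}. c s \<in> ?E"
      using m(2)[OF \<open>P \<in> polys_over ?E\<close>] unfolding lin_span_def by blast
    show ?thesis unfolding c(1) using c(2) E1 by (intro lin_span_sum) fastforce
  qed
  show ?thesis
  proof (rule alg_over_if_stable)
    show "1 \<in> lin_span F ?S" using P[of 1] polys_over_intros(2)[OF E] by simp
    fix s assume "s \<in> ?S"
    then obtain i j where s: "s = x ^ i * y ^ j" by auto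
    have "y * s = poly (Polynomial.monom (x ^ i) (Suc j)) y" by (simp add: s poly_monom algebra_simps)
    moreover have "x ^ i \<in> ?E" by (intro subfield_power[OF E] adjoin_gen) auto
    ultimately show "y * s \<in> lin_span F ?S" using P polys_over_intros(7)[OF E] by metis
  qed simp
qed

text \<open>No nonzero polynomial vanishes at a transcendental \<open>x\<close>, so the quotients
  are closed under the field operations.\<close>

lemma adjoin_single_fraction:
  assumes "z \<in> adjoin F {x}" "\<not> alg_over F x"
  shows "\<exists>P Q. P \<in> polys_over F \<and> Q \<in> polys_over F \<and> Q \<noteq> 0 \<and> z = poly P x / poly Q x"
proof -
  note R = polys_over_intros[OF F]
  let ?R = "{poly P x / poly Q x |P Q. P \<in> polys_over F \<and> Q \<in> polys_over F \<and> Q \<noteq> 0}"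
  have nz: "poly Q x \<noteq> 0" if "Q \<in> polys_over F" "Q \<noteq> 0" for Q
    using assms(2) that unfolding alg_over_def by blast
  have const: "a \<in> ?R" if "a \<in> F" for a
    using that R(1,2) by (intro CollectI exI[of _ "[:a:]"] exI[of _ 1]) auto
  have "is_subfield ?R"
  proof (rule is_subfieldI)
    show "0 \<in> ?R" "1 \<in> ?R" using const subfield_0[OF F] subfield_1[OF F] by blast+
    fix u assume "u \<in> ?R"
    then obtain P Q where u: "u = poly P x / poly Q x" "P \<in> polys_over F" "Q \<in> polys_over F" "Q \<noteq> 0" by blast
    show "inverse u \<in> ?R"
    proof (cases "P = 0")
      case True
      then show ?thesis using u \<open>0 \<in> ?R\<close> by auto
    next
      case False
      then show ?thesis using u by (intro CollectI exI[of _ Q] exI[of _ P]) auto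
    qed
    fix w assume "w \<in> ?R"
    then obtain P' Q' where w: "w = poly P' x / poly Q' x" "P' \<in> polys_over F" "Q' \<in> polys_over F" "Q' \<noteq> 0" by blast
    have "u - w = poly (P * Q' - P' * Q) x / poly (Q * Q') x" using u w nz by (simp add: diff_frac_eq)
    moreover have "P * Q' - P' * Q \<in> polys_over F" "Q * Q' \<in> polys_over F" "Q * Q' \<noteq> 0"
      using u w by (auto intro!: R)
    ultimately show "u - w \<in> ?R" by blast
    have "u * w = poly (P * P') x / poly (Q * Q') x" using u w by simp
    moreover have "P * P' \<in> polys_over F" using u w by (auto intro!: R)
    ultimately show "u * w \<in> ?R" using \<open>Q * Q' \<in> polys_over F\<close> \<open>Q * Q' \<noteq> 0\<close> by blast
  qed
  moreover have "x \<in> ?R" using subfield_0[OF F] subfield_1[OF F] R(1,2)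
    by (intro CollectI exI[of _ "[:0, 1:]"] exI[of _ 1]) auto
  ultimately have "adjoin F {x} \<subseteq> ?R" using const by (subst adjoin_subset_iff) blast+
  then show ?thesis using assms(1) by blast
qed

end

text \<open>Stated for an evaluation \<open>x\<close> and a multiplication \<open>m\<close> of
  representatives, so that it serves both polynomials evaluated at a point and polynomials embedded
  in their field of fractions.\<close>

lemma common_denominator:
  fixes n :: nat and x :: "'c \<Rightarrow> 'l::field"
  assumes "\<And>i. i \<le> n \<Longrightarrow> a i \<in> {x P / x Q |P Q. P \<in> R \<and> Q \<in> D}"
    and "\<And>P Q. P \<in> R \<Longrightarrow> Q \<in> D \<Longrightarrow> m P Q \<in> R \<and> x (m P Q) = x P * x Q"
    and "\<And>P Q. P \<in> D \<Longrightarrow> Q \<in> D \<Longrightarrow> m P Q \<in> D \<and> x (m P Q) = x P * x Q"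
    and "\<And>Q. Q \<in> D \<Longrightarrow> x Q \<noteq> 0"
  shows "\<exists>N Q. Q \<in> D \<and> (\<forall>i\<le>n. N i \<in> R \<and> a i = x (N i) / x Q)"
  using assms(1)
proof (induction n)
  case 0
  then obtain P Q where "a 0 = x P / x Q" "P \<in> R" "Q \<in> D" by blast
  then show ?case by (intro exI[of _ "\<lambda>_. P"] exI[of _ Q]) auto
next
  case (Suc n)
  then obtain N Q where NQ: "Q \<in> D" "\<And>i. i \<le> n \<Longrightarrow> N i \<in> R \<and> a i = x (N i) / x Q" by auto
  obtain P Q' where P: "a (Suc n) = x P / x Q'" "P \<in> R" "Q' \<in> D" using Suc.prems[of "Suc n"] by blast
  define N' where "N' i = (if i = Suc n then m P Q else m (N i) Q')" for i
  have "N' i \<in> R \<and> a i = x (N' i) / x (m Q Q')" if "i \<le> Suc n" for i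
  proof (cases "i = Suc n")
    case True
    then show ?thesis using P NQ(1) assms(2)[of P Q] assms(3)[of Q Q'] assms(4)[of Q] by (simp add: N'_def)
  next
    case False
    then show ?thesis using that P NQ assms(2)[of "N i" Q'] assms(3)[of Q Q'] assms(4)[of Q']
      by (simp add: N'_def)
  qed
  moreover have "m Q Q' \<in> D" using NQ(1) P assms(3) by blast
  ultimately show ?case by blast
qed

text \<open>A relation for \<open>y\<close> with coefficients in F(x) becomes, after clearing
  denominators, a polynomial relation between \<open>x\<close> and \<open>y\<close>, which is then
  read as one for \<open>x\<close> with coefficients in F(y).\<close>

lemma alg_over_exchange:
  assumes F: "is_subfield F" and y: "alg_over (adjoin F {x}) y" "\<not> alg_over F y"
  shows "alg_over (adjoin F {y}) x"
proof (cases "alg_over F x")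
  case True
  then show ?thesis using alg_over_trans_single[OF F] y by blast
next
  case False
  note R = polys_over_intros[OF F]
  let ?E = "adjoin F {y}"
  have E: "is_subfield ?E" by (rule is_subfield_hull)
  obtain A where A: "A \<in> polys_over (adjoin F {x})" "A \<noteq> 0" "poly A y = 0"
    using y(1) unfolding alg_over_def by blast
  let ?n = "Polynomial.degree A" and ?D = "polys_over F - {0}"
  have nz: "poly Q x \<noteq> 0" if "Q \<in> ?D" for Q
    using False that unfolding alg_over_def by blast
  have "Polynomial.coeff A i \<in> {poly P x / poly Q x |P Q. P \<in> polys_over F \<and> Q \<in> ?D}" for i
    using adjoin_single_fraction[OF F _ False] A(1) unfolding polys_over_def[of "adjoin F {x}"] by blast
  then obtain N Q where N: "Q \<in> ?D" "\<And>i. i \<le> ?n \<Longrightarrow> N i \<in> polys_over F \<and> Polynomial.coeff A i = poly (N i) x / poly Q x"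
    using common_denominator[of ?n "Polynomial.coeff A" "\<lambda>P. poly P x" "polys_over F" ?D "(*)"] R(5) nz
    by auto
  define B where "B = (\<Sum>j\<le>?n. smult (y ^ j) (N j))"
  have "B \<in> polys_over ?E"
    unfolding B_def
  proof (intro polys_over_sum[OF E] polys_over_intros[OF E] subfield_power[OF E])
    show "y \<in> ?E" by (rule adjoin_gen) simp
    show "N i \<in> polys_over ?E" if "i \<in> {..?n}" for i
      using N(2)[of i] that polys_over_mono[of F ?E] adjoin_base by blast
  qed
  moreover have "poly B x = 0"
  proof -
    have "poly B x = (\<Sum>j\<le>?n. y ^ j * (Polynomial.coeff A j * poly Q x))"
      using N nz by (auto simp: B_def poly_sum intro!: sum.cong)
    also have "\<dots> = poly A y * poly Q x"
      by (simp add: poly_altdef[of A] sum_distrib_left sum_distrib_right algebra_simps)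
    finally show ?thesis using A(3) by simp
  qed
  \<comment> \<open>A coefficient of \<open>B\<close> is the value at \<open>y\<close> of a nonzero
    polynomial \<open>C\<close> over \<open>F\<close>, and \<open>y\<close> is transcendental over
    \<open>F\<close>.\<close>
  moreover have "B \<noteq> 0"
  proof -
    have "N ?n \<noteq> 0" using N(2)[of ?n] A(2) by auto
    then obtain i where i: "Polynomial.coeff (N ?n) i \<noteq> 0" by (meson leading_coeff_0_iff)
    define C where "C = (\<Sum>j\<le>?n. Polynomial.monom (Polynomial.coeff (N j) i) j)"
    have "Polynomial.coeff C ?n \<noteq> 0" using i by (simp add: C_def coeff_sum coeff_monom)
    then have "C \<noteq> 0" by auto
    moreover have "C \<in> polys_over F"
      using N(2) unfolding C_def polys_over_def[of F]
      by (intro polys_over_sum[OF F, unfolded polys_over_def] R(7)[unfolded polys_over_def]) auto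
    ultimately have "poly C y \<noteq> 0" using y(2) unfolding alg_over_def by blast
    moreover have "poly C y = Polynomial.coeff B i"
      by (simp add: C_def B_def poly_sum poly_monom coeff_sum mult.commute)
    ultimately show ?thesis by auto
  qed
  ultimately show ?thesis unfolding alg_over_def by blast
qed

text \<open>Steinitz exchange: an element of \<open>C\<close> outside \<open>A\<close> is either
  redundant or can be traded for some \<open>a\<close> in \<open>A\<close> that is not algebraic
  without it; either way fewer elements of \<open>C\<close> lie outside \<open>A\<close>. Once
  \<open>C\<close> is contained in \<open>A\<close>, independence forces equality.\<close>

lemma exchange_card:
  fixes K :: "'l::field set"
  assumes "finite A" "finite C"
    and indep: "\<And>a. a \<in> A \<Longrightarrow> \<not> alg_over (adjoin K (A - {a})) a"
    and span: "\<And>a. a \<in> A \<Longrightarrow> alg_over (adjoin K C) a"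
  shows "card A \<le> card C"
  using assms(2,4)
proof (induction "card (C - A)" arbitrary: C rule: less_induct)
  case less
  show ?case
  proof (cases "C \<subseteq> A")
    case True
    have "a \<in> C" if a: "a \<in> A" for a
    proof (rule ccontr)
      assume "a \<notin> C"
      then have "adjoin K C \<subseteq> adjoin K (A - {a})" using True by (intro adjoin_mono) auto
      then show False using alg_over_mono less.prems(2)[OF a] indep[OF a] by blast
    qed
    then show ?thesis by (intro card_mono less.prems) auto
  next
    case False
    then obtain c where c: "c \<in> C" "c \<notin> A" by blast
    let ?C = "C - {c}"
    have fin: "finite (C - A)" "c \<in> C - A" using less.prems c by auto
    show ?thesis
    proof (cases "\<forall>a\<in>A. alg_over (adjoin K ?C) a")
      case True
      have "card (?C - A) < card (C - A)"
        using fin by (intro psubset_card_mono) auto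
      then have "card A \<le> card ?C" using less.hyps[of ?C] less.prems(1) True by blast
      then show ?thesis using card_mono[of C ?C] less.prems(1) by force
    next
      case False
      then obtain a where a: "a \<in> A" "\<not> alg_over (adjoin K ?C) a" by blast
      have "a \<notin> C"
      proof
        assume "a \<in> C"
        then have "a \<in> ?C" using c a by auto
        then have "a \<in> adjoin K ?C" by (rule adjoin_gen)
        then show False using a(2) alg_over_base[OF is_subfield_hull] by blast
      qed
      let ?C' = "insert a ?C"
      have "adjoin K C = adjoin (adjoin K ?C) {c}" using adjoin_insert[of K c ?C] c(1) by (simp add: insert_absorb)
      then have "alg_over (adjoin (adjoin K ?C) {c}) a" using less.prems(2)[OF a(1)] by simp
      then have ca: "alg_over (adjoin K ?C') c"
        using alg_over_exchange[OF is_subfield_hull _ a(2)] adjoin_insert by metis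
      have "alg_over (adjoin K ?C') b" if b: "b \<in> A" for b
      proof (rule alg_over_trans_single[OF is_subfield_hull ca])
        have "adjoin K C \<subseteq> adjoin K (insert c ?C')" by (intro adjoin_mono) auto
        then have "alg_over (adjoin K (insert c ?C')) b" using less.prems(2)[OF b] alg_over_mono by blast
        then show "alg_over (adjoin (adjoin K ?C') {c}) b" using adjoin_insert by metis
      qed
      moreover have "card (?C' - A) < card (C - A)"
        using fin a c by (intro psubset_card_mono) auto
      ultimately have "card A \<le> card ?C'" using less.hyps[of ?C'] less.prems(1) by blast
      moreover have "card ?C' = card C" using c \<open>a \<notin> C\<close> less.prems(1)
        using card_Suc_Diff1[of C c] by simp
      ultimately show ?thesis by simp
    qed
  qed
qed

text \<open>If some \<open>c\<close> were algebraic over the rest of \<open>C\<close>, the rest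
  would still span \<open>A\<close> with too few elements. Independence of generators thus becomes a
  matter of counting.\<close>

lemma spanning_independent:
  fixes K :: "'l::field set"
  assumes "finite A" "finite C" "card C \<le> card A"
    and indep: "\<And>a. a \<in> A \<Longrightarrow> \<not> alg_over (adjoin K (A - {a})) a"
    and span: "\<And>a. a \<in> A \<Longrightarrow> alg_over (adjoin K C) a"
  shows "card C = card A" "c \<in> C \<Longrightarrow> \<not> alg_over (adjoin K (C - {c})) c"
proof -
  show "card C = card A" using exchange_card[OF assms(1,2) indep span] assms(3) by linarith
  assume c: "c \<in> C"
  show "\<not> alg_over (adjoin K (C - {c})) c"
  proof
    assume alg: "alg_over (adjoin K (C - {c})) c"
    have "alg_over (adjoin K (C - {c})) a" if a: "a \<in> A" for a
    proof (rule alg_over_trans_single[OF is_subfield_hull alg])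
      show "alg_over (adjoin (adjoin K (C - {c})) {c}) a"
        using span[OF a] c adjoin_insert[of K c "C - {c}"] by (simp add: insert_absorb)
    qed
    then have "card A \<le> card (C - {c})" by (intro exchange_card indep) (use assms in auto)
    moreover have "card (C - {c}) < card C" using c assms(2) by (intro psubset_card_mono) auto
    ultimately show False using assms(3) by linarith
  qed
qed

section \<open>Polynomial relations\<close>

lemma poly_eval_Const_monom:
  assumes "finite V" "vars P \<subseteq> V"
  shows "poly_eval c a P = (\<Sum>m\<in>Poly_Mapping.keys (Defs.coeffs P). c (Defs.coeff P m) * (\<Prod>v\<in>V. a v ^ Poly_Mapping.lookup m v))"
  unfolding poly_eval.rep_eq pm_eval_def Defs.coeff_def
  by (intro sum.cong arg_cong2[of _ _ _ _ "(*)"] monom_eval_superset refl assms(1))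
    (use assms(2) in \<open>auto simp: vars_def\<close>)

text \<open>Sorting the monomials of a relation by their degree in one variable shows that either this
  variable is algebraic over the others or the others are dependent.\<close>

lemma algebraically_independentI:
  fixes K :: "'l::field set"
  assumes "is_subfield K" "finite B" "\<And>b. b \<in> B \<Longrightarrow> \<not> alg_over (adjoin K (B - {b})) b"
  shows "algebraically_independent K B"
  using assms(2,3)
proof (induction B rule: finite_induct)
  case empty
  show ?case
    unfolding algebraically_independent_def
  proof (intro allI impI)
    fix P :: "('l, 'l) mpoly"
    assume P: "range (Defs.coeff P) \<subseteq> K" "vars P \<subseteq> {}" "poly_eval (\<lambda>c. c) (\<lambda>b. b) P = 0"
    have keys: "Poly_Mapping.keys (Defs.coeffs P) \<subseteq> {0}" using P(2) by (auto simp: vars_def)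
    have " Defs.coeffs P = 0"
    proof (rule ccontr)
      assume " Defs.coeffs P \<noteq> 0"
      then have "Poly_Mapping.keys (Defs.coeffs P) = {0}" using keys keys_eq_empty subset_singletonD by metis
      then show False using P(3) poly_eval_Const_monom[of "{}" P "\<lambda>c. c" "\<lambda>b. b"] P(2)
        by (auto simp: Defs.coeff_def in_keys_iff)
    qed
    then show "P = 0" by transfer
  qed
next
  case (insert b B)
  have "\<not> alg_over (adjoin K (B - {a})) a" if "a \<in> B" for a
  proof -
    have "adjoin K (B - {a}) \<subseteq> adjoin K (insert b B - {a})" by (intro adjoin_mono) auto
    then show ?thesis using insert.prems[of a] that alg_over_mono by blast
  qed
  then have IH: "algebraically_independent K B" using insert.IH by blast
  show ?case
    unfolding algebraically_independent_def
  proof (intro allI impI)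
    fix P :: "('l, 'l) mpoly"
    assume P: "range (Defs.coeff P) \<subseteq> K" "vars P \<subseteq> insert b B" "poly_eval (\<lambda>c. c) (\<lambda>b. b) P = 0"
    let ?keys = "Poly_Mapping.keys (Defs.coeffs P)"
    define E where "E = adjoin K B"
    have E: "is_subfield E" unfolding E_def by (rule is_subfield_hull)
    have "insert b B - {b} = B" using insert.hyps by auto
    then have b: "\<not> alg_over E b" using insert.prems[of b] unfolding E_def by simp
    define mon where "mon m = (\<Prod>v\<in>B. v ^ Poly_Mapping.lookup m v)" for m :: "'l \<Rightarrow>\<^sub>0 nat"
    define Q where "Q = (\<Sum>m\<in>?keys. Polynomial.monom (Defs.coeff P m * mon m) (Poly_Mapping.lookup m b))"
    have "Q \<in> polys_over E"
      unfolding Q_def mon_def using P(1)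
      by (intro polys_over_sum[OF E] polys_over_intros[OF E] subfield_mult[OF E] subfield_prod[OF E] subfield_power[OF E])
        (auto simp: E_def intro: adjoin_base adjoin_gen)
    moreover have "poly Q b = 0"
      using P(3) poly_eval_Const_monom[of "insert b B" P "\<lambda>c. c" "\<lambda>b. b"] P(2) insert.hyps
      by (simp add: Q_def poly_sum poly_monom mon_def ac_simps)
    ultimately have Q0: "Q = 0" using b unfolding alg_over_def by blast
    show "P = 0"
    proof (rule ccontr)
      assume "P \<noteq> 0"
      then have " Defs.coeffs P \<noteq> 0" by transfer
      then obtain m0 where m0: "m0 \<in> ?keys" by (metis ex_in_conv keys_eq_empty)
      let ?i = "Poly_Mapping.lookup m0 b"
      define T where "T = {m \<in> ?keys. Poly_Mapping.lookup m b = ?i}"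
      have finT: "finite T" by (simp add: T_def)
      \<comment> \<open>Erasing the exponent of \<open>b\<close> is injective on \<open>T\<close>,
        where this exponent has the fixed value it takes in \<open>m0\<close>.\<close>
      define red where "red m = m - Poly_Mapping.single b ?i" for m :: "'l \<Rightarrow>\<^sub>0 nat"
      have lookup_red: "Poly_Mapping.lookup (red m) v = (if v = b then 0 else Poly_Mapping.lookup m v)"
        if "m \<in> T" for m v using that by (auto simp: red_def lookup_minus lookup_single T_def when_def)
      have inj: "red m = red m' \<Longrightarrow> m = m'" if "m \<in> T" "m' \<in> T" for m m'
      proof (rule poly_mapping_eqI)
        fix v assume "red m = red m'"
        then show "Poly_Mapping.lookup m v = Poly_Mapping.lookup m' v"
          using lookup_red[OF that(1), of v] lookup_red[OF that(2), of v] that by (cases "v = b") (auto simp: T_def)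
      qed
      \<comment> \<open>The coefficient of the power \<open>?i\<close> of \<open>b\<close> in
        \<open>P\<close>: a relation among \<open>B\<close> that holds because \<open>Q\<close> is
        zero, and is nontrivial because of the term that comes from \<open>m0\<close>.\<close>
      define P' where "P' = MPoly (\<Sum>m\<in>T. Poly_Mapping.single (red m) (Defs.coeff P m))"
      have coeff: "Defs.coeff P' n = (\<Sum>m\<in>T. Defs.coeff P m when red m = n)" for n
        by (simp add: P'_def Defs.coeff_def MPoly_inverse lookup_sum lookup_single)
      have coeffm: "Defs.coeff P' (red m) = Defs.coeff P m" if "m \<in> T" for m
      proof -
        have "Defs.coeff P' (red m) = (\<Sum>m'\<in>T. if m' = m then Defs.coeff P m' else 0)"
          unfolding coeff using inj that by (intro sum.cong) (auto simp: when_def)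
        then show ?thesis using that finT by simp
      qed
      have keys': "Poly_Mapping.keys (Defs.coeffs P') = red ` T"
      proof (intro equalityI subsetI)
        fix n assume "n \<in> Poly_Mapping.keys (Defs.coeffs P')"
        then have "Defs.coeff P' n \<noteq> 0" by (simp add: Defs.coeff_def in_keys_iff)
        then obtain m where "m \<in> T" "red m = n" unfolding coeff by (metis (mono_tags, lifting) sum.neutral when_neq_zero)
        then show "n \<in> red ` T" by blast
      next
        fix n assume "n \<in> red ` T"
        then obtain m where m: "m \<in> T" "n = red m" by blast
        then have "Defs.coeff P' n \<noteq> 0" using coeffm by (auto simp: T_def Defs.coeff_def in_keys_iff)
        then show "n \<in> Poly_Mapping.keys (Defs.coeffs P')" by (simp add: Defs.coeff_def in_keys_iff)
      qed
      have vars': "vars P' \<subseteq> B"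
      proof
        fix v assume "v \<in> vars P'"
        then obtain m where m: "m \<in> T" "v \<in> Poly_Mapping.keys (red m)" by (auto simp: vars_def keys')
        then have "v \<noteq> b" "v \<in> Poly_Mapping.keys m" using lookup_red[OF m(1), of v] by (auto simp: in_keys_iff split: if_splits)
        then show "v \<in> B" using P(2) m(1) by (auto simp: vars_def T_def)
      qed
      have "range (Defs.coeff P') \<subseteq> K"
      proof
        fix c assume "c \<in> range (Defs.coeff P')"
        then obtain n where n: "c = Defs.coeff P' n" by blast
        show "c \<in> K" unfolding n coeff using P(1) subfield_0[OF assms(1)]
          by (intro subfield_sum[OF assms(1)]) (auto simp: when_def)
      qed
      moreover have "poly_eval (\<lambda>c. c) (\<lambda>b. b) P' = 0"
      proof -
        have "poly_eval (\<lambda>c. c) (\<lambda>b. b) P' = (\<Sum>n\<in>red ` T. Defs.coeff P' n * mon n)"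
          using poly_eval_Const_monom[OF insert.hyps(1) vars'] by (simp add: keys' mon_def)
        also have "\<dots> = (\<Sum>m\<in>T. Defs.coeff P' (red m) * mon (red m))"
          using inj by (intro sum.reindex_cong[of red]) (auto simp: inj_on_def)
        also have "\<dots> = (\<Sum>m\<in>T. Defs.coeff P m * mon m)"
        proof (intro sum.cong refl arg_cong2[of _ _ _ _ "(*)"])
          fix m assume m: "m \<in> T"
          show "Defs.coeff P' (red m) = Defs.coeff P m" by (rule coeffm[OF m])
          show "mon (red m) = mon m" unfolding mon_def
            using lookup_red[OF m] insert.hyps by (intro prod.cong) auto
        qed
        also have "\<dots> = Polynomial.coeff Q ?i"
          by (simp add: Q_def coeff_sum coeff_monom T_def sum.If_cases Int_def)
        finally show ?thesis using Q0 by simp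
      qed
      ultimately have "P' = 0" using IH vars' unfolding algebraically_independent_def by blast
      then have "Defs.coeff P' (red m0) = 0" by (simp add: Defs.coeff_def zero_mpoly.rep_eq)
      then show False using coeffm[of m0] m0 by (simp add: T_def Defs.coeff_def in_keys_iff)
    qed
  qed
qed

lemma rconst_hom:
  fixes c d :: "'k::field"
  shows "(rconst 1 :: ('v, 'k) ratfun) = 1"
    "(rconst (c + d) :: ('v, 'k) ratfun) = rconst c + rconst d"
    "(rconst (c * d) :: ('v, 'k) ratfun) = rconst c * rconst d"
  using ring_map_Const[where 'v = 'v and 'k = 'k] unfolding ring_map_def
  by (auto simp: rconst_def One_fract_def)

text \<open>Evaluation in \<open>L[X]\<close>, with \<open>L\<close> the field of rational functions, that sends the variable \<open>g\<close>
  to \<open>X\<close> and every other variable to itself separates the powers of \<open>g\<close>.\<close>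

lemma rvar_transcendental:
  fixes g :: 'v
  assumes "g \<notin> S"
  shows "\<not> alg_over (adjoin (range rconst) (rvar ` S)) (rvar g :: ('v, 'k::field) ratfun)"
proof
  define emb where "emb P = Fraction_Field.Fract P 1" for P :: "('v, 'k) mpoly"
  have emb: "emb 0 = 0" "emb 1 = 1" "emb (P + Q) = emb P + emb Q" "emb (P - Q) = emb P - emb Q"
    "emb (P * Q) = emb P * emb Q" "emb P = 0 \<longleftrightarrow> P = 0" for P Q
    by (simp_all add: emb_def Zero_fract_def One_fract_def eq_fract)
  define \<psi> where "\<psi> = poly_eval (\<lambda>c. [:rconst c:]) (\<lambda>v. if v = g then [:0, 1:] else [:rvar v:] :: ('v, 'k) ratfun poly)"
  have "ring_map (\<lambda>c. [:rconst c:] :: ('v, 'k) ratfun poly)"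
    unfolding ring_map_def by (simp add: rconst_hom one_pCons)
  note \<psi> = poly_eval_hom[OF this, of "\<lambda>v. if v = g then [:0, 1:] else [:rvar v:]", folded \<psi>_def]
  have \<psi>_diff: "\<psi> (P - Q) = \<psi> P - \<psi> Q" for P Q using \<psi>(3)[of "P - Q" Q] by simp
  \<comment> \<open>The polynomials free of the variable \<open>g\<close>, described through
    \<open>\<psi>\<close>; only closure properties of this set are used.\<close>
  define D where "D = {A. \<psi> A = [:emb A:]}"
  have D: "0 \<in> D" "1 \<in> D" "Const c \<in> D" "v \<noteq> g \<Longrightarrow> Var v \<in> D"
    "P \<in> D \<Longrightarrow> Q \<in> D \<Longrightarrow> P - Q \<in> D" "P \<in> D \<Longrightarrow> Q \<in> D \<Longrightarrow> P * Q \<in> D" for P Q c v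
    unfolding D_def using \<psi>(1,2,4,5,6) \<psi>_diff emb
    by (auto simp: one_pCons emb_def rconst_def rvar_def mult.commute)
  let ?Fr = "{emb P / emb Q |P Q. P \<in> D \<and> Q \<in> D - {0}}"
  have in_Fr: "emb P \<in> ?Fr" if "P \<in> D" for P
    using that D(2) emb by (intro CollectI exI[of _ P] exI[of _ 1]) auto
  have "is_subfield ?Fr"
  proof (rule is_subfieldI)
    show "0 \<in> ?Fr" "1 \<in> ?Fr" using in_Fr[OF D(1)] in_Fr[OF D(2)] by (simp_all only: emb(1,2))
    fix x assume "x \<in> ?Fr"
    then obtain P Q where x: "x = emb P / emb Q" "P \<in> D" "Q \<in> D" "Q \<noteq> 0" by blast
    show "inverse x \<in> ?Fr"
    proof (cases "P = 0")
      case True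
      then show ?thesis using x \<open>0 \<in> ?Fr\<close> emb by simp
    next
      case False
      then show ?thesis using x by (intro CollectI exI[of _ Q] exI[of _ P]) auto
    qed
    fix y assume "y \<in> ?Fr"
    then obtain P' Q' where y: "y = emb P' / emb Q'" "P' \<in> D" "Q' \<in> D" "Q' \<noteq> 0" by blast
    have "x - y = emb (P * Q' - P' * Q) / emb (Q * Q')" using x y emb by (simp add: diff_frac_eq)
    moreover have "Q * Q' \<in> D - {0}" "P * Q' - P' * Q \<in> D" using x y D by auto
    ultimately show "x - y \<in> ?Fr" by blast
    have "x * y = emb (P * P') / emb (Q * Q')" using x y emb by simp
    then show "x * y \<in> ?Fr" using \<open>Q * Q' \<in> D - {0}\<close> D(6)[OF x(2) y(2)] by blast
  qed
  moreover have "range rconst \<subseteq> ?Fr" using in_Fr D(3) by (auto simp: emb_def rconst_def)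
  moreover have "rvar ` S \<subseteq> ?Fr"
  proof (rule image_subsetI)
    fix v assume "v \<in> S"
    then have "Var v \<in> D" using assms by (intro D(4)) auto
    then show "rvar v \<in> ?Fr" using in_Fr[of "Var v"] by (simp only: emb_def rvar_def)
  qed
  ultimately have sub: "adjoin (range rconst) (rvar ` S) \<subseteq> ?Fr" by (simp add: adjoin_subset_iff)
  assume "alg_over (adjoin (range rconst) (rvar ` S)) (rvar g :: ('v, 'k) ratfun)"
  then obtain A where A: "A \<in> polys_over ?Fr" "A \<noteq> 0" "poly A (rvar g) = 0"
    using polys_over_mono[OF sub] unfolding alg_over_def by blast
  let ?n = "Polynomial.degree A"
  have "\<exists>N Q. Q \<in> D - {0} \<and> (\<forall>i\<le>?n. N i \<in> D \<and> Polynomial.coeff A i = emb (N i) / emb Q)"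
    using A(1) D(6) emb by (intro common_denominator[of _ _ emb D "D - {0}" "(*)"]) (auto simp: polys_over_def)
  then obtain N Q where N: "Q \<in> D" "Q \<noteq> 0" "\<And>i. i \<le> ?n \<Longrightarrow> N i \<in> D \<and> Polynomial.coeff A i = emb (N i) / emb Q"
    by blast
  define R where "R = (\<Sum>i\<le>?n. N i * Var g ^ i)"
  have emb_sum: "emb (sum f I) = (\<Sum>i\<in>I. emb (f i))" for f and I :: "nat set"
    by (induction I rule: infinite_finite_induct) (simp_all add: emb)
  have emb_pow: "emb (P ^ n) = emb P ^ n" for P n by (induction n) (simp_all add: emb)
  have "emb R = (\<Sum>i\<le>?n. (Polynomial.coeff A i * emb Q) * rvar g ^ i)"
    using N emb by (auto simp: R_def emb_sum emb_pow emb(5) rvar_def simp flip: emb_def intro!: sum.cong)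
  also have "\<dots> = poly A (rvar g) * emb Q"
    by (simp add: poly_altdef sum_distrib_left mult_ac)
  finally have "R = 0" using A(3) emb(6) by simp
  have \<psi>_sum: "\<psi> (sum f I) = (\<Sum>i\<in>I. \<psi> (f i))" for f and I :: "nat set"
    by (induction I rule: infinite_finite_induct) (simp_all add: \<psi>)
  have \<psi>_pow: "\<psi> (P ^ n) = \<psi> P ^ n" for P n by (induction n) (simp_all add: \<psi>)
  \<comment> \<open>\<open>R\<close> is zero in the polynomial ring, while \<open>\<psi>\<close>
    keeps the numerators \<open>N i\<close> apart as coefficients.\<close>
  have "\<psi> R = (\<Sum>i\<le>?n. [:emb (N i):] * [:0, 1:] ^ i)"
    using N(3) by (auto simp: R_def \<psi>_sum \<psi>_pow \<psi>(4,6) D_def intro!: sum.cong)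
  also have "\<dots> = (\<Sum>i\<le>?n. Polynomial.monom (emb (N i)) i)"
    by (simp add: monom_altdef)
  finally have "Polynomial.coeff (\<psi> R) ?n = emb (N ?n)" by (simp add: coeff_sum coeff_monom)
  then have "N ?n = 0" using \<open>R = 0\<close> \<psi>(1) emb(6) by simp
  then show False using N(3)[of ?n] A(2) emb by simp
qed

section \<open>Modules over the group ring of a cyclic group of prime order\<close>

text \<open>Such a module is treated as a module over \<open>\<int>[X]\<close> on which \<open>X\<close> has order \<open>p\<close>.\<close>

definition poly_act :: "(int \<Rightarrow> 'a \<Rightarrow> 'a) \<Rightarrow> ('a \<Rightarrow> 'a) \<Rightarrow> int poly \<Rightarrow> 'a::ab_group_add \<Rightarrow> 'a" where
  "poly_act s \<phi> P v = (\<Sum>i\<le>Polynomial.degree P. s (Polynomial.coeff P i) ((\<phi> ^^ i) v))"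

locale module_endo = Modules.module s for s :: "int \<Rightarrow> 'a::ab_group_add \<Rightarrow> 'a" +
  fixes \<phi> :: "'a \<Rightarrow> 'a"
  assumes \<phi>_add: "\<phi> (v + w) = \<phi> v + \<phi> w" and \<phi>_scale: "\<phi> (s c v) = s c (\<phi> v)"
begin

lemma \<phi>_sum: "\<phi> (sum f I) = (\<Sum>i\<in>I. \<phi> (f i))"
proof (induction I rule: infinite_finite_induct)
  show "\<phi> (sum f {}) = sum (\<lambda>i. \<phi> (f i)) {}" using \<phi>_scale[of 0 0] by simp
qed (use \<phi>_scale[of 0 0] \<phi>_add in simp_all)

lemma poly_act_superset:
  assumes "Polynomial.degree P \<le> n"
  shows "poly_act s \<phi> P v = (\<Sum>i\<le>n. s (Polynomial.coeff P i) ((\<phi> ^^ i) v))"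
  unfolding poly_act_def using assms
  by (intro sum.mono_neutral_left) (auto simp: coeff_eq_0)

lemma poly_act_pCons: "poly_act s \<phi> (pCons a P) v = s a v + \<phi> (poly_act s \<phi> P v)"
proof -
  have "poly_act s \<phi> (pCons a P) v = (\<Sum>i\<le>Suc (Polynomial.degree P). s (Polynomial.coeff (pCons a P) i) ((\<phi> ^^ i) v))"
    by (intro poly_act_superset degree_pCons_le)
  then show ?thesis
    by (simp add: sum.atMost_Suc_shift poly_act_def \<phi>_sum \<phi>_scale del: sum.atMost_Suc)
qed

lemma poly_act_0: "poly_act s \<phi> 0 v = 0"
  by (simp add: poly_act_def)

lemma poly_act_add: "poly_act s \<phi> (P + Q) v = poly_act s \<phi> P v + poly_act s \<phi> Q v"
proof -
  let ?n = "max (Polynomial.degree P) (Polynomial.degree Q)"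
  have "Polynomial.degree (P + Q) \<le> ?n" by (intro degree_add_le) auto
  then show ?thesis
    by (simp add: poly_act_superset[of _ ?n] scale_left_distrib sum.distrib)
qed

lemma poly_act_add_right: "poly_act s \<phi> P (v + w) = poly_act s \<phi> P v + poly_act s \<phi> P w"
  by (induction P) (simp_all add: poly_act_0 poly_act_pCons scale_right_distrib \<phi>_add algebra_simps)

lemma poly_act_smult: "poly_act s \<phi> (smult a P) v = s a (poly_act s \<phi> P v)"
  by (induction P) (simp_all add: poly_act_0 poly_act_pCons scale_right_distrib \<phi>_scale)

lemma \<phi>_0: "\<phi> 0 = 0"
  using \<phi>_scale[of 0 0] by simp

lemma poly_act_const: "poly_act s \<phi> [:c:] v = s c v"
  unfolding poly_act_pCons poly_act_0 \<phi>_0 by simp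

lemma module_poly_act: "Modules.module (poly_act s \<phi>)"
proof
  show "poly_act s \<phi> P (poly_act s \<phi> Q v) = poly_act s \<phi> (P * Q) v" for P Q v
    by (induction P) (simp_all add: poly_act_0 poly_act_pCons poly_act_add poly_act_smult)
  show "poly_act s \<phi> 1 v = v" for v
    using poly_act_const[of 1 v] by (simp flip: one_pCons)
qed (simp_all add: poly_act_add poly_act_add_right)

lemma poly_act_monom: "poly_act s \<phi> (Polynomial.monom 1 n) v = (\<phi> ^^ n) v"
  by (induction n) (simp_all add: monom_Suc poly_act_pCons monom_0 poly_act_0 \<phi>_0)

end

section \<open>Congruences modulo a prime\<close>

lemma prime_dvd_binomial_power:
  fixes a b :: "'a::comm_ring_1"
  assumes p: "prime p"
  shows "of_nat p dvd (a + b) ^ p - (a ^ p + b ^ p)"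
proof -
  have "0 < p" using p prime_gt_0_nat by blast
  then have "{..p} = insert 0 (insert p {0<..<p})" by auto
  then have "(a + b) ^ p = a ^ p + b ^ p + (\<Sum>k\<in>{0<..<p}. of_nat (p choose k) * a ^ k * b ^ (p - k))"
    using \<open>0 < p\<close> by (simp add: binomial_ring)
  moreover have "of_nat p dvd (of_nat (p choose k) * a ^ k * b ^ (p - k) :: 'a)" if "k \<in> {0<..<p}" for k
  proof -
    have "p dvd (p choose k)" using that p by (intro dvd_choose_prime) auto
    then have "(of_nat p :: 'a) dvd of_nat (p choose k)" by (metis dvd_def of_nat_mult)
    then show ?thesis by (simp add: mult.assoc)
  qed
  ultimately show ?thesis by (auto intro: dvd_sum)
qed

text \<open>Congruent elements have congruent p-th powers, because the difference of the powers is
  divisible by the difference of the elements; this carries the congruence from \<open>e\<close> to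
  \<open>Suc e\<close>.\<close>

lemma prime_dvd_binomial_power_power:
  fixes a b :: "'a::comm_ring_1"
  assumes p: "prime p"
  shows "of_nat p dvd (a + b) ^ (p ^ e) - (a ^ (p ^ e) + b ^ (p ^ e))"
proof (induction e)
  case (Suc e)
  let ?A = "(a + b) ^ (p ^ e)" and ?B = "a ^ (p ^ e) + b ^ (p ^ e)"
  have "?A - ?B dvd ?A ^ p - ?B ^ p" by (metis dvd_triv_left power_diff_sumr2)
  then have 1: "of_nat p dvd ?A ^ p - ?B ^ p" using Suc.IH dvd_trans by blast
  have "of_nat p dvd ?B ^ p - ((a ^ (p ^ e)) ^ p + (b ^ (p ^ e)) ^ p)"
    by (rule prime_dvd_binomial_power[OF p])
  from dvd_add[OF 1 this] show ?case by (simp add: algebra_simps flip: power_mult)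
qed simp

abbreviation "T_poly \<equiv> [:-1, 1:] :: int poly"

text \<open>\<open>N_poly p\<close> is the norm element of \<int>[C_p], whose vanishing defines
  \<int>[\<zeta>_p]; for \<open>l\<close> prime to \<open>p\<close>, \<open>N_poly l\<close> acts
  there as a cyclotomic unit.\<close>

definition N_poly :: "nat \<Rightarrow> int poly" where
  "N_poly n = (\<Sum>i<n. Polynomial.monom 1 i)"

lemma T_N_poly: "T_poly * N_poly n = Polynomial.monom 1 n - 1"
proof (induction n)
  case (Suc n)
  have "T_poly * N_poly (Suc n) = T_poly * N_poly n + T_poly * Polynomial.monom 1 n"
    by (simp add: N_poly_def distrib_left)
  also have "T_poly * Polynomial.monom 1 n = Polynomial.monom 1 (Suc n) - Polynomial.monom 1 n"
    by (simp add: monom_Suc)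
  finally show ?case using Suc by simp
qed (simp add: N_poly_def monom_0 one_pCons)

lemma poly_N_poly: "poly (N_poly n) 1 = int n"
  by (simp add: N_poly_def poly_sum poly_monom)

lemma poly_mod_T: "\<exists>Q. P = [:poly P 1:] + Q * T_poly"
proof -
  have "poly (P - [:poly P 1:]) 1 = 0" by simp
  then have "T_poly dvd P - [:poly P 1:]" by (rule poly_eq_0_iff_dvd[THEN iffD1])
  then obtain Q where "P - [:poly P 1:] = T_poly * Q" by (rule dvdE)
  then show ?thesis by (intro exI[of _ Q]) (simp add: algebra_simps)
qed

text \<open>The Frobenius congruence for X + (-1); oddness keeps the sign of the constant term. With
  exponent \<open>p\<close> it makes X - 1 nilpotent modulo \<open>p\<close> on the lattices, and
  with the exponent of the group it makes g - 1 nilpotent in characteristic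
  \<open>p\<close>.\<close>

lemma T_power: 
  assumes "prime p" "odd p"
  shows "\<exists>R. T_poly ^ (p ^ e) = Polynomial.monom 1 (p ^ e) - 1 + of_nat p * R"
proof -
  have "T_poly = [:0, 1:] + (-1)" by (simp add: one_pCons)
  moreover have "(-1) ^ (p ^ e) = (-1 :: int poly)" using assms(2) by simp
  moreover have "[:0, 1:] ^ n = (Polynomial.monom 1 n :: int poly)" for n by (simp add: monom_altdef)
  ultimately have "of_nat p dvd T_poly ^ (p ^ e) - (Polynomial.monom 1 (p ^ e) - 1)"
    using prime_dvd_binomial_power_power[OF assms(1), of "[:0, 1:] :: int poly" "-1" e] by simp
  then obtain R where "T_poly ^ (p ^ e) - (Polynomial.monom 1 (p ^ e) - 1) = of_nat p * R" by (rule dvdE)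
  then show ?thesis by (intro exI[of _ R]) (simp add: algebra_simps)
qed

locale cyclic_module = Modules.module scale for scale :: "int poly \<Rightarrow> 'a::ab_group_add \<Rightarrow> 'a" (infixr \<open>*s\<close> 75) +
  fixes p :: nat
  assumes p: "prime p" "odd p" and period: "Polynomial.monom 1 p *s v = v"
begin

lemma T_N: "T_poly *s N_poly p *s v = 0"
  using period by (simp add: T_N_poly scale_left_diff_distrib del: mult_pCons_left)

lemma N_T: "N_poly p *s T_poly *s v = 0"
  using T_N[of v] by (simp add: mult.commute del: mult_pCons_left mult_pCons_right)

text \<open>\<open>N_poly p\<close> has value \<open>p\<close> at 1, so the norm and multiplication
  by \<open>p\<close> agree modulo X - 1. This is what allows one to replace the other among
  generators.\<close>

lemma N_mod_T: "\<exists>Q. \<forall>v. N_poly p *s v = of_nat p *s v + Q *s T_poly *s v"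
proof -
  obtain Q where "N_poly p = [:poly (N_poly p) 1:] + Q * T_poly" using poly_mod_T by blast
  then have "N_poly p *s v = of_nat p *s v + Q *s T_poly *s v" for v
    by (simp add: poly_N_poly of_nat_poly scale_left_distrib del: mult_pCons_left mult_pCons_right)
  then show ?thesis by blast
qed

lemma T_power_p: "\<exists>R. \<forall>v. T_poly ^ p *s v = of_nat p *s R *s v"
proof -
  obtain R where R: "T_poly ^ p = Polynomial.monom 1 p - 1 + of_nat p * R" using T_power[OF p, of 1] by auto
  have "T_poly ^ p *s v = of_nat p *s R *s v" for v
    unfolding R by (simp add: scale_left_distrib scale_left_diff_distrib period)
  then show ?thesis by blast
qed

lemma subspace_sum_image:
  assumes "subspace M1" "subspace M"
  shows "subspace {m + Q *s v |m v. m \<in> M1 \<and> v \<in> M}"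
proof (rule subspaceI)
  show "0 \<in> {m + Q *s v |m v. m \<in> M1 \<and> v \<in> M}"
    using assms subspace_0 by (intro CollectI exI[of _ 0]) auto
  fix x assume "x \<in> {m + Q *s v |m v. m \<in> M1 \<and> v \<in> M}"
  then obtain m v where x: "x = m + Q *s v" "m \<in> M1" "v \<in> M" by blast
  show "c *s x \<in> {m + Q *s v |m v. m \<in> M1 \<and> v \<in> M}" for c
    using x assms by (intro CollectI exI[of _ "c *s m"] exI[of _ "c *s v"])
      (auto simp: scale_right_distrib mult.commute intro: subspace_scale)
  fix y assume "y \<in> {m + Q *s v |m v. m \<in> M1 \<and> v \<in> M}"
  then obtain m' v' where y: "y = m' + Q *s v'" "m' \<in> M1" "v' \<in> M" by blast
  show "x + y \<in> {m + Q *s v |m v. m \<in> M1 \<and> v \<in> M}"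
    using x y assms by (intro CollectI exI[of _ "m + m'"] exI[of _ "v + v'"])
      (auto simp: scale_right_distrib intro: subspace_add)
qed

text \<open>The quotient of \<open>M\<close> by \<open>M'\<close> is a finite \<open>p\<close>-group
  on which \<open>p\<close> and X - 1 are nilpotent. Both therefore act as zero on a simple
  quotient, which then has order \<open>p\<close>.\<close>

lemma maximal_submodule:
  fixes r :: nat
  assumes "subspace M'" "subspace M" "M' \<subset> M"
    and R: "finite R" "\<And>v. v \<in> M \<Longrightarrow> \<exists>r\<in>R. v - r \<in> M'"
    and exponent: "\<And>v. v \<in> M \<Longrightarrow> of_nat p ^ r *s v \<in> M'"
  obtains M1 where "subspace M1" "M' \<subseteq> M1" "M1 \<subset> M"
    "\<And>v. v \<in> M \<Longrightarrow> T_poly *s v \<in> M1" "\<And>v. v \<in> M \<Longrightarrow> of_nat p *s v \<in> M1"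
    "\<And>u v. u \<in> M \<Longrightarrow> v \<in> M \<Longrightarrow> v \<notin> M1 \<Longrightarrow> \<exists>k. u - [:k:] *s v \<in> M1"
proof -
  \<comment> \<open>\<open>R\<close> represents \<open>M\<close> modulo \<open>M'\<close>, so a
    submodule is measured by the number of representatives in it; a greatest count gives a maximal
    submodule.\<close>
  let ?P = "\<lambda>M1. subspace M1 \<and> M' \<subseteq> M1 \<and> M1 \<subset> M"
  have "\<exists>M1. ?P M1 \<and> (\<forall>M2. ?P M2 \<longrightarrow> card (R \<inter> M2) \<le> card (R \<inter> M1))"
    using assms(1,3) R(1)
    by (intro ex_has_greatest_nat[of ?P M' _ "Suc (card R)"]) (auto simp: less_Suc_eq_le intro: card_mono)
  then obtain M1 where M1: "?P M1" "\<And>M2. ?P M2 \<Longrightarrow> card (R \<inter> M2) \<le> card (R \<inter> M1)" by blast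
  have max: "M2 = M" if M2: "subspace M2" "M1 \<subseteq> M2" "M2 \<subseteq> M" "v \<in> M2" "v \<notin> M1" for M2 v
  proof (rule ccontr)
    assume "M2 \<noteq> M"
    obtain r where r: "r \<in> R" "v - r \<in> M'" using R(2)[of v] M2 by blast
    have "v - r \<in> M2" "v - r \<in> M1" using r M1 M2 by auto
    then have "r \<in> M2" "r \<notin> M1"
      using subspace_diff[OF M2(1,4), of "v - r"] subspace_add[of M1 r "v - r"] M1 M2(5) by auto
    then have "R \<inter> M1 \<subset> R \<inter> M2" using r M2(2) by blast
    then have "card (R \<inter> M1) < card (R \<inter> M2)" using R(1) by (intro psubset_card_mono) auto
    moreover have "?P M2" using M1 M2 \<open>M2 \<noteq> M\<close> by blast
    ultimately show False using M1(2)[of M2] by linarith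
  qed
  \<comment> \<open>Nakayama's argument: otherwise \<open>M = M1 + Q M\<close> by maximality, and
    iteration yields \<open>M = M1 + Q ^ n M\<close>, which lies in \<open>M1\<close>.\<close>
  have nil: "Q *s v \<in> M1" if v: "v \<in> M" and nilp: "\<And>w. w \<in> M \<Longrightarrow> Q ^ n *s w \<in> M1" for Q n v
  proof (rule ccontr)
    assume nv: "Q *s v \<notin> M1"
    let ?M2 = "{m + Q *s v |m v. m \<in> M1 \<and> v \<in> M}"
    have "?M2 = M"
    proof (rule max[of _ "Q *s v"])
      show "subspace ?M2" using M1 assms(2) by (intro subspace_sum_image) auto
      show "M1 \<subseteq> ?M2"
      proof
        fix x assume "x \<in> M1"
        then show "x \<in> ?M2" using subspace_0[OF assms(2)] by (intro CollectI exI[of _ x] exI[of _ 0]) auto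
      qed
      show "Q *s v \<in> ?M2" using v subspace_0 M1 by (intro CollectI exI[of _ 0] exI[of _ v]) auto
      show "?M2 \<subseteq> M" using M1 assms(2) by (auto intro!: subspace_add subspace_scale)
    qed (rule nv)
    have "\<exists>m\<in>M1. \<exists>w\<in>M. u = m + Q ^ k *s w" if "u \<in> M" for u k
      using that
    proof (induction k arbitrary: u)
      case 0
      then show ?case using subspace_0 M1 by (intro bexI[of _ 0] bexI[of _ u]) auto
    next
      case (Suc k)
      then obtain m w where u: "m \<in> M1" "w \<in> M" "u = m + Q ^ k *s w" by blast
      obtain m' w' where w: "m' \<in> M1" "w' \<in> M" "w = m' + Q *s w'" using \<open>?M2 = M\<close> u(2) by blast
      have "u = (m + Q ^ k *s m') + Q ^ Suc k *s w'"
        by (simp add: u w scale_right_distrib mult.commute add.assoc)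
      moreover have "m + Q ^ k *s m' \<in> M1" using u w M1 by (auto intro: subspace_add subspace_scale)
      ultimately show ?case using w by blast
    qed
    then have "u \<in> M1" if "u \<in> M" for u
      using that nilp M1 by (metis (no_types, lifting) subspace_add)
    then show False using M1 by blast
  qed
  have pM: "of_nat p *s v \<in> M1" if "v \<in> M" for v
    using nil[OF that, where n = r and Q = "of_nat p"] exponent M1 by blast
  obtain S where S: "\<And>v. T_poly ^ p *s v = of_nat p *s S *s v" using T_power_p by blast
  have TM: "T_poly *s v \<in> M1" if "v \<in> M" for v
  proof (rule nil[OF that])
    fix w assume "w \<in> M"
    then show "T_poly ^ p *s w \<in> M1" unfolding S
      using pM subspace_scale[OF assms(2)] by blast
  qed
  \<comment> \<open>By maximality \<open>v\<close> generates \<open>M\<close> modulo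
    \<open>M1\<close>; as X - 1 acts as zero there, integer coefficients suffice.\<close>
  have "\<exists>k. u - [:k:] *s v \<in> M1" if uv: "u \<in> M" "v \<in> M" "v \<notin> M1" for u v
  proof -
    let ?M2 = "{m + 1 *s w |m w. m \<in> M1 \<and> w \<in> span {v}}"
    have v: "span {v} \<subseteq> M" using uv assms(2) by (intro span_minimal) auto
    have "?M2 = M"
    proof (rule max[of _ v])
      show "subspace ?M2" using M1 by (intro subspace_sum_image) auto
      show "M1 \<subseteq> ?M2"
      proof
        fix x assume "x \<in> M1"
        then show "x \<in> ?M2" using span_zero by (intro CollectI exI[of _ x] exI[of _ 0]) auto
      qed
      show "v \<in> ?M2" using subspace_0 M1 by (intro CollectI exI[of _ 0] exI[of _ v]) (auto intro: span_base)
      show "?M2 \<subseteq> M" using M1 assms(2) v by (auto intro!: subspace_add)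
    qed (rule uv)
    then obtain m P where m: "m \<in> M1" "u = m + P *s v" using uv(1) by (auto simp: span_singleton)
    obtain Q where Q: "P = [:poly P 1:] + Q * T_poly" using poly_mod_T by blast
    have "P *s v = [:poly P 1:] *s v + Q *s T_poly *s v"
      by (subst Q) (simp add: scale_left_distrib del: mult_pCons_right)
    then have "u - [:poly P 1:] *s v = m + Q *s T_poly *s v" using m by simp
    then show ?thesis using m TM[OF uv(2)] M1 by (metis subspace_add subspace_scale)
  qed
  then show ?thesis using that[of M1] M1 pM TM by blast
qed

lemma span_replace:
  assumes "\<And>u. u \<in> U \<Longrightarrow> \<exists>c. e u = u - c *s v" "v \<in> A"
  shows "span (A \<union> e ` U) = span (A \<union> U)"
proof -
  have v: "v \<in> span (A \<union> B)" for B using assms(2) by (auto intro: span_base)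
  have "e u \<in> span (A \<union> U)" if "u \<in> U" for u
    using assms(1)[OF that] v[of U] that by (auto intro!: span_diff span_scale intro: span_base)
  moreover have "u \<in> span (A \<union> e ` U)" if u: "u \<in> U" for u
  proof -
    obtain c where "e u = u - c *s v" using assms(1)[OF u] by blast
    then have "u = e u + c *s v" by simp
    moreover have "e u \<in> span (A \<union> e ` U)" using u by (auto intro: span_base)
    ultimately show ?thesis using v[of "e ` U"] by (metis span_add span_scale)
  qed
  ultimately show ?thesis by (subst span_eq) (auto intro: span_base)
qed

text \<open>Modulo X - 1 the coefficient of \<open>v\<close> is an integer, and in an element of
  \<open>M1\<close> it must be divisible by \<open>p\<close>. Hence \<open>p v\<close> and
  \<open>(X - 1) v\<close> account for all multiples of \<open>v\<close> that occur.\<close>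

lemma submodule_span:
  assumes "subspace M1" "A \<subseteq> M1" "v \<notin> M1" "M1 \<subseteq> span (insert v A)"
    and "T_poly *s v \<in> M1" "of_nat p *s v \<in> M1"
  shows "M1 = span (A \<union> {T_poly *s v, of_nat p *s v})"
proof (intro equalityI subsetI)
  fix m assume m: "m \<in> M1"
  let ?A = "A \<union> {T_poly *s v, of_nat p *s v}"
  obtain P where P: "m - P *s v \<in> span A" using m assms(4) by (auto simp: span_insert)
  then have PM: "m - P *s v \<in> M1" using span_minimal[OF assms(2,1)] by blast
  obtain Q where Q: "P = [:poly P 1:] + Q * T_poly" using poly_mod_T by blast
  let ?c = "poly P 1"
  have Pv: "P *s v = [:?c:] *s v + Q *s T_poly *s v"
    by (subst Q) (simp add: scale_left_distrib del: mult_pCons_right)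
  have "[:?c:] *s v = m - (m - P *s v) - Q *s T_poly *s v" by (simp add: Pv)
  also have "\<dots> \<in> M1" 
    using subspace_diff[OF assms(1) subspace_diff[OF assms(1) m PM] subspace_scale[OF assms(1,5), of Q]] .
  finally have c: "[:?c:] *s v \<in> M1" .
  \<comment> \<open>A coefficient invertible modulo \<open>p\<close> would put \<open>v\<close>
    itself into \<open>M1\<close>.\<close>
  have "int p dvd ?c"
  proof (rule ccontr)
    assume "\<not> int p dvd ?c"
    then have "coprime (int p) ?c" using p(1) by (simp add: prime_imp_coprime)
    then obtain a b where ab: "a * int p + b * ?c = 1" by (metis bezout_int coprime_imp_gcd_eq_1)
    have "v = [:a * int p + b * ?c:] *s v" by (simp add: ab flip: one_pCons)
    also have "\<dots> = [:a:] *s of_nat p *s v + [:b:] *s [:?c:] *s v"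
      by (simp add: of_nat_poly mult.commute flip: scale_left_distrib)
    also have "\<dots> \<in> M1" using c assms
      by (intro subspace_add subspace_scale[of M1 "of_nat p *s v"] subspace_scale[of M1 "[:?c:] *s v"])
    finally show False using assms(3) by blast
  qed
  then obtain k where k: "?c = int p * k" by blast
  have "m = (m - P *s v) + ([:k:] *s of_nat p *s v + Q *s T_poly *s v)"
    by (simp add: Pv k of_nat_poly mult.commute)
  also have "\<dots> \<in> span ?A"
  proof (intro span_add span_scale[of "of_nat p *s v"] span_scale[of "T_poly *s v"])
    show "m - P *s v \<in> span ?A" using P span_mono[of A ?A] by blast
  qed (auto intro: span_base)
  finally show "m \<in> span ?A" .
next
  fix m assume "m \<in> span (A \<union> {T_poly *s v, of_nat p *s v})"
  then show "m \<in> M1" using span_minimal[of "A \<union> {T_poly *s v, of_nat p *s v}" M1] assms by auto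
qed

end

section \<open>Generators of submodules of p-power index\<close>

lemma sum_lessThan_add:
  fixes f :: "nat \<Rightarrow> 'a::comm_monoid_add"
  shows "(\<Sum>i<a + b. f i) = (\<Sum>i<a. f i) + (\<Sum>i<b. f (a + i))"
  by (induction b) (simp_all add: add.assoc)

context cyclic_module
begin

text \<open>The \<open>fs\<close> generate images of \<int> and the \<open>gs\<close> images of
  \<int>[\<zeta>_p]. The third kind of generator, \<open>es\<close>, generates images of \<int>[C_p]
  and has no equation to satisfy.\<close>

definition good_generators :: "'a list \<Rightarrow> 'a list \<Rightarrow> bool" where
  "good_generators fs gs \<longleftrightarrow> (\<forall>f\<in>set fs. T_poly *s f = 0) \<and> (\<forall>g\<in>set gs. N_poly p *s g = 0)"

text \<open>The weights are the ranks of \<int>, \<int>[C_p] and \<int>[\<zeta>_p]; no freeness is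
  asserted, so the total is an upper bound for the rank of the span.\<close>

definition lattice_rank :: "'a list \<Rightarrow> 'a list \<Rightarrow> 'a list \<Rightarrow> nat" where
  "lattice_rank fs es gs = length fs + p * length es + (p - 1) * length gs"

text \<open>The inverse of the cyclotomic unit \<open>1 + X + \<dots> + X\<^sup>l\<^sup>-\<^sup>1\<close> is \<open>1 + X\<^sup>l + \<dots> + X\<^sup>l\<^sup>(\<^sup>m\<^sup>-\<^sup>1\<^sup>)\<close>, where
  \<open>lm\<close> is \<open>1\<close> modulo \<open>p\<close>.\<close>

lemma cyclotomic_unit:
  assumes "N_poly p *s g = 0" "\<not> p dvd l"
  shows "\<exists>U. U *s N_poly l *s g = g"
proof -
  have "gcd l p = 1" using assms(2) p(1) by (metis coprime_commute coprime_imp_gcd_eq_1 prime_imp_coprime_nat)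
  moreover have "l \<noteq> 0" using assms(2) by (metis dvd_0_right)
  ultimately obtain l' q where l': "l * l' = Suc (p * q)" using bezout_nat[of l p] by auto
  have per: "Polynomial.monom 1 (p * k) *s v = v" for k v
  proof (induction k)
    case (Suc k)
    have "Polynomial.monom 1 (p * Suc k) *s v = Polynomial.monom 1 p *s Polynomial.monom 1 (p * k) *s v"
      by (simp add: mult_monom)
    then show ?case using Suc period by simp
  qed (simp add: monom_0 flip: one_pCons)
  \<comment> \<open>Each block of \<open>p\<close> consecutive powers is a translate of the norm and
    annihilates \<open>g\<close>.\<close>
  have N_shift: "(\<Sum>i<p * k. Polynomial.monom 1 (a + i) *s g) = 0" for k a
  proof (induction k)
    case (Suc k)
    have "(\<Sum>i<p * Suc k. Polynomial.monom 1 (a + i) *s g)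
        = (\<Sum>i<p * k. Polynomial.monom 1 (a + i) *s g) + (\<Sum>i<p. Polynomial.monom 1 (a + (p * k + i)) *s g)"
      by (simp only: mult_Suc_right add.commute[of p "p * k"] sum_lessThan_add)
    also have "(\<Sum>i<p. Polynomial.monom 1 (a + (p * k + i)) *s g)
        = Polynomial.monom 1 a *s Polynomial.monom 1 (p * k) *s (\<Sum>i<p. Polynomial.monom 1 i) *s g"
      by (simp add: scale_sum_left scale_sum_right mult_monom add.assoc)
    also have "\<dots> = 0" using assms(1) by (simp add: N_poly_def)
    finally show ?case using Suc by simp
  qed simp
  define U where "U = (\<Sum>i<l'. Polynomial.monom (1::int) (l * i))"
  have "U *s N_poly l *s g = (\<Sum>i<l * l'. Polynomial.monom 1 i *s g)"
    unfolding U_def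
  proof (induction l')
    case (Suc m)
    have "(\<Sum>i<l * Suc m. Polynomial.monom 1 i *s g)
        = (\<Sum>i<l * m. Polynomial.monom 1 i *s g) + (\<Sum>i<l. Polynomial.monom 1 (l * m + i) *s g)"
      by (simp only: mult_Suc_right add.commute[of l "l * m"] sum_lessThan_add)
    then show ?case using Suc
      by (simp add: scale_left_distrib distrib_right sum.distrib N_poly_def scale_sum_left scale_sum_right sum_distrib_left mult_monom)
  qed simp
  also have "\<dots> = g"
  proof -
    \<comment> \<open>There are \<open>1 + p * q\<close> powers: the first gives \<open>g\<close>,
      the others form \<open>q\<close> full blocks.\<close>
    have "(\<Sum>i<l * l'. Polynomial.monom 1 i *s g) = g + (\<Sum>i<p * q. Polynomial.monom 1 (1 + i) *s g)"
      unfolding l' by (simp add: sum.lessThan_Suc_shift monom_0 del: sum.lessThan_Suc flip: one_pCons)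
    then show ?thesis by (simp only: N_shift add_0_right)
  qed
  finally show ?thesis by blast
qed

lemma span_insert_redundant: "x \<in> span A \<Longrightarrow> span (insert x A) = span A"
  unfolding span_def by (rule hull_redundant)

text \<open>All generators lie in \<open>M1\<close> after subtracting multiples of one that does not. That one is replaced
  by \<open>p f\<close>, by \<open>(X - 1) g\<close>, or by \<open>(X - 1) e\<close> and the norm of \<open>e\<close>. If both an \<open>f\<close> and a \<open>g\<close> lie outside of
  \<open>M1\<close>, the two merge into the regular generator \<open>f + u g\<close> for a suitable cyclotomic unit \<open>u\<close>.\<close>

lemma submodule_step:
  assumes gens: "good_generators fs gs" "M = span (set fs \<union> set es \<union> set gs)"
    and M1: "subspace M1" "M1 \<subset> M"
    and T: "\<And>v. v \<in> M \<Longrightarrow> T_poly *s v \<in> M1" and pM: "\<And>v. v \<in> M \<Longrightarrow> of_nat p *s v \<in> M1"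
    and red: "\<And>u v. u \<in> M \<Longrightarrow> v \<in> M \<Longrightarrow> v \<notin> M1 \<Longrightarrow> \<exists>k. u - [:k:] *s v \<in> M1"
  shows "\<exists>fs' es' gs'. good_generators fs' gs' \<and> M1 = span (set fs' \<union> set es' \<union> set gs')
    \<and> lattice_rank fs' es' gs' = lattice_rank fs es gs"
proof -
  have p0: "0 < p" using p(1) prime_gt_0_nat by blast
  have M: "u \<in> M" if "u \<in> set fs \<union> set es \<union> set gs" for u
    unfolding gens(2) using that by (rule span_base)
  define k where "k u v = (SOME k. u - [:k:] *s v \<in> M1)" for u v
  have k: "u - [:k u v:] *s v \<in> M1" if "u \<in> M" "v \<in> M" "v \<notin> M1" for u v
    unfolding k_def using red[OF that] by (rule someI_ex)
  define rd where "rd v u = u - [:k u v:] *s v" for u v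
  have rd: "rd v u \<in> M1" if "u \<in> M" "v \<in> M" "v \<notin> M1" for u v using k that by (simp add: rd_def)
  have rd_ex: "\<exists>c. rd v u = u - c *s v" for v u unfolding rd_def by blast
  \<comment> \<open>Subtracting multiples of \<open>v\<close> keeps an element in the kernel of
    \<open>P\<close> if \<open>v\<close> lies there as well. So the \<open>fs\<close> are reduced by
    an \<open>f\<close> and the \<open>gs\<close> by a \<open>g\<close>, while the \<open>es\<close>
    can be reduced by anything; the case distinction below respects this.\<close>
  have rd_0: "P *s rd v u = 0" if "P *s u = 0" "P *s v = 0" for P v u
  proof -
    have "P *s rd v u = P *s u - [:k u v:] *s P *s v" by (simp add: rd_def scale_right_diff_distrib mult.commute)
    then show ?thesis using that by simp
  qed
  have T0: "T_poly *s f = 0" if "f \<in> set fs" for f using gens(1) that by (simp add: good_generators_def)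
  have N0: "N_poly p *s g = 0" if "g \<in> set gs" for g using gens(1) that by (simp add: good_generators_def)
  obtain S where S: "\<And>v. N_poly p *s v = of_nat p *s v + S *s T_poly *s v" using N_mod_T by blast
  have span_M: "span (insert v (A \<union> rd v ` U)) = span (insert v (A \<union> U))" for v A U
    using span_replace[of U "rd v" v "insert v A"] rd_ex by simp
  consider (F) f where "f \<in> set fs" "f \<notin> M1" "set gs \<subseteq> M1"
    | (FG) f g where "f \<in> set fs" "f \<notin> M1" "g \<in> set gs" "g \<notin> M1"
    | (G) g where "g \<in> set gs" "g \<notin> M1" "set fs \<subseteq> M1"
    | (E) e where "e \<in> set es" "e \<notin> M1" "set fs \<union> set gs \<subseteq> M1"
  proof -
    have "\<not> set fs \<union> set es \<union> set gs \<subseteq> M1"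
      using M1 gens(2) span_minimal by blast
    then show ?thesis using that by blast
  qed
  then show ?thesis
  proof cases
    case F
    obtain xs ys where fs: "fs = xs @ f # ys" using F(1) by (meson split_list)
    have fM: "f \<in> M" using F M by blast
    let ?U = "set xs \<union> set ys \<union> set es"
    let ?A = "set gs \<union> rd f ` ?U"
    have "M1 = span (?A \<union> {T_poly *s f, of_nat p *s f})"
    proof (rule submodule_span[OF M1(1) _ F(2) _ T[OF fM] pM[OF fM]])
      show "?A \<subseteq> M1" using F(3) rd[OF _ fM F(2)] M by (auto simp: fs)
      have "span (insert f ?A) = M"
        unfolding span_M gens(2) by (rule arg_cong[of _ _ span]) (auto simp: fs)
      then show "M1 \<subseteq> span (insert f ?A)" using M1(2) by blast
    qed
    also have "T_poly *s f = 0" using T0[OF F(1)] .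
    also have "?A \<union> {0, of_nat p *s f} = insert 0 (?A \<union> {of_nat p *s f})" by simp
    also have "span \<dots> = span (?A \<union> {of_nat p *s f})"
      by (rule span_insert_redundant[OF span_zero])
    also have "?A \<union> {of_nat p *s f} = set (of_nat p *s f # map (rd f) (xs @ ys)) \<union> set (map (rd f) es) \<union> set gs"
      by auto
    finally have "M1 = span (set (of_nat p *s f # map (rd f) (xs @ ys)) \<union> set (map (rd f) es) \<union> set gs)" .
    moreover have "good_generators (of_nat p *s f # map (rd f) (xs @ ys)) gs"
    proof -
      have "T_poly *s of_nat p *s f = of_nat p *s T_poly *s f" by (simp add: mult.commute del: mult_pCons_left mult_pCons_right)
      then show ?thesis using T0 N0 rd_0[of T_poly] by (auto simp: good_generators_def fs)
    qed
    moreover have "lattice_rank (of_nat p *s f # map (rd f) (xs @ ys)) (map (rd f) es) gs = lattice_rank fs es gs"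
      by (simp add: lattice_rank_def fs)
    ultimately show ?thesis by blast
  next
    case G
    obtain xs ys where gs: "gs = xs @ g # ys" using G(1) by (meson split_list)
    have gM: "g \<in> M" using G M by blast
    let ?U = "set xs \<union> set ys \<union> set es"
    let ?A = "set fs \<union> rd g ` ?U"
    let ?gs = "T_poly *s g # map (rd g) (xs @ ys)"
    have "M1 = span (?A \<union> {T_poly *s g, of_nat p *s g})"
    proof (rule submodule_span[OF M1(1) _ G(2) _ T[OF gM] pM[OF gM]])
      show "?A \<subseteq> M1" using G(3) rd[OF _ gM G(2)] M by (auto simp: gs)
      have "span (insert g ?A) = M"
        unfolding span_M gens(2) by (rule arg_cong[of _ _ span]) (auto simp: gs)
      then show "M1 \<subseteq> span (insert g ?A)" using M1(2) by blast
    qed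
    also have "\<dots> = span (insert (of_nat p *s g) (?A \<union> {T_poly *s g}))" by (simp add: insert_commute)
    also have "\<dots> = span (?A \<union> {T_poly *s g})"
    proof -
      \<comment> \<open>The norm of \<open>g\<close> is zero, so \<open>p g\<close> is a multiple of
        \<open>(X - 1) g\<close> and drops out of the generators.\<close>
      have "of_nat p *s g = - (S *s T_poly *s g)" using S[of g] N0[OF G(1)] by (simp add: eq_neg_iff_add_eq_0)
      moreover have "T_poly *s g \<in> span (?A \<union> {T_poly *s g})" by (rule span_base) simp
      ultimately have "of_nat p *s g \<in> span (?A \<union> {T_poly *s g})" by (metis span_neg span_scale)
      then show ?thesis by (rule span_insert_redundant)
    qed
    also have "?A \<union> {T_poly *s g} = set fs \<union> set (map (rd g) es) \<union> set ?gs" by auto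
    finally have "M1 = span (set fs \<union> set (map (rd g) es) \<union> set ?gs)" .
    moreover have "good_generators fs ?gs"
      using T0 N0 rd_0[of "N_poly p"] N_T by (auto simp: good_generators_def gs)
    moreover have "lattice_rank fs (map (rd g) es) ?gs = lattice_rank fs es gs"
      by (simp add: lattice_rank_def gs)
    ultimately show ?thesis by blast
  next
    case E
    obtain xs ys where es: "es = xs @ e # ys" using E(1) by (meson split_list)
    have eM: "e \<in> M" using E M by blast
    let ?U = "set xs \<union> set ys"
    let ?A = "set fs \<union> set gs \<union> rd e ` ?U"
    have "M1 = span (?A \<union> {T_poly *s e, of_nat p *s e})"
    proof (rule submodule_span[OF M1(1) _ E(2) _ T[OF eM] pM[OF eM]])
      show "?A \<subseteq> M1" using E(3) rd[OF _ eM E(2)] M by (auto simp: es)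
      have "span (insert e ?A) = M"
        unfolding span_M gens(2) by (rule arg_cong[of _ _ span]) (auto simp: es)
      then show "M1 \<subseteq> span (insert e ?A)" using M1(2) by blast
    qed
    also have "\<dots> = span ((?A \<union> {T_poly *s e}) \<union> (\<lambda>_. N_poly p *s e) ` {of_nat p *s e})"
    proof -
      \<comment> \<open>Modulo \<open>(X - 1) e\<close>, the generator \<open>p e\<close> may be
        replaced by the norm of \<open>e\<close>. The norm is fixed by X and
        \<open>(X - 1) e\<close> has norm zero, so the weight \<open>p\<close> splits as
        \<open>1 + (p - 1)\<close>.\<close>
      have "N_poly p *s e = of_nat p *s e - (- S) *s T_poly *s e"
        unfolding S by (simp only: scale_minus_left diff_minus_eq_add)
      then have "\<exists>c. N_poly p *s e = u - c *s T_poly *s e" if "u \<in> {of_nat p *s e}" for u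
        using that by blast
      then have "span ((?A \<union> {T_poly *s e}) \<union> (\<lambda>_. N_poly p *s e) ` {of_nat p *s e})
          = span ((?A \<union> {T_poly *s e}) \<union> {of_nat p *s e})"
        by (intro span_replace[of _ _ "T_poly *s e"]) auto
      then show ?thesis by (simp only: Un_assoc insert_is_Un[of "T_poly *s e" "{of_nat p *s e}", symmetric])
    qed
    also have "(?A \<union> {T_poly *s e}) \<union> (\<lambda>_. N_poly p *s e) ` {of_nat p *s e}
        = set (N_poly p *s e # fs) \<union> set (map (rd e) (xs @ ys)) \<union> set (T_poly *s e # gs)" by auto
    finally have "M1 = span (set (N_poly p *s e # fs) \<union> set (map (rd e) (xs @ ys)) \<union> set (T_poly *s e # gs))" .
    moreover have "good_generators (N_poly p *s e # fs) (T_poly *s e # gs)"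
      using T0 N0 T_N N_T by (auto simp: good_generators_def)
    moreover have "lattice_rank (N_poly p *s e # fs) (map (rd e) (xs @ ys)) (T_poly *s e # gs) = lattice_rank fs es gs"
      using p0 by (simp add: lattice_rank_def es)
    ultimately show ?thesis by blast
  next
    case FG
    obtain xs ys where fs: "fs = xs @ f # ys" using FG(1) by (meson split_list)
    obtain zs ws where gs: "gs = zs @ g # ws" using FG(3) by (meson split_list)
    have fM: "f \<in> M" and gM: "g \<in> M" using FG M by blast+
    have fk: "f - [:k f g:] *s g \<in> M1" using k fM gM FG(4) by blast
    \<comment> \<open>With \<open>l\<close> congruent to \<open>- k f g\<close> modulo
      \<open>p\<close>, \<open>N_poly l *s g\<close> agrees modulo \<open>M1\<close> with
      \<open>- k f g\<close> times \<open>g\<close>, so its sum with \<open>f\<close> falls into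
      \<open>M1\<close>.\<close>
    define l where "l = nat ((- k f g) mod int p)"
    have l: "int p dvd k f g + int l"
    proof -
      have "int l = (- k f g) mod int p" using p0 by (simp add: l_def)
      then show ?thesis by (simp add: mod_eq_0_iff_dvd[symmetric] mod_simps)
    qed
    have "\<not> p dvd l"
    proof
      assume "p dvd l"
      then have "int p dvd k f g" using l by (simp add: dvd_add_left_iff)
      then obtain q where "k f g = int p * q" by blast
      then have "[:k f g:] *s g = [:q:] *s of_nat p *s g" by (simp add: of_nat_poly mult.commute)
      then have "[:k f g:] *s g \<in> M1" using pM[OF gM] M1(1) by (simp only: subspace_scale)
      then have "f \<in> M1" using fk M1(1) by (metis diff_add_cancel subspace_add)
      then show False using FG by blast
    qed
    define g' where "g' = N_poly l *s g"
    obtain U where U: "U *s g' = g" using cyclotomic_unit[OF N0[OF FG(3)] \<open>\<not> p dvd l\<close>] g'_def by blast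
    have Ng': "N_poly p *s g' = 0"
    proof -
      have "N_poly p *s g' = N_poly l *s N_poly p *s g" by (simp add: g'_def mult.commute)
      then show ?thesis using N0[OF FG(3)] by simp
    qed
    define e where "e = f + g'"
    have "e \<in> M1"
    proof -
      obtain Q where Q: "N_poly l = [:poly (N_poly l) 1:] + Q * T_poly" using poly_mod_T by blast
      obtain q where q: "int l = int p * q - k f g" using l by (metis add_diff_cancel_left' dvdE)
      have "g' = [:int l:] *s g + Q *s T_poly *s g"
        unfolding g'_def by (subst Q) (simp add: scale_left_distrib poly_N_poly del: mult_pCons_right)
      moreover have "[:int l:] *s g = [:q:] *s of_nat p *s g - [:k f g:] *s g"
        by (simp add: q of_nat_poly mult.commute flip: scale_left_diff_distrib)
      ultimately have "e = (f - [:k f g:] *s g) + ([:q:] *s of_nat p *s g + Q *s T_poly *s g)"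
        by (simp add: e_def)
      also have "\<dots> \<in> M1"
        by (rule subspace_add[OF M1(1) fk subspace_add[OF M1(1)
          subspace_scale[OF M1(1) pM[OF gM]] subspace_scale[OF M1(1) T[OF gM]]]])
      finally show ?thesis .
    qed
    let ?U = "set xs \<union> set ys \<union> set es" and ?V = "set zs \<union> set ws"
    let ?B = "rd f ` ?U \<union> rd g ` ?V"
    let ?A = "insert e ?B"
    have "M1 = span (?A \<union> {T_poly *s f, of_nat p *s f})"
    proof (rule submodule_span[OF M1(1) _ FG(2) _ T[OF fM] pM[OF fM]])
      show "?A \<subseteq> M1" using \<open>e \<in> M1\<close> rd[OF _ fM FG(2)] rd[OF _ gM FG(4)] M by (auto simp: fs gs)
      have "span (insert f ?A) = span (insert f (insert g ?B))"
      proof (subst span_eq, intro conjI insert_subsetI)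
        let ?C = "insert f (insert g ?B)"
        have "f \<in> span ?C" "g \<in> span ?C" by (auto intro: span_base)
        then show "f \<in> span ?C" "e \<in> span ?C" unfolding e_def g'_def by (auto intro: span_add span_scale)
        show "?B \<subseteq> span ?C" using span_superset[of ?C] by blast
        have fe: "f \<in> span (insert f ?A)" "e \<in> span (insert f ?A)" by (auto intro: span_base)
        then show "f \<in> span (insert f ?A)" by simp
        \<comment> \<open>The inverse of the cyclotomic unit recovers \<open>g\<close> from
          \<open>e\<close> and \<open>f\<close>; an integer multiple of \<open>g\<close> in place of
          \<open>g'\<close> would not allow this in general.\<close>
        have "g = U *s (e - f)" by (simp add: e_def U)
        then show "g \<in> span (insert f ?A)" using fe by (metis span_diff span_scale)
        show "?B \<subseteq> span (insert f ?A)" using span_superset[of "insert f ?A"] by blast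
      qed
      also have "insert f (insert g ?B) = insert g (insert f (rd f ` ?U) \<union> rd g ` ?V)" by auto
      also have "span \<dots> = span (insert g (insert f (rd f ` ?U) \<union> ?V))" by (rule span_M)
      also have "insert g (insert f (rd f ` ?U) \<union> ?V) = insert f (insert g ?V \<union> rd f ` ?U)" by auto
      also have "span \<dots> = span (insert f (insert g ?V \<union> ?U))" by (rule span_M)
      also have "\<dots> = M"
        unfolding gens(2) by (rule arg_cong[of _ _ span]) (auto simp: fs gs)
      finally show "M1 \<subseteq> span (insert f ?A)" using M1(2) by blast
    qed
    also have "T_poly *s f = 0" using T0 FG by blast
    also have "span (?A \<union> {0, of_nat p *s f}) = span ?A"
    proof -
      \<comment> \<open>The norm acts as \<open>p\<close> on \<open>f\<close> and kills
        \<open>g'\<close>, so \<open>p f\<close> is redundant and the weights 1 and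
        \<open>p - 1\<close> merge into \<open>p\<close>.\<close>
      have "of_nat p *s f = N_poly p *s e"
        using S[of f] T0[OF FG(1)] Ng' by (simp add: e_def scale_right_distrib)
      moreover have "e \<in> span ?A" by (rule span_base) simp
      ultimately have "of_nat p *s f \<in> span ?A" by (simp only: span_scale)
      moreover have "?A \<union> {0, of_nat p *s f} = insert 0 (insert (of_nat p *s f) ?A)" by auto
      ultimately show ?thesis by (simp only: span_insert_redundant span_zero)
    qed
    also have "?A = set (map (rd f) (xs @ ys)) \<union> set (e # map (rd f) es) \<union> set (map (rd g) (zs @ ws))" by auto
    finally have "M1 = span (set (map (rd f) (xs @ ys)) \<union> set (e # map (rd f) es) \<union> set (map (rd g) (zs @ ws)))" .
    moreover have "good_generators (map (rd f) (xs @ ys)) (map (rd g) (zs @ ws))"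
      using T0 N0 rd_0[of T_poly] rd_0[of "N_poly p"] by (auto simp: good_generators_def fs gs)
    moreover have "lattice_rank (map (rd f) (xs @ ys)) (e # map (rd f) es) (map (rd g) (zs @ ws)) = lattice_rank fs es gs"
      using p0 by (simp add: lattice_rank_def fs gs)
    ultimately show ?thesis by blast
  qed
qed

text \<open>Only the number of generators is recorded: their independence will follow from the transcendence
  degree of the fixed field.\<close>

lemma submodule_generators:
  fixes r :: nat
  assumes "good_generators fs gs" "M = span (set fs \<union> set es \<union> set gs)" "subspace M'" "M' \<subseteq> M"
    and R: "finite R" "\<And>v. v \<in> M \<Longrightarrow> \<exists>r\<in>R. v - r \<in> M'"
    and exponent: "\<And>v. v \<in> M \<Longrightarrow> of_nat p ^ r *s v \<in> M'"
  shows "\<exists>fs' es' gs'. good_generators fs' gs' \<and> M' = span (set fs' \<union> set es' \<union> set gs')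
    \<and> lattice_rank fs' es' gs' = lattice_rank fs es gs"
  using assms
proof (induction "card (R \<inter> M)" arbitrary: M fs es gs rule: less_induct)
  case less
  show ?case
  proof (cases "M' = M")
    case True
    then show ?thesis using less.prems by blast
  next
    case False
    have M: "subspace M" unfolding less.prems(2) by (rule subspace_span)
    obtain M1 where M1: "subspace M1" "M' \<subseteq> M1" "M1 \<subset> M"
      "\<And>v. v \<in> M \<Longrightarrow> T_poly *s v \<in> M1" "\<And>v. v \<in> M \<Longrightarrow> of_nat p *s v \<in> M1"
      "\<And>u v. u \<in> M \<Longrightarrow> v \<in> M \<Longrightarrow> v \<notin> M1 \<Longrightarrow> \<exists>k. u - [:k:] *s v \<in> M1"
      using maximal_submodule[OF less.prems(3) M _ less.prems(5,6,7)] False less.prems(4) by blast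
    obtain fs1 es1 gs1 where 1: "good_generators fs1 gs1" "M1 = span (set fs1 \<union> set es1 \<union> set gs1)"
      "lattice_rank fs1 es1 gs1 = lattice_rank fs es gs"
      using submodule_step[OF less.prems(1,2) M1(1,3-)] by blast
    obtain v where v: "v \<in> M" "v \<notin> M1" using M1 by blast
    obtain t where t: "t \<in> R" "v - t \<in> M'" using less.prems(6)[OF v(1)] by blast
    have "t \<in> M" using subspace_diff[OF M v(1), of "v - t"] t less.prems(4) by auto
    moreover have "t \<notin> M1" using subspace_add[OF M1(1), of t "v - t"] t v M1(2) by auto
    ultimately have "card (R \<inter> M1) < card (R \<inter> M)"
      using M1(3) t(1) less.prems(5) by (intro psubset_card_mono) auto
    from less.hyps[OF this 1(1,2) less.prems(3) M1(2) less.prems(5)] show ?thesis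
      using less.prems(6,7) M1(3) 1(3) by auto
  qed
qed

end

hide_const (open) Polynomial.order

section \<open>Finite groups of field automorphisms\<close>

definition monom_int :: "'i set \<Rightarrow> ('i \<Rightarrow> 'l::field) \<Rightarrow> ('i \<Rightarrow> int) \<Rightarrow> 'l" where
  "monom_int I x v = (\<Prod>i\<in>I. x i powi v i)"

text \<open>The composition law is demanded on \<open>L0\<close> only, where it can be checked on
  generators. \<open>rc\<close> embeds the type of scalars into the ambient field.\<close>

locale group_field_action = group G for G (structure) +
  fixes act :: "'a \<Rightarrow> 'l::field \<Rightarrow> 'l" and rc :: "'k::field \<Rightarrow> 'l" and L0 :: "'l set"
  assumes finite_G: "finite (carrier G)"
    and L0: "is_subfield L0"
    and rc_1: "rc 1 = 1" and rc_add: "rc (a + b) = rc a + rc b" and rc_mult: "rc (a * b) = rc a * rc b"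
    and rc_L0: "rc a \<in> L0"
    and act_add: "g \<in> carrier G \<Longrightarrow> act g (x + y) = act g x + act g y"
    and act_mult: "g \<in> carrier G \<Longrightarrow> act g (x * y) = act g x * act g y"
    and act_rc: "g \<in> carrier G \<Longrightarrow> act g (rc a) = rc a"
    and act_closed: "g \<in> carrier G \<Longrightarrow> x \<in> L0 \<Longrightarrow> act g x \<in> L0"
    and act_act: "g \<in> carrier G \<Longrightarrow> h \<in> carrier G \<Longrightarrow> x \<in> L0 \<Longrightarrow> act g (act h x) = act (g \<otimes> h) x"
    and act_one: "x \<in> L0 \<Longrightarrow> act \<one> x = x"
begin

abbreviation "K \<equiv> range rc"

lemma rc_0: "rc 0 = 0"
  using rc_add[of 0 0] by (metis add_cancel_right_right add_0)

lemma rc_uminus: "rc (- a) = - rc a"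
  using rc_add[of a "- a"] by (simp add: rc_0 eq_neg_iff_add_eq_0 add.commute)

lemma rc_diff: "rc (a - b) = rc a - rc b"
  using rc_add[of a "- b"] by (simp add: rc_uminus)

lemma rc_inverse: "rc (inverse a) = inverse (rc a)"
proof (cases "a = 0")
  case False
  then have "rc a * rc (inverse a) = 1" by (simp add: rc_1 flip: rc_mult)
  then show ?thesis by (simp add: inverse_unique)
qed (simp add: rc_0)

lemma rc_eq_0_iff: "rc a = 0 \<longleftrightarrow> a = 0"
  using rc_mult[of a "inverse a"] rc_1 rc_0 by (cases "a = 0") auto

lemma rc_power: "rc (a ^ n) = rc a ^ n"
  by (induction n) (simp_all add: rc_1 rc_mult)

lemma rc_power_int: "rc (a powi n) = rc a powi n"
  by (simp add: power_int_def rc_power rc_inverse)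

lemma rc_of_nat: "rc (of_nat n) = of_nat n"
  by (induction n) (simp_all add: rc_0 rc_1 rc_add)

lemma rc_sum: "rc (sum f I) = (\<Sum>i\<in>I. rc (f i))"
  by (induction I rule: infinite_finite_induct) (simp_all add: rc_0 rc_add)

lemma subfield_K: "is_subfield K"
  by (rule is_subfieldI) (auto simp flip: rc_diff rc_mult rc_inverse, metis rc_0 rangeI, metis rc_1 rangeI)

context
  fixes g assumes g: "g \<in> carrier G"
begin

lemma act_0: "act g 0 = 0" and act_1: "act g 1 = 1"
  using act_rc[OF g, of 0] act_rc[OF g, of 1] by (simp_all add: rc_0 rc_1)

lemma act_uminus: "act g (- x) = - act g x"
  using act_add[OF g, of x "- x"] by (simp add: act_0 eq_neg_iff_add_eq_0 add.commute)

lemma act_diff: "act g (x - y) = act g x - act g y"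
  using act_add[OF g, of x "- y"] by (simp add: act_uminus)

lemma act_inverse: "act g (inverse x) = inverse (act g x)"
proof (cases "x = 0")
  case False
  then have "act g x * act g (inverse x) = 1" by (simp add: act_1 flip: act_mult[OF g])
  then show ?thesis by (simp add: inverse_unique)
qed (simp add: act_0)

lemma act_divide: "act g (x / y) = act g x / act g y"
  by (simp add: divide_inverse act_mult[OF g] act_inverse)

lemma act_eq_0_iff: "act g x = 0 \<longleftrightarrow> x = 0"
  using act_mult[OF g, of x "inverse x"] act_1 act_0 by (cases "x = 0") auto

lemma act_power: "act g (x ^ n) = act g x ^ n"
  by (induction n) (simp_all add: act_1 act_mult[OF g])

lemma act_power_int: "act g (x powi n) = act g x powi n"
  by (simp add: power_int_def act_power act_inverse)

lemma act_sum: "act g (sum f I) = (\<Sum>i\<in>I. act g (f i))"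
  by (induction I rule: infinite_finite_induct) (simp_all add: act_0 act_add[OF g])

lemma act_prod: "act g (prod f I) = (\<Prod>i\<in>I. act g (f i))"
  by (induction I rule: infinite_finite_induct) (simp_all add: act_1 act_mult[OF g])

definition "act_poly = map_poly (act g)"

lemma act_poly_coeff: "Polynomial.coeff (act_poly P) i = act g (Polynomial.coeff P i)"
  by (simp add: act_poly_def coeff_map_poly act_0)

lemma act_poly_mult: "act_poly (P * Q) = act_poly P * act_poly Q"
  by (rule poly_eqI) (simp add: act_poly_coeff coeff_mult act_sum act_mult[OF g])

lemma act_poly_pCons: "act_poly (pCons a P) = pCons (act g a) (act_poly P)"
  by (rule poly_eqI) (simp add: act_poly_coeff coeff_pCons split: nat.splits)

lemma act_poly_0: "act_poly 0 = 0" and act_poly_1: "act_poly 1 = 1"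
  by (simp_all add: act_poly_def act_1)

lemma act_poly_prod: "act_poly (prod f I) = (\<Prod>i\<in>I. act_poly (f i))"
  by (induction I rule: infinite_finite_induct) (simp_all add: act_poly_1 act_poly_mult)

lemma poly_act_poly: "poly (act_poly P) (act g x) = act g (poly P x)"
  by (induction P) (simp_all add: act_poly_0 act_poly_pCons act_0 act_add[OF g] act_mult[OF g])

end

definition fixed :: "'a set \<Rightarrow> 'l set" where
  "fixed S = {x \<in> L0. \<forall>g\<in>S. act g x = x}"

lemma subfield_fixed:
  assumes "S \<subseteq> carrier G"
  shows "is_subfield (fixed S)"
proof -
  have S: "g \<in> carrier G" if "g \<in> S" for g using that assms by blast
  show ?thesis
    unfolding fixed_def
    by (rule is_subfieldI)
      (auto simp: act_0[OF S] act_1[OF S] act_diff[OF S] act_mult[OF S] act_inverse[OF S]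
        intro: subfield_intros[OF L0])
qed

lemma K_fixed: "S \<subseteq> carrier G \<Longrightarrow> K \<subseteq> fixed S"
  using act_rc rc_L0 by (auto simp: fixed_def)

lemma bij_mult_subgroup:
  assumes "subgroup H G" "g \<in> H"
  shows "bij_betw (\<lambda>h. g \<otimes> h) H H"
proof (rule bij_betwI)
  interpret H: subgroup H G by fact
  show "(\<lambda>h. g \<otimes> h) \<in> H \<rightarrow> H" "(\<lambda>h. inv g \<otimes> h) \<in> H \<rightarrow> H"
    using assms(2) by auto
  show "inv g \<otimes> (g \<otimes> h) = h" "g \<otimes> (inv g \<otimes> h) = h" if "h \<in> H" for h
    using assms(2) that by (simp_all add: H.mem_carrier flip: m_assoc)
qed

lemma
  assumes "subgroup H G" "g \<in> H" "x \<in> L0"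
  shows act_sum_orbit: "act g (\<Sum>h\<in>H. act h x) = (\<Sum>h\<in>H. act h x)"
    and act_prod_orbit: "act g (\<Prod>h\<in>H. act h x) = (\<Prod>h\<in>H. act h x)"
proof -
  interpret H: subgroup H G by fact
  have g: "g \<in> carrier G" using assms by (simp add: H.mem_carrier)
  have "act g (\<Sum>h\<in>H. act h x) = (\<Sum>h\<in>H. act (g \<otimes> h) x)"
    unfolding act_sum[OF g] using act_act[OF g _ assms(3)] by (intro sum.cong) auto
  also have "\<dots> = (\<Sum>h\<in>H. act h x)"
    by (rule sum.reindex_bij_betw[OF bij_mult_subgroup[OF assms(1,2)]])
  finally show "act g (\<Sum>h\<in>H. act h x) = (\<Sum>h\<in>H. act h x)" .
  have "act g (\<Prod>h\<in>H. act h x) = (\<Prod>h\<in>H. act (g \<otimes> h) x)"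
    unfolding act_prod[OF g] using act_act[OF g _ assms(3)] by (intro prod.cong) auto
  also have "\<dots> = (\<Prod>h\<in>H. act h x)"
    by (rule prod.reindex_bij_betw[OF bij_mult_subgroup[OF assms(1,2)]])
  finally show "act g (\<Prod>h\<in>H. act h x) = (\<Prod>h\<in>H. act h x)" .
qed

sublocale vs: vector_space "\<lambda>c x. rc c * x"
  by standard (simp_all add: rc_add rc_mult rc_1 algebra_simps)

lemma span_mult_closed:
  assumes "\<And>a b. a \<in> A \<Longrightarrow> b \<in> A \<Longrightarrow> a * b \<in> A" "x \<in> vs.span A" "y \<in> vs.span A"
  shows "x * y \<in> vs.span A"
  using assms(2)
proof (induction rule: vs.span_induct_alt)
  case base
  then show ?case by (simp add: vs.span_zero)
next
  case (step c a u)
  have "a * y \<in> vs.span A"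
    using assms(3)
  proof (induction rule: vs.span_induct_alt)
    case base
    then show ?case by (simp add: vs.span_zero)
  next
    case (step d b w)
    have "a * (rc d * b + w) = rc d * (a * b) + a * w" by (simp add: algebra_simps)
    then show ?case using step assms(1) \<open>a \<in> A\<close> vs.span_add vs.span_scale vs.span_base by metis
  qed
  moreover have "(rc c * a + u) * y = rc c * (a * y) + u * y" by (simp add: algebra_simps)
  ultimately show ?case using step vs.span_add vs.span_scale by metis
qed

text \<open>As \<open>A\<close> is a multiplicative monoid, its linear span over \<open>K\<close> is
  a ring, and the adjoined field consists of quotients.\<close>

lemma adjoin_span_fraction:
  assumes "1 \<in> A" "\<And>a b. a \<in> A \<Longrightarrow> b \<in> A \<Longrightarrow> a * b \<in> A" "x \<in> adjoin K A"
  shows "\<exists>P\<in>vs.span A. \<exists>Q\<in>vs.span A. Q \<noteq> 0 \<and> x = P / Q"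
proof -
  let ?R = "{P / Q |P Q. P \<in> vs.span A \<and> Q \<in> vs.span A \<and> Q \<noteq> 0}"
  have one: "1 \<in> vs.span A" using assms(1) by (rule vs.span_base)
  have span: "P \<in> ?R" if "P \<in> vs.span A" for P
    using that one by (intro CollectI exI[of _ P] exI[of _ 1]) auto
  have mult: "P * Q \<in> vs.span A" if "P \<in> vs.span A" "Q \<in> vs.span A" for P Q
    using span_mult_closed[OF assms(2)] that by blast
  have "is_subfield ?R"
  proof (rule is_subfieldI)
    show "0 \<in> ?R" "1 \<in> ?R" using span vs.span_zero one by blast+
    fix u assume "u \<in> ?R"
    then obtain P Q where u: "u = P / Q" "P \<in> vs.span A" "Q \<in> vs.span A" "Q \<noteq> 0" by blast
    show "inverse u \<in> ?R"
    proof (cases "P = 0")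
      case True
      then show ?thesis using u \<open>0 \<in> ?R\<close> by simp
    next
      case False
      then show ?thesis using u by (intro CollectI exI[of _ Q] exI[of _ P]) auto
    qed
    fix w assume "w \<in> ?R"
    then obtain P' Q' where w: "w = P' / Q'" "P' \<in> vs.span A" "Q' \<in> vs.span A" "Q' \<noteq> 0" by blast
    have QQ: "Q * Q' \<in> vs.span A" "Q * Q' \<noteq> 0" using u w mult by auto
    have "u - w = (P * Q' - P' * Q) / (Q * Q')" using u w by (simp add: diff_frac_eq)
    moreover have "P * Q' - P' * Q \<in> vs.span A" using u w mult by (intro vs.span_diff) auto
    ultimately show "u - w \<in> ?R" using QQ by blast
    have "u * w = (P * P') / (Q * Q')" using u w by simp
    moreover have "P * P' \<in> vs.span A" using u w mult by auto
    ultimately show "u * w \<in> ?R" using QQ by blast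
  qed
  moreover have "rc c \<in> vs.span A" for c using vs.span_scale[OF one, of c] by simp
  then have "K \<subseteq> ?R" using span by auto
  moreover have "A \<subseteq> ?R" using span vs.span_base by blast
  ultimately have "adjoin K A \<subseteq> ?R" by (simp add: adjoin_subset_iff)
  then show ?thesis using assms(3) by blast
qed

text \<open>Averaging over \<open>H\<close> multiplies an eigenvector by a constant, which vanishes unless the
  eigenvector is invariant; so no linear independence is needed here.\<close>

lemma fixed_eigenvectors:
  assumes H: "subgroup H G" "of_nat (card H) \<noteq> (0 :: 'k)"
    and A: "A \<subseteq> L0" "1 \<in> A" "\<And>a b. a \<in> A \<Longrightarrow> b \<in> A \<Longrightarrow> a * b \<in> A"
    and eigen: "\<And>a h. a \<in> A \<Longrightarrow> h \<in> H \<Longrightarrow> \<exists>c. act h a = rc c * a"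
    and x: "x \<in> adjoin K A" "\<And>h. h \<in> H \<Longrightarrow> act h x = x"
  shows "x \<in> adjoin K {a \<in> A. \<forall>h\<in>H. act h a = a}"
proof -
  interpret H: subgroup H G by fact
  let ?F = "adjoin K {a \<in> A. \<forall>h\<in>H. act h a = a}"
  have F: "is_subfield ?F" by (rule is_subfield_hull)
  have finH: "finite H" using H.subset finite_G finite_subset by blast
  have spanL: "vs.span A \<subseteq> L0"
  proof
    fix v assume "v \<in> vs.span A"
    then show "v \<in> L0"
      by (induction rule: vs.span_induct_alt) (use A(1) rc_L0 in \<open>auto intro!: subfield_intros[OF L0]\<close>)
  qed
  have act_span: "act h v \<in> vs.span A" if h: "h \<in> H" and v: "v \<in> vs.span A" for h v
    using v
  proof (induction rule: vs.span_induct_alt)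
    case base
    then show ?case using h by (simp add: act_0[OF H.mem_carrier] vs.span_zero)
  next
    case (step c a u)
    obtain d where "act h a = rc d * a" using eigen[OF step(1) h] by blast
    then have "act h (rc c * a + u) = rc (c * d) * a + act h u"
      using h by (simp add: act_add act_mult act_rc rc_mult H.mem_carrier)
    then show ?case using step vs.span_add vs.span_scale vs.span_base by metis
  qed
  have avg: "(\<Sum>h\<in>H. act h v) \<in> ?F" if "v \<in> vs.span A" for v
    using that
  proof (induction rule: vs.span_induct_alt)
    case base
    then show ?case using subfield_0[OF F] by (simp add: act_0[OF H.mem_carrier])
  next
    case (step c a u)
    obtain d where d: "\<And>h. h \<in> H \<Longrightarrow> act h a = rc (d h) * a" using eigen[OF step(1)] by metis
    then have avg_a: "(\<Sum>h\<in>H. act h a) = rc (\<Sum>h\<in>H. d h) * a" by (simp add: rc_sum sum_distrib_right)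
    have "(\<Sum>h\<in>H. act h a) \<in> ?F"
    proof (cases "(\<Sum>h\<in>H. d h) = 0")
      case True
      then show ?thesis using avg_a subfield_0[OF F] by (simp add: rc_0)
    next
      case False
      have "act h a = a" if h: "h \<in> H" for h
      proof -
        have "act h (rc (\<Sum>h\<in>H. d h) * a) = rc (\<Sum>h\<in>H. d h) * a"
          unfolding avg_a[symmetric] by (rule act_sum_orbit[OF H(1) h]) (use A(1) step(1) in blast)
        then show ?thesis using h False by (simp add: act_mult act_rc H.mem_carrier rc_eq_0_iff)
      qed
      then have "a \<in> {a \<in> A. \<forall>h\<in>H. act h a = a}" using step(1) by blast
      then have "a \<in> ?F" by (rule adjoin_gen)
      then show ?thesis unfolding avg_a by (rule subfield_mult[OF F adjoin_base[OF rangeI]])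
    qed
    moreover have "(\<Sum>h\<in>H. act h (rc c * a + u)) = rc c * (\<Sum>h\<in>H. act h a) + (\<Sum>h\<in>H. act h u)"
      by (simp add: act_add act_mult act_rc H.mem_carrier sum.distrib sum_distrib_left)
    ultimately show ?case
      using subfield_add[OF F subfield_mult[OF F adjoin_base[OF rangeI[of rc c]]] step.IH] by (simp only:)
  qed
  have inv: "v \<in> ?F" if "v \<in> vs.span A" "\<And>h. h \<in> H \<Longrightarrow> act h v = v" for v
  proof -
    have "(\<Sum>h\<in>H. act h v) = of_nat (card H) * v" using that(2) by simp
    then have "of_nat (card H) * v \<in> ?F" using avg[OF that(1)] by (simp only:)
    then have "of_nat (card H) * v / of_nat (card H) \<in> ?F"
      by (rule subfield_divide[OF F _ subfield_of_nat[OF F]])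
    moreover have "(of_nat (card H) :: 'l) \<noteq> 0" using H(2) rc_eq_0_iff[of "of_nat (card H)"] by (simp only: rc_of_nat not_False_eq_True)
    ultimately show ?thesis by simp
  qed
  obtain P Q where PQ: "P \<in> vs.span A" "Q \<in> vs.span A" "Q \<noteq> 0" "x = P / Q"
    using adjoin_span_fraction[OF A(2,3) x(1)] by blast
  have one: "1 \<in> vs.span A" using A(2) by (rule vs.span_base)
  have prod: "(\<Prod>h\<in>S. act h Q) \<in> vs.span A" if "S \<subseteq> H" for S
  proof -
    have "finite S" using that finH finite_subset by blast
    then show ?thesis using that
      by (induction S rule: finite_induct) (auto intro!: span_mult_closed[OF A(3)] act_span PQ one)
  qed
  \<comment> \<open>The norm of the denominator: writing \<open>x\<close> over \<open>N\<close>
    makes the denominator invariant, and then the numerator is invariant too.\<close>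
  define N where "N = (\<Prod>h\<in>H. act h Q)"
  have N: "N = Q * (\<Prod>h\<in>H - {\<one>}. act h Q)"
    unfolding N_def using finH act_one[of Q] PQ(2) spanL by (subst prod.remove[of _ \<one>]) auto
  have "N \<noteq> 0" unfolding N_def using finH PQ(3) act_eq_0_iff H.mem_carrier by simp
  have Ninv: "act h N = N" if "h \<in> H" for h
    unfolding N_def using act_prod_orbit[OF H(1) that] PQ(2) spanL by blast
  have xN: "x * N \<in> vs.span A"
  proof -
    have "x * N = P * (\<Prod>h\<in>H - {\<one>}. act h Q)" using PQ by (simp add: N)
    then show ?thesis using span_mult_closed[OF A(3) PQ(1) prod[of "H - {\<one>}"]] by simp
  qed
  have "x * N \<in> ?F" using xN Ninv x(2) by (intro inv) (auto simp: act_mult H.mem_carrier)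
  moreover have "N \<in> ?F" using prod[of H] Ninv by (intro inv) (auto simp: N_def)
  ultimately have "x * N / N \<in> ?F" by (rule subfield_divide[OF F])
  then show ?thesis using \<open>N \<noteq> 0\<close> by simp
qed

text \<open>The orbit polynomial, whose linear factors are permuted by \<open>G\<close>, has
  \<open>x\<close> as a root.\<close>

lemma alg_over_fixed:
  assumes "x \<in> L0"
  shows "alg_over (fixed (carrier G)) x"
proof -
  define P where "P = (\<Prod>h\<in>carrier G. [:- act h x, 1:])"
  have "P \<noteq> 0" using finite_G by (simp add: P_def)
  moreover have "poly P x = 0"
    using finite_G act_one[OF assms] by (auto simp: P_def poly_prod intro!: bexI[of _ \<one>])
  moreover have "P \<in> polys_over (fixed (carrier G))"
  proof -
    have "P \<in> polys_over L0"
      unfolding P_def using act_closed[OF _ assms]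
      by (intro polys_over_prod[OF L0]) (auto intro!: subfield_intros[OF L0] polys_over_intros[OF L0])
    moreover have "act_poly g P = P" if g: "g \<in> carrier G" for g
    proof -
      have "act_poly g P = (\<Prod>h\<in>carrier G. [:- act (g \<otimes> h) x, 1:])"
        unfolding P_def act_poly_prod[OF g]
        by (intro prod.cong) (simp_all add: act_poly_pCons[OF g] act_poly_0[OF g] act_uminus[OF g] act_1[OF g] act_act[OF g _ assms])
      also have "\<dots> = P" unfolding P_def
        by (rule prod.reindex_bij_betw[OF bij_mult_subgroup[OF subgroup_self g]])
      finally show ?thesis .
    qed
    ultimately show ?thesis unfolding polys_over_def fixed_def by (auto simp flip: act_poly_coeff)
  qed
  ultimately show ?thesis unfolding alg_over_def by blast
qed

end

section \<open>Regularly permuted variables and the count of generators\<close>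

locale noether_action = group_field_action G act rc L0 for G (structure) and act :: "'a \<Rightarrow> 'l::field \<Rightarrow> 'l"
    and rc :: "'k::field \<Rightarrow> 'l" and L0 +
  fixes x :: "'a \<Rightarrow> 'l"
  assumes act_x: "g \<in> carrier G \<Longrightarrow> h \<in> carrier G \<Longrightarrow> act g (x h) = x (g \<otimes> h)"
    and L0_eq: "L0 = adjoin (range rc) (x ` carrier G)"
    and x_independent: "h \<in> carrier G \<Longrightarrow> \<not> alg_over (adjoin (range rc) (x ` (carrier G - {h}))) (x h)"
begin

lemma inj_x: "inj_on x (carrier G)"
proof (rule inj_onI, rule ccontr)
  fix g h assume gh: "g \<in> carrier G" "h \<in> carrier G" "x g = x h" "g \<noteq> h"
  then have "x g \<in> adjoin K (x ` (carrier G - {g}))" by (intro adjoin_gen) (auto simp: image_iff)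
  then show False using x_independent[OF gh(1)] alg_over_base[OF is_subfield_hull] by blast
qed

lemma x_L0: "g \<in> carrier G \<Longrightarrow> x g \<in> L0"
  unfolding L0_eq by (intro adjoin_gen) auto

lemma generators_independent:
  assumes "finite B" "card B \<le> order G" "\<And>h. h \<in> carrier G \<Longrightarrow> alg_over (adjoin K B) (x h)"
  shows "card B = order G" "b \<in> B \<Longrightarrow> \<not> alg_over (adjoin K (B - {b})) b"
proof -
  have card: "card (x ` carrier G) = order G" using inj_x by (simp add: card_image Coset.order_def)
  have indep: "\<not> alg_over (adjoin K (x ` carrier G - {a})) a" if "a \<in> x ` carrier G" for a
  proof -
    from that obtain h where h: "a = x h" "h \<in> carrier G" by (rule imageE)
    then have "x ` carrier G - {a} = x ` (carrier G - {h})" using inj_x by (auto simp: inj_on_def)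
    then show ?thesis using x_independent[OF h(2)] h(1) by simp
  qed
  have span: "alg_over (adjoin K B) a" if "a \<in> x ` carrier G" for a
    using that by (rule imageE) (simp only: assms(3))
  have fin: "finite (x ` carrier G)" "card B \<le> card (x ` carrier G)" using finite_G assms(2) card by auto
  show "card B = order G"
    using spanning_independent(1)[OF fin(1) assms(1) fin(2) indep span] card by simp
  show "b \<in> B \<Longrightarrow> \<not> alg_over (adjoin K (B - {b})) b"
    by (rule spanning_independent(2)[OF fin(1) assms(1) fin(2) indep span])
qed

text \<open>The variables are independent and algebraic over the fixed field, so
  \<open>order G\<close> is a lower bound for the number of generators; meeting it forces the
  generators to be independent.\<close>

lemma rational_if_few_generators:
  assumes "finite B" "card B \<le> order G" "fixed (carrier G) = adjoin K B"
  shows "rational_over K (fixed (carrier G))"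
proof -
  have "alg_over (adjoin K B) (x h)" if "h \<in> carrier G" for h
    using alg_over_fixed[OF x_L0[OF that]] assms(3) by simp
  from generators_independent(2)[OF assms(1,2) this] have "algebraically_independent K B"
    by (intro algebraically_independentI subfield_K assms(1))
  then show ?thesis unfolding rational_over_def using assms(3) subfield_K by blast
qed

end

section \<open>Roots of unity and eigenvectors\<close>

lemma primitive_root_power_eq_1:
  fixes z :: "'k::field"
  assumes "primitive_root_of_unity m z" "z ^ l = 1"
  shows "m dvd l"
proof -
  have m: "0 < m" "z ^ m = 1" using assms(1) by (auto simp: primitive_root_of_unity_def)
  have "z ^ l = z ^ (m * (l div m)) * z ^ (l mod m)" by (simp flip: power_add)
  then have "z ^ (l mod m) = 1" using assms(2) m by (simp add: power_mult)
  then have "\<not> 0 < l mod m" using assms(1) m(1) unfolding primitive_root_of_unity_def by (metis mod_less_divisor)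
  then show ?thesis by auto
qed

lemma primitive_root_power_inj:
  fixes z :: "'k::field"
  assumes "primitive_root_of_unity m z" "i < m" "j < m" "z ^ i = z ^ j"
  shows "i = j"
  using assms(2-)
proof (induction i j rule: linorder_wlog)
  case (le i j)
  have "z ^ m = 1" "0 < m" using assms(1) by (auto simp: primitive_root_of_unity_def)
  then have "z \<noteq> 0" by (metis power_0_left zero_neq_one less_numeral_extra(3))
  have "z ^ i * z ^ (j - i) = z ^ j" using le(1) by (metis le_add_diff_inverse power_add)
  then have "z ^ (j - i) = 1" using le(4) \<open>z \<noteq> 0\<close> by (metis mult_cancel_left2 power_not_zero)
  then have "m dvd j - i" by (rule primitive_root_power_eq_1[OF assms(1)])
  then show ?case using le by (auto dest: dvd_imp_le)
qed auto

text \<open>The first \<open>m\<close> powers of \<open>z\<close> are distinct roots of a polynomial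
  of degree \<open>m\<close>, hence all of its roots.\<close>

lemma root_of_unity_is_power:
  fixes z :: "'k::field"
  assumes "primitive_root_of_unity m z" "w ^ m = 1"
  obtains t where "w = z ^ t"
proof -
  have m: "0 < m" "z ^ m = 1" using assms(1) by (auto simp: primitive_root_of_unity_def)
  have z: "z \<noteq> 0" using m by (metis power_0_left zero_neq_one less_numeral_extra(3))
  let ?P = "Polynomial.monom 1 m - 1 :: 'k poly"
  have deg: "Polynomial.degree ?P = m"
  proof (rule antisym)
    show "Polynomial.degree ?P \<le> m" using degree_monom_le[of "1 :: 'k" m] by (intro degree_diff_le) auto
    show "m \<le> Polynomial.degree ?P" using m(1) by (intro le_degree) (simp add: coeff_1)
  qed
  have P0: "?P \<noteq> 0" using deg m(1) by auto
  have inj: "inj_on (\<lambda>i. z ^ i) {..<m}"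
    using primitive_root_power_inj[OF assms(1)] by (auto intro: inj_onI)
  have sub: "(\<lambda>i. z ^ i) ` {..<m} \<subseteq> {x. poly ?P x = 0}"
  proof
    fix x assume "x \<in> (\<lambda>i. z ^ i) ` {..<m}"
    then obtain i where "x = z ^ i" by blast
    then have "x ^ m = (z ^ m) ^ i" by (simp flip: power_mult add: mult.commute)
    then show "x \<in> {x. poly ?P x = 0}" using m(2) by (simp add: poly_monom)
  qed
  have "card {x. poly ?P x = 0} \<le> card ((\<lambda>i. z ^ i) ` {..<m})"
    using card_poly_roots_bound[OF P0] deg inj by (simp add: card_image)
  then have "(\<lambda>i. z ^ i) ` {..<m} = {x. poly ?P x = 0}"
    using sub poly_roots_finite[OF P0] by (intro card_seteq) auto
  then have "w \<in> (\<lambda>i. z ^ i) ` {..<m}" using assms(2) by (simp add: poly_monom)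
  then show ?thesis using that by blast
qed

lemma sum_powers_root_of_unity:
  fixes z :: "'k::field"
  assumes "z ^ m = 1" "z \<noteq> 1"
  shows "(\<Sum>k<m. z ^ k) = 0"
  using assms by (simp add: geometric_sum)

section \<open>Discrete Fourier transform\<close>

context group_field_action
begin

text \<open>Up to a factor \<open>m\<close>, the component of \<open>y\<close> on which the cyclic
  shift acts as \<open>z ^ k\<close>.\<close>

definition dft :: "nat \<Rightarrow> 'k \<Rightarrow> (nat \<Rightarrow> 'l) \<Rightarrow> nat \<Rightarrow> 'l" where
  "dft m z y k = (\<Sum>j<m. rc (inverse z ^ (k * j)) * y j)"

lemma dft_inverse:
  assumes z: "primitive_root_of_unity m z" and l: "l < m"
  shows "(\<Sum>k<m. rc (z ^ (k * l)) * dft m z y k) = of_nat m * y l"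
proof -
  have m: "0 < m" "z ^ m = 1" using z by (auto simp: primitive_root_of_unity_def)
  have z0: "z \<noteq> 0" using m by (metis power_0_left zero_neq_one less_numeral_extra(3))
  have orth: "(\<Sum>k<m. z ^ (k * l) * inverse z ^ (k * j)) = (if j = l then of_nat m else 0)" if j: "j < m" for j
  proof -
    let ?q = "z ^ l * inverse z ^ j"
    have "(\<Sum>k<m. z ^ (k * l) * inverse z ^ (k * j)) = (\<Sum>k<m. ?q ^ k)"
      by (simp add: power_mult_distrib mult.commute flip: power_mult)
    also have "\<dots> = (if j = l then of_nat m else 0)"
    proof (cases "j = l")
      case True
      then show ?thesis using z0 by (simp add: power_inverse)
    next
      case False
      have "?q \<noteq> 1"
      proof
        assume "?q = 1"
        then have eq: "z ^ l = z ^ j" using z0 by (simp add: power_inverse field_simps)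
        then show False using primitive_root_power_inj[OF z l j] False by simp
      qed
      moreover have "?q ^ m = (z ^ m) ^ l * inverse ((z ^ m) ^ j)"
        by (simp add: power_mult_distrib power_inverse mult.commute flip: power_mult)
      ultimately have "(\<Sum>k<m. ?q ^ k) = 0" using m(2) by (intro sum_powers_root_of_unity) auto
      then show ?thesis using False by simp
    qed
    finally show ?thesis .
  qed
  have "(\<Sum>k<m. rc (z ^ (k * l)) * dft m z y k) = (\<Sum>k<m. \<Sum>j<m. rc (z ^ (k * l) * inverse z ^ (k * j)) * y j)"
    by (simp only: dft_def sum_distrib_left rc_mult mult.assoc)
  also have "\<dots> = (\<Sum>j<m. \<Sum>k<m. rc (z ^ (k * l) * inverse z ^ (k * j)) * y j)" by (rule sum.swap)
  also have "\<dots> = (\<Sum>j<m. rc (if j = l then of_nat m else 0) * y j)"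
  proof (intro sum.cong refl)
    fix j assume "j \<in> {..<m}"
    then have "(\<Sum>k<m. z ^ (k * l) * inverse z ^ (k * j)) = (if j = l then of_nat m else 0)"
      by (intro orth) simp
    then show "(\<Sum>k<m. rc (z ^ (k * l) * inverse z ^ (k * j)) * y j) = rc (if j = l then of_nat m else 0) * y j"
      by (simp only: flip: sum_distrib_right rc_sum)
  qed
  also have "\<dots> = (\<Sum>j<m. if j = l then of_nat m * y j else 0)"
    by (intro sum.cong) (auto simp: rc_0 rc_of_nat)
  finally show ?thesis using l by simp
qed

lemma dft_in_adjoin:
  assumes z: "primitive_root_of_unity m z" "of_nat m \<noteq> (0 :: 'k)" and F: "is_subfield F" "K \<subseteq> F"
    and "\<And>k. k < m \<Longrightarrow> dft m z y k \<in> F" "l < m"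
  shows "y l \<in> F"
proof -
  have rcF: "rc c \<in> F" for c using F(2) by blast
  have "of_nat m * y l \<in> F"
    unfolding dft_inverse[OF z(1) assms(6), symmetric]
    using assms(5) rcF by (intro subfield_sum subfield_mult F(1)) auto
  then have "of_nat m * y l / of_nat m \<in> F" by (intro subfield_divide subfield_of_nat F(1))
  moreover have "(of_nat m :: 'l) \<noteq> 0" using z(2) rc_eq_0_iff[of "of_nat m"] by (simp only: rc_of_nat not_False_eq_True)
  ultimately show ?thesis by simp
qed

text \<open>Reindexing by one multiplies the weights by \<open>z ^ k\<close>, and
  \<open>y m = y 0\<close> closes the cycle. The constant \<open>c\<close> admits a shift that is
  cyclic only up to a scalar.\<close>

lemma dft_eigenvector:
  assumes z: "primitive_root_of_unity m z" and g: "g \<in> carrier G"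
    and act: "\<And>j. j < m \<Longrightarrow> act g (y j) = rc c * y (Suc j)" and per: "y m = y 0"
  shows "act g (dft m z y k) = rc (c * z ^ k) * dft m z y k"
proof -
  have m: "0 < m" "z ^ m = 1" using z by (auto simp: primitive_root_of_unity_def)
  have z0: "z \<noteq> 0" using m by (metis power_0_left zero_neq_one less_numeral_extra(3))
  let ?f = "\<lambda>j. rc (inverse z ^ (k * j)) * y j"
  have "inverse z ^ (k * m) = inverse ((z ^ m) ^ k)" by (simp add: power_inverse mult.commute flip: power_mult)
  then have "?f m = ?f 0" using m(2) per by simp
  then have shift: "(\<Sum>j<m. ?f (Suc j)) = dft m z y k"
    using sum.lessThan_Suc_shift[of ?f m] unfolding dft_def by (simp add: rc_1)
  have "act g (dft m z y k) = (\<Sum>j<m. rc (inverse z ^ (k * j)) * (rc c * y (Suc j)))"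
    unfolding dft_def act_sum[OF g] using g act by (intro sum.cong) (auto simp: act_mult act_rc)
  also have "\<dots> = (\<Sum>j<m. rc (c * z ^ k) * ?f (Suc j))"
  proof (intro sum.cong refl)
    fix j
    have "z ^ k * inverse z ^ (k * Suc j) = inverse z ^ (k * j)"
      using z0 by (simp add: power_add power_inverse)
    then have "rc (c * z ^ k) * rc (inverse z ^ (k * Suc j)) = rc c * rc (inverse z ^ (k * j))"
      by (simp only: mult.assoc flip: rc_mult)
    then show "rc (inverse z ^ (k * j)) * (rc c * y (Suc j)) = rc (c * z ^ k) * ?f (Suc j)"
      unfolding mult.assoc[symmetric] by (simp add: mult_ac)
  qed
  also have "\<dots> = rc (c * z ^ k) * dft m z y k" by (simp only: shift flip: sum_distrib_left)
  finally show ?thesis .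
qed

end

text \<open>Multiplication by X on exponents models \<open>a\<close> on monomials up to the scalar
  \<open>c\<close>. Since \<open>c\<close> is invariant under X, applying \<open>a\<close>
  \<open>p\<close> times multiplies \<open>mon v\<close> by \<open>c v ^ p\<close>; so the exponents
  have period \<open>p\<close> although \<open>a\<close> itself may have larger order.\<close>

locale monomial_action = group_field_action G act rc L0 + cyclic_module scale p
  for G (structure) and act :: "'a \<Rightarrow> 'l::field \<Rightarrow> 'l" and rc :: "'k::field \<Rightarrow> 'l" and L0
    and scale :: "int poly \<Rightarrow> 'v::ab_group_add \<Rightarrow> 'v" (infixr \<open>*s\<close> 75) and p +
  fixes a :: 'a and mon :: "'v \<Rightarrow> 'l" and c :: "'v \<Rightarrow> 'k" and \<zeta> :: 'k
  assumes a: "a \<in> carrier G"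
    and mon_add: "mon (v + w) = mon v * mon w" and mon_nz: "mon v \<noteq> 0"
    and c_add: "c (v + w) = c v * c w" and c_nz: "c v \<noteq> 0" and c_shift: "c ([:0, 1:] *s v) = c v"
    and act_mon: "act a (mon v) = rc (c v) * mon ([:0, 1:] *s v)"
    and \<zeta>: "primitive_root_of_unity p \<zeta>" and p_nz: "of_nat p \<noteq> (0 :: 'k)"
begin

lemma mon_0: "mon 0 = 1"
  using mon_add[of 0 0] mon_nz[of 0] by simp

lemma c_0: "c 0 = 1"
  using c_add[of 0 0] c_nz[of 0] by simp

lemma mon_diff: "mon (v - w) = mon v / mon w"
  using mon_add[of "v - w" w] mon_nz[of w] by (simp add: field_simps)

lemma mon_const: "is_subfield F \<Longrightarrow> mon v \<in> F \<Longrightarrow> mon ([:k:] *s v) \<in> F"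
proof (induction k rule: int_induct[where k = 0])
  case base
  then show ?case by (simp add: mon_0 subfield_1)
next
  case (step1 i)
  have "[:i + 1:] = [:i:] + 1" by (simp add: one_pCons)
  then have "[:i + 1:] *s v = [:i:] *s v + v" by (simp only: scale_left_distrib scale_one)
  then show ?case using step1 by (simp add: mon_add subfield_mult)
next
  case (step2 i)
  have "[:i - 1:] = [:i:] - 1" by (simp add: one_pCons)
  then have "[:i - 1:] *s v = [:i:] *s v - v" by (simp only: scale_left_diff_distrib scale_one)
  then show ?case using step2 by (simp add: mon_diff subfield_divide)
qed

definition shift :: "nat \<Rightarrow> 'v \<Rightarrow> 'v" where
  "shift j v = Polynomial.monom 1 j *s v"

lemma shift_0: "shift 0 v = v" and shift_p: "shift p v = v"
  and shift_Suc: "shift (Suc j) v = [:0, 1:] *s shift j v"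
  and shift_add: "shift (i + j) v = shift i (shift j v)"
  using period by (simp_all add: shift_def monom_0 monom_Suc mult_monom flip: one_pCons)

lemma shift_mod: "shift j v = shift (j mod p) v"
proof -
  have "shift (p * k) v = v" for k by (induction k) (simp_all add: shift_0 shift_add shift_p)
  then show ?thesis using shift_add[of "j mod p" "p * (j div p)" v] by simp
qed

lemma c_shift': "c (shift j v) = c v"
  by (induction j) (simp_all add: shift_0 shift_Suc c_shift)

lemma act_mon_shift: "act a (mon (shift j v)) = rc (c v) * mon (shift (Suc j) v)"
  by (simp add: act_mon c_shift' shift_Suc)

lemma mon_span:
  assumes F: "is_subfield F" and U: "\<And>u j. u \<in> U \<Longrightarrow> mon (shift j u) \<in> F" and v: "v \<in> span U"
  shows "mon v \<in> F"
proof -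
  let ?D = "{v. \<forall>j. mon (shift j v) \<in> F}"
  have add: "v + w \<in> ?D" if "v \<in> ?D" "w \<in> ?D" for v w
    using that by (auto simp: shift_def scale_right_distrib mon_add intro: subfield_mult[OF F])
  have zero: "0 \<in> ?D" by (simp add: shift_def mon_0 subfield_1[OF F])
  have X: "[:0, 1:] *s v \<in> ?D" if "v \<in> ?D" for v
  proof -
    have "shift j ([:0, 1:] *s v) = shift (Suc j) v" for j by (simp add: shift_def monom_Suc)
    with that show ?thesis by simp
  qed
  have const: "[:k:] *s v \<in> ?D" if "v \<in> ?D" for k v
  proof -
    have "shift j ([:k:] *s v) = [:k:] *s shift j v" for j by (simp add: shift_def mult.commute)
    then show ?thesis using that mon_const[OF F] by simp
  qed
  have scale: "P *s v \<in> ?D" if "v \<in> ?D" for P v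
  proof (induction P)
    case 0
    then show ?case using zero by simp
  next
    case (pCons k P)
    have "pCons k P = [:k:] + [:0, 1:] * P" by simp
    then have "pCons k P *s v = [:k:] *s v + [:0, 1:] *s P *s v"
      by (simp only: scale_left_distrib scale_scale)
    then show ?case using add[OF const[OF that] X[OF pCons.IH]] by (simp only:)
  qed
  have "subspace ?D" by (rule subspaceI) (use zero add scale in blast)+
  moreover have "U \<subseteq> ?D" using U by blast
  ultimately have "v \<in> ?D" using v span_minimal by blast
  then have "mon (shift 0 v) \<in> F" by blast
  then show ?thesis by (simp only: shift_0)
qed

text \<open>The two inclusions make \<open>S\<close> and the orbit of \<open>mon u\<close> generate
  the same field over \<open>K\<close>. The bound \<open>m\<close> will be the weight of
  \<open>u\<close> in \<open>lattice_rank\<close>.\<close>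

definition diagonalizable :: "nat \<Rightarrow> 'v \<Rightarrow> bool" where
  "diagonalizable m u \<longleftrightarrow> (\<exists>S. finite S \<and> card S \<le> m \<and> S \<subseteq> adjoin K (range (\<lambda>j. mon (shift j u)))
     \<and> (\<forall>s\<in>S. \<exists>d. act a s = rc d * s) \<and> (\<forall>j. mon (shift j u) \<in> adjoin K S))"

lemma diagonalizable_fixed:
  assumes "T_poly *s f = 0"
  shows "diagonalizable 1 f"
proof -
  have "[:0, 1:] = T_poly + 1" by (simp add: one_pCons)
  then have "[:0, 1:] *s f = T_poly *s f + f" by (simp only: scale_left_distrib scale_one)
  then have X: "[:0, 1:] *s f = f" using assms by simp
  then have "shift j f = f" for j by (induction j) (simp_all add: shift_0 shift_Suc)
  then show ?thesis
    unfolding diagonalizable_def using act_mon[of f] X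
    by (intro exI[of _ "{mon f}"]) (auto intro: hull_inc)
qed

text \<open>Up to the scalar \<open>c e\<close> the orbit is permuted cyclically, so its Fourier
  components are eigenvectors, and they recover it because \<open>p\<close> is invertible.\<close>

lemma diagonalizable_free: "diagonalizable p e"
proof -
  let ?y = "\<lambda>j. mon (shift j e)"
  let ?S = "dft p \<zeta> ?y ` {..<p}"
  have F: "is_subfield (adjoin K S)" for S by (rule is_subfield_hull)
  have "card ?S \<le> p" using card_image_le[of "{..<p}" "dft p \<zeta> ?y"] by simp
  moreover have "?S \<subseteq> adjoin K (range ?y)"
  proof (rule image_subsetI)
    fix k show "dft p \<zeta> ?y k \<in> adjoin K (range ?y)"
      unfolding dft_def
      by (intro subfield_sum[OF F] subfield_mult[OF F]) (auto intro: adjoin_base adjoin_gen)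
  qed
  moreover have "\<exists>d. act a s = rc d * s" if "s \<in> ?S" for s
    using that dft_eigenvector[OF \<zeta> a, of ?y "c e"] act_mon_shift shift_p shift_0 by auto
  moreover have "mon (shift j e) \<in> adjoin K ?S" for j
  proof -
    have "mon (shift (j mod p) e) \<in> adjoin K ?S"
    proof (rule dft_in_adjoin[OF \<zeta> p_nz F, of ?S])
      show "K \<subseteq> adjoin K ?S" by (auto intro: adjoin_base)
      show "dft p \<zeta> ?y k \<in> adjoin K ?S" if "k < p" for k using that by (intro adjoin_gen) auto
      show "j mod p < p" using p(1) prime_gt_0_nat by simp
    qed
    then show ?thesis using shift_mod by simp
  qed
  ultimately show ?thesis unfolding diagonalizable_def by (intro exI[of _ ?S]) auto
qed

text \<open>With \<open>w\<^sub>l\<close> the partial products of the orbit of \<open>g\<close>, the elements \<open>t\<^sub>l = w\<^sub>l / \<Sum> w\<close> are permuted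
  cyclically and have sum \<open>1\<close>. The denominator is nonzero after twisting the orbit by a suitable
  \<open>p\<close>-th root of unity.\<close>

lemma diagonalizable_norm_0:
  assumes g: "N_poly p *s g = 0"
  shows "diagonalizable (p - 1) g"
proof -
  have p0: "0 < p" using p(1) prime_gt_0_nat by blast
  have F: "is_subfield (adjoin K S)" for S by (rule is_subfield_hull)
  have rcF: "rc d \<in> adjoin K S" for d S by (intro adjoin_base) auto
  define u where "u l = mon (N_poly l *s g)" for l
  have N_Suc: "N_poly (Suc l) *s g = N_poly l *s g + shift l g" for l
    by (simp add: N_poly_def scale_left_distrib shift_def)
  have u0: "u 0 = 1" by (simp add: u_def N_poly_def mon_0)
  have u1: "u 1 = mon g" by (simp add: u_def N_poly_def monom_0 flip: one_pCons)
  have up: "u p = 1" by (simp add: u_def g mon_0)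
  have unz: "u l \<noteq> 0" for l by (simp add: u_def mon_nz)
  have u_Suc: "u (Suc l) = u l * mon (shift l g)" for l unfolding u_def N_Suc mon_add ..
  define c0 where "c0 = c g"
  have cN: "c (N_poly l *s g) = c0 ^ l" for l
    by (induction l) (simp_all add: N_Suc c_add c_shift' c0_def, simp add: N_poly_def c_0)
  have c0: "c0 ^ p = 1" "c0 \<noteq> 0" using cN[of p] g c_0 c_nz by (auto simp: c0_def)
  have X_N: "[:0, 1:] *s N_poly l *s g = N_poly (Suc l) *s g - g" for l
  proof (induction l)
    case 0
    then show ?case by (simp add: N_poly_def monom_0 flip: one_pCons)
  next
    case (Suc l)
    have "[:0, 1:] *s N_poly (Suc l) *s g = [:0, 1:] *s N_poly l *s g + [:0, 1:] *s shift l g"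
      unfolding N_Suc by (rule scale_right_distrib)
    then show ?case unfolding Suc.IH N_Suc[of "Suc l"] by (simp add: shift_Suc)
  qed
  have act_u: "act a (u l) = rc (c0 ^ l) * (u (Suc l) / u 1)" for l
    unfolding u_def act_mon cN X_N mon_diff using u1 by (simp add: u_def)
  \<comment> \<open>The triangular numbers accumulate the scalars \<open>c0 ^ l\<close> in the
    action on \<open>u l\<close>, so that the factor \<open>c0 ^ t l\<close> absorbs them.\<close>
  define t where "t l = (\<Sum>i<l. i)" for l :: nat
  have t: "t 0 = 0" "t (Suc l) = t l + l" for l by (simp_all add: t_def)
  \<comment> \<open>\<open>t p\<close> is p (p - 1) / 2, a multiple of \<open>p\<close> since
    \<open>p\<close> is odd; this closes the cycle with \<open>w d p = 1\<close>.\<close>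
  have ctp: "c0 ^ t p = 1"
  proof -
    have t2: "2 * t (Suc l) = Suc l * l" for l by (induction l) (simp_all add: t)
    obtain q where q: "p = Suc (2 * q)" using p(2) by (metis oddE Suc_eq_plus1)
    have "2 * t p = 2 * (p * q)" unfolding q t2 by simp
    then have "t p = p * q" by simp
    then show ?thesis using c0 by (simp add: power_mult)
  qed
  define w where "w d l = rc (c0 ^ t l * d ^ l) * u l" for d l
  have w0: "w d 0 = 1" for d by (simp add: w_def t u0 rc_1)
  have wp: "w d p = 1" if "d ^ p = 1" for d using that by (simp add: w_def ctp up rc_1)
  have wnz: "w d l \<noteq> 0" if "d \<noteq> 0" for d l using that c0 unz by (simp add: w_def rc_eq_0_iff)
  have act_w: "act a (w d l) = w d (Suc l) / w d 1" if "d \<noteq> 0" for d l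
  proof -
    have "act a (w d l) = rc (c0 ^ t l * d ^ l) * (rc (c0 ^ l) * (u (Suc l) / u 1))"
      unfolding w_def act_mult[OF a] act_rc[OF a] act_u ..
    moreover have "w d (Suc l) = rc (c0 ^ t l * d ^ l) * rc (c0 ^ l) * rc d * u (Suc l)"
      unfolding w_def by (simp only: t power_add power_Suc mult_ac flip: rc_mult)
    moreover have "w d 1 = rc d * u 1" by (simp add: w_def t)
    moreover have "rc d \<noteq> 0" using that rc_eq_0_iff by simp
    ultimately show ?thesis by simp
  qed
  have \<zeta>1: "\<zeta> ^ p = 1" using \<zeta> by (simp add: primitive_root_of_unity_def)
  \<comment> \<open>If the sum vanished for every twist, all Fourier components of the untwisted
    sequence would vanish, and inversion at index 0 would give \<open>p = 0\<close> in the
    field.\<close>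
  have "\<exists>k<p. (\<Sum>l<p. w (\<zeta> ^ k) l) \<noteq> 0"
  proof (rule ccontr)
    assume *: "\<not> ?thesis"
    let ?y = "\<lambda>l. rc (c0 ^ t l) * u l"
    have dft0: "dft p (inverse \<zeta>) ?y k = 0" if "k < p" for k
    proof -
      have "dft p (inverse \<zeta>) ?y k = (\<Sum>l<p. w (\<zeta> ^ k) l)"
        by (simp add: dft_def w_def rc_mult mult_ac flip: power_mult)
      then show ?thesis using * that by simp
    qed
    have "primitive_root_of_unity p (inverse \<zeta>)"
      using \<zeta> by (auto simp: primitive_root_of_unity_def power_inverse)
    from dft_inverse[OF this p0, of ?y] have "of_nat p * ?y 0 = 0" using dft0 by simp
    then have "(of_nat p :: 'l) = 0" by (simp add: t u0 rc_1)
    then show False using p_nz rc_eq_0_iff[of "of_nat p"] by (simp add: rc_of_nat)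
  qed
  then obtain k where k: "(\<Sum>l<p. w (\<zeta> ^ k) l) \<noteq> 0" by blast
  define d where "d = \<zeta> ^ k"
  have d: "d ^ p = 1" "d \<noteq> 0"
  proof -
    have "d ^ p = (\<zeta> ^ p) ^ k" by (simp add: d_def mult.commute flip: power_mult)
    then show "d ^ p = 1" using \<zeta>1 by simp
    then show "d \<noteq> 0" using p0 by (metis power_0_left zero_neq_one less_numeral_extra(3))
  qed
  define Q where "Q = (\<Sum>l<p. w d l)"
  have Q0: "Q \<noteq> 0" using k by (simp add: Q_def d_def)
  have act_Q: "act a Q = Q / w d 1"
  proof -
    have "(\<Sum>l<p. w d (Suc l)) = Q"
      using sum.lessThan_Suc_shift[of "w d" p] w0 wp[OF d(1)] by (simp add: Q_def)
    then show ?thesis unfolding Q_def act_sum[OF a] act_w[OF d(2)] by (simp flip: sum_divide_distrib)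
  qed
  define \<tau> where "\<tau> l = w d l / Q" for l
  have act_\<tau>: "act a (\<tau> l) = rc 1 * \<tau> (Suc l)" for l
    unfolding \<tau>_def act_divide[OF a] act_Q act_w[OF d(2)] using wnz[OF d(2)] Q0 by (simp add: rc_1)
  have \<tau>p: "\<tau> p = \<tau> 0" by (simp add: \<tau>_def w0 wp[OF d(1)])
  \<comment> \<open>Index 0 is omitted: that component is the sum of the \<open>\<tau> l\<close>,
    which is 1. This saves one generator, in accordance with the weight
    \<open>p - 1\<close>.\<close>
  let ?S = "dft p \<zeta> \<tau> ` {1..<p}"
  have s0: "dft p \<zeta> \<tau> 0 = 1"
    using Q0 by (simp add: dft_def rc_1 \<tau>_def Q_def flip: sum_divide_distrib)
  have "card ?S \<le> p - 1" using card_image_le[of "{1..<p}" "dft p \<zeta> \<tau>"] by simp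
  moreover have "?S \<subseteq> adjoin K (range (\<lambda>j. mon (shift j g)))"
  proof (rule image_subsetI)
    let ?F = "adjoin K (range (\<lambda>j. mon (shift j g)))"
    have "u l \<in> ?F" for l
      by (induction l) (auto simp: u0 u_Suc intro!: subfield_1[OF F] subfield_mult[OF F] intro: hull_inc)
    then have "w d l \<in> ?F" for l unfolding w_def by (intro subfield_mult[OF F] rcF)
    then have "\<tau> l \<in> ?F" for l unfolding \<tau>_def Q_def by (intro subfield_divide[OF F] subfield_sum[OF F])
    then show "dft p \<zeta> \<tau> k \<in> ?F" for k unfolding dft_def by (intro subfield_sum[OF F] subfield_mult[OF F] rcF)
  qed
  moreover have "\<exists>d. act a s = rc d * s" if "s \<in> ?S" for s
    using that dft_eigenvector[OF \<zeta> a, of \<tau> 1] act_\<tau> \<tau>p by auto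
  moreover have "mon (shift j g) \<in> adjoin K ?S" for j
  proof -
    have "dft p \<zeta> \<tau> k \<in> adjoin K ?S" if "k < p" for k
    proof (cases "k = 0")
      case True
      then show ?thesis using s0 subfield_1[OF F] by simp
    next
      case False
      then show ?thesis using that by (intro adjoin_gen) auto
    qed
    moreover have "K \<subseteq> adjoin K ?S" by (auto intro: adjoin_base)
    ultimately have \<tau>: "\<tau> l \<in> adjoin K ?S" if "l < p" for l
      using dft_in_adjoin[OF \<zeta> p_nz F] that by blast
    \<comment> \<open>Ratios of the \<open>\<tau> l\<close> eliminate the denominator
      \<open>Q\<close>, because \<open>w d 0 = 1\<close>.\<close>
    have "w d l \<in> adjoin K ?S" if "l < p" for l
    proof -
      have "w d l = \<tau> l / \<tau> 0" using Q0 by (simp add: \<tau>_def w0)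
      then show ?thesis using subfield_divide[OF F \<tau>[OF that] \<tau>[OF p0]] by simp
    qed
    then have "w d l / rc (c0 ^ t l * d ^ l) \<in> adjoin K ?S" if "l < p" for l
      using that subfield_divide[OF F _ rcF] by blast
    moreover have "w d l / rc (c0 ^ t l * d ^ l) = u l" for l
      using d c0 by (simp add: w_def rc_eq_0_iff)
    ultimately have u: "u l \<in> adjoin K ?S" if "l \<le> p" for l
      using that up subfield_1[OF F] by (cases "l = p") auto
    have "mon (shift l g) \<in> adjoin K ?S" if "l < p" for l
    proof -
      have "mon (shift l g) = u (Suc l) / u l" using u_Suc unz by simp
      then show ?thesis using subfield_divide[OF F u u] that by simp
    qed
    then show ?thesis using shift_mod[of j] p0 by simp
  qed
  ultimately show ?thesis unfolding diagonalizable_def by (intro exI[of _ ?S]) auto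
qed

lemma diagonalizable_list:
  assumes "\<And>u. u \<in> set us \<Longrightarrow> diagonalizable m u"
  shows "\<exists>S. finite S \<and> card S \<le> m * length us \<and> S \<subseteq> adjoin K (mon ` span (set us))
    \<and> (\<forall>s\<in>S. \<exists>d. act a s = rc d * s) \<and> (\<forall>u\<in>set us. \<forall>j. mon (shift j u) \<in> adjoin K S)"
proof -
  have "\<forall>u\<in>set us. \<exists>S. finite S \<and> card S \<le> m \<and> S \<subseteq> adjoin K (range (\<lambda>j. mon (shift j u)))
     \<and> (\<forall>s\<in>S. \<exists>d. act a s = rc d * s) \<and> (\<forall>j. mon (shift j u) \<in> adjoin K S)"
    using assms unfolding diagonalizable_def by blast
  then obtain S where S: "\<And>u. u \<in> set us \<Longrightarrow> finite (S u) \<and> card (S u) \<le> m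
     \<and> S u \<subseteq> adjoin K (range (\<lambda>j. mon (shift j u)))
     \<and> (\<forall>s\<in>S u. \<exists>d. act a s = rc d * s) \<and> (\<forall>j. mon (shift j u) \<in> adjoin K (S u))" by metis
  let ?S = "\<Union>u\<in>set us. S u"
  have "card ?S \<le> (\<Sum>u\<in>set us. card (S u))" by (rule card_UN_le) simp
  also have "\<dots> \<le> of_nat (card (set us)) * m" using S by (intro sum_bounded_above) auto
  also have "\<dots> \<le> m * length us" using card_length[of us] by simp
  finally have "card ?S \<le> m * length us" .
  moreover have "?S \<subseteq> adjoin K (mon ` span (set us))"
  proof
    fix s assume "s \<in> ?S"
    then obtain u where u: "u \<in> set us" "s \<in> S u" by blast
    have "range (\<lambda>j. mon (shift j u)) \<subseteq> mon ` span (set us)"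
      using u(1) by (auto simp: shift_def intro!: imageI span_scale intro: span_base)
    then have "adjoin K (range (\<lambda>j. mon (shift j u))) \<subseteq> adjoin K (mon ` span (set us))"
      by (intro adjoin_mono) auto
    then show "s \<in> adjoin K (mon ` span (set us))" using S[OF u(1)] u(2) by blast
  qed
  moreover have "mon (shift j u) \<in> adjoin K ?S" if "u \<in> set us" for u j
  proof -
    have "adjoin K (S u) \<subseteq> adjoin K ?S" using that by (intro adjoin_mono) auto
    then show ?thesis using S[OF that] by blast
  qed
  ultimately show ?thesis using S by (intro exI[of _ ?S]) blast
qed

lemma eigenvector_generators:
  assumes "good_generators fs gs"
  shows "\<exists>S. finite S \<and> card S \<le> lattice_rank fs es gs \<and> (\<forall>s\<in>S. \<exists>d. act a s = rc d * s)
    \<and> adjoin K S = adjoin K (mon ` span (set fs \<union> set es \<union> set gs))"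
proof -
  let ?U = "set fs \<union> set es \<union> set gs"
  let ?Q = "\<lambda>m us S. finite S \<and> card S \<le> m * length us \<and> S \<subseteq> adjoin K (mon ` span (set us))
    \<and> (\<forall>s\<in>S. \<exists>d. act a s = rc d * s) \<and> (\<forall>u\<in>set us. \<forall>j. mon (shift j u) \<in> adjoin K S)"
  obtain S1 where 1: "?Q 1 fs S1"
    using diagonalizable_list[of fs 1] diagonalizable_fixed assms unfolding good_generators_def by blast
  obtain S2 where 2: "?Q p es S2" using diagonalizable_list[of es p] diagonalizable_free by blast
  obtain S3 where 3: "?Q (p - 1) gs S3"
    using diagonalizable_list[of gs "p - 1"] diagonalizable_norm_0 assms unfolding good_generators_def by blast
  let ?S = "S1 \<union> S2 \<union> S3"
  have F: "is_subfield (adjoin K S)" for S by (rule is_subfield_hull)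
  have "card ?S \<le> lattice_rank fs es gs"
    using card_Un_le[of "S1 \<union> S2" S3] card_Un_le[of S1 S2] 1 2 3 unfolding lattice_rank_def by linarith
  moreover have "adjoin K ?S = adjoin K (mon ` span ?U)"
  proof (rule antisym)
    have mono: "adjoin K (mon ` span A) \<subseteq> adjoin K (mon ` span ?U)" if "A \<subseteq> ?U" for A
      using span_mono[OF that] by (intro adjoin_mono image_mono) auto
    have "?S \<subseteq> adjoin K (mon ` span ?U)"
      using 1 2 3 mono[of "set fs"] mono[of "set es"] mono[of "set gs"] by blast
    then show "adjoin K ?S \<subseteq> adjoin K (mon ` span ?U)"
      by (subst adjoin_subset_iff[OF F]) (auto intro: adjoin_base)
    have monoS: "adjoin K S1 \<subseteq> adjoin K ?S" "adjoin K S2 \<subseteq> adjoin K ?S" "adjoin K S3 \<subseteq> adjoin K ?S"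
      by (intro adjoin_mono; blast)+
    have "mon (shift j u) \<in> adjoin K ?S" if "u \<in> ?U" for u j
      using that 1 2 3 monoS by blast
    then have "mon ` span ?U \<subseteq> adjoin K ?S" using mon_span[OF F] by blast
    then show "adjoin K (mon ` span ?U) \<subseteq> adjoin K ?S"
      by (subst adjoin_subset_iff[OF F]) (auto intro: adjoin_base)
  qed
  ultimately show ?thesis using 1 2 3 by (intro exI[of _ ?S]) blast
qed

end

section \<open>Lattices of exponents\<close>

definition fun_scale :: "int \<Rightarrow> ('i \<Rightarrow> int) \<Rightarrow> 'i \<Rightarrow> int" where
  "fun_scale k w = (\<lambda>i. k * w i)"

definition unit_fun :: "'i \<Rightarrow> 'i \<Rightarrow> int" where
  "unit_fun i j = (if j = i then 1 else 0)"

definition supported_on :: "'i set \<Rightarrow> ('i \<Rightarrow> int) set" where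
  "supported_on I = {w. \<forall>i. i \<notin> I \<longrightarrow> w i = 0}"

definition exponent_group :: "('i \<Rightarrow> int) set \<Rightarrow> bool" where
  "exponent_group M \<longleftrightarrow> (\<lambda>_. 0) \<in> M \<and> (\<forall>v\<in>M. \<forall>w\<in>M. (\<lambda>i. v i + w i) \<in> M)
     \<and> (\<forall>k. \<forall>w\<in>M. fun_scale k w \<in> M)"

lemma unit_fun_supported: "i \<in> I \<Longrightarrow> unit_fun i \<in> supported_on I"
  by (auto simp: supported_on_def unit_fun_def)

abbreviation perm_scale :: "('i \<Rightarrow> 'i) \<Rightarrow> int poly \<Rightarrow> ('i \<Rightarrow> int) \<Rightarrow> 'i \<Rightarrow> int" where
  "perm_scale \<tau> \<equiv> poly_act fun_scale (\<lambda>w i. w (\<tau> i))"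

locale perm_lattice =
  fixes \<tau> :: "'i \<Rightarrow> 'i" and p :: nat
  assumes prime: "prime p" "odd p" and \<tau>: "\<tau> ^^ p = id"
begin

sublocale ex: module_endo fun_scale "\<lambda>w i. w (\<tau> i)"
  by standard (simp_all add: fun_scale_def fun_eq_iff algebra_simps)

lemma poly_act_funpow: "((\<lambda>w i. w (\<tau> i)) ^^ n) w = (\<lambda>i. w ((\<tau> ^^ n) i) :: int)"
  by (induction n arbitrary: w) (simp_all add: funpow_swap1)

sublocale cyclic_module "perm_scale \<tau>" p
proof (intro cyclic_module.intro cyclic_module_axioms.intro ex.module_poly_act prime)
  show "perm_scale \<tau> (Polynomial.monom 1 p) v = v" for v
    by (simp add: ex.poly_act_monom poly_act_funpow \<tau>)
qed

lemma X_act: "perm_scale \<tau> [:0, 1:] w = (\<lambda>i. w (\<tau> i))"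
  unfolding ex.poly_act_pCons[of 0] ex.poly_act_const by (simp add: fun_scale_def fun_eq_iff)

lemma poly_act_subspaceI:
  assumes "(\<lambda>_. 0) \<in> M" "\<And>v w. v \<in> M \<Longrightarrow> w \<in> M \<Longrightarrow> (\<lambda>i. v i + w i) \<in> M"
    "\<And>k w. w \<in> M \<Longrightarrow> fun_scale k w \<in> M" "\<And>w. w \<in> M \<Longrightarrow> (\<lambda>i. w (\<tau> i)) \<in> M"
  shows "subspace M"
proof (rule subspaceI)
  show "0 \<in> M" using assms(1) by (simp add: zero_fun_def)
  show "v + w \<in> M" if "v \<in> M" "w \<in> M" for v w using assms(2)[OF that] by (simp add: plus_fun_def)
  show "perm_scale \<tau> P w \<in> M" if "w \<in> M" for P w
  proof (induction P)
    case 0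
    show ?case unfolding ex.poly_act_0 by fact
  next
    case (pCons k P)
    show ?case unfolding ex.poly_act_pCons
      using assms(2)[OF assms(3)[OF that, of k] assms(4)[OF pCons.IH]] by (simp add: plus_fun_def)
  qed
qed

lemma sum_fun_apply: "(sum f A) j = (\<Sum>i\<in>A. f i j)" for f :: "'b \<Rightarrow> 'i \<Rightarrow> int"
  by (induction A rule: infinite_finite_induct) simp_all

lemma unit_fun_expansion:
  assumes I: "finite I" and w: "w \<in> supported_on I"
  shows "w = (\<Sum>i\<in>I. perm_scale \<tau> [:w i:] (unit_fun i))"
proof
  fix j
  have "(\<Sum>i\<in>I. perm_scale \<tau> [:w i:] (unit_fun i)) j = (\<Sum>i\<in>I. if i = j then w i else 0)"
    unfolding sum_fun_apply ex.poly_act_const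
    by (intro sum.cong) (auto simp: fun_scale_def unit_fun_def)
  then show "w j = (\<Sum>i\<in>I. perm_scale \<tau> [:w i:] (unit_fun i)) j"
    using I w by (auto simp: supported_on_def)
qed

lemma span_supported_on:
  assumes I: "finite I" "\<And>i. \<tau> i \<in> I \<Longrightarrow> i \<in> I"
    and U: "U \<subseteq> supported_on I" "\<And>i. i \<in> I \<Longrightarrow> unit_fun i \<in> span U"
  shows "supported_on I = span U"
proof (intro equalityI subsetI)
  fix w :: "'i \<Rightarrow> int" assume "w \<in> supported_on I"
  then show "w \<in> span U"
    by (subst unit_fun_expansion[OF I(1)]) (use U(2) in \<open>auto intro!: span_sum span_scale\<close>)
next
  have "subspace (supported_on I)"
    by (rule poly_act_subspaceI) (use I(2) in \<open>auto simp: supported_on_def fun_scale_def\<close>)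
  then show "w \<in> supported_on I" if "w \<in> span U" for w
    using span_minimal[OF U(1)] that by blast
qed

text \<open>The induction starts from the full lattice; residue vectors modulo \<open>p ^ r\<close>
  are the finitely many representatives that it counts.\<close>

lemma finite_index_generators:
  assumes "finite I" and gens: "good_generators fs []" "supported_on I = span (set fs \<union> set es)"
    and M': "subspace M'" "M' \<subseteq> supported_on I"
    and exponent: "\<And>w. w \<in> supported_on I \<Longrightarrow> fun_scale (int p ^ r) w \<in> M'"
  obtains fs' es' gs' where "good_generators fs' gs'" "M' = span (set fs' \<union> set es' \<union> set gs')"
    "lattice_rank fs' es' gs' = length fs + p * length es"
proof -
  let ?q = "int p ^ r"
  have q: "0 < ?q" using prime(1) prime_gt_0_nat by simp
  define R where "R = {w :: 'i \<Rightarrow> int. \<forall>i. (i \<in> I \<longrightarrow> w i \<in> {0..<?q}) \<and> (i \<notin> I \<longrightarrow> w i = 0)}"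
  have "finite R" unfolding R_def by (rule finite_set_of_finite_funs) (use assms(1) in auto)
  have R: "\<exists>t\<in>R. v - t \<in> M'" if v: "v \<in> supported_on I" for v
  proof
    let ?t = "\<lambda>i. v i mod ?q"
    show "?t \<in> R" using v q by (auto simp: R_def supported_on_def)
    have "v - ?t = fun_scale ?q (\<lambda>i. v i div ?q)"
      by (simp add: fun_scale_def fun_eq_iff minus_mod_eq_mult_div)
    moreover have "(\<lambda>i. v i div ?q) \<in> supported_on I" using v by (auto simp: supported_on_def)
    ultimately show "v - ?t \<in> M'" using exponent by simp
  qed
  have exp: "perm_scale \<tau> (of_nat p ^ r) v \<in> M'" if v: "v \<in> supported_on I" for v
  proof -
    have "(of_nat p ^ r :: int poly) = [:?q:]" by (simp add: of_nat_poly flip: poly_const_pow)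
    then show ?thesis using exponent[OF v] by (simp add: ex.poly_act_const)
  qed
  have "\<exists>fs' es' gs'. good_generators fs' gs' \<and> M' = span (set fs' \<union> set es' \<union> set gs')
    \<and> lattice_rank fs' es' gs' = lattice_rank fs es []"
    by (rule submodule_generators[OF gens(1) _ M'(1,2) \<open>finite R\<close> R exp]) (use gens(2) in auto)
  then show ?thesis using that by (auto simp: lattice_rank_def)
qed

end

text \<open>With \<open>\<tau>\<close> the identity, X - 1 annihilates everything, and the same
  induction bounds the number of generators. Generation is phrased through all exponent groups
  \<open>D\<close>, to be applied to the exponents of the monomials lying in a given field.\<close>

lemma sublattice_generators:
  fixes M :: "('i \<Rightarrow> int) set"
  assumes p: "prime p" "odd p" and I: "finite I" and M: "M \<subseteq> supported_on I" "exponent_group M"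
    and exponent: "\<And>w. w \<in> supported_on I \<Longrightarrow> fun_scale (int p ^ r) w \<in> M"
  shows "\<exists>U. finite U \<and> card U \<le> card I \<and> U \<subseteq> M \<and> (\<forall>D. exponent_group D \<longrightarrow> U \<subseteq> D \<longrightarrow> M \<subseteq> D)"
proof -
  define \<tau> where "\<tau> = (id :: 'i \<Rightarrow> 'i)"
  interpret perm_lattice \<tau> p by standard (use p in \<open>auto simp: \<tau>_def\<close>)
  obtain ss where ss: "set ss = I" "distinct ss" using finite_distinct_list[OF I] by blast
  let ?fs = "map unit_fun ss"
  have X: "perm_scale \<tau> [:0, 1:] w = w" for w :: "'i \<Rightarrow> int" unfolding X_act by (simp add: \<tau>_def)
  have T0: "perm_scale \<tau> T_poly w = 0" for w :: "'i \<Rightarrow> int"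
  proof -
    have "T_poly = [:0, 1:] - 1" by (simp add: one_pCons)
    then show ?thesis using scale_left_diff_distrib[of "[:0, 1:]" 1 w] X by simp
  qed
  have sub: "subspace D" if "exponent_group D" for D
    by (rule poly_act_subspaceI) (use that in \<open>simp_all add: exponent_group_def \<tau>_def\<close>)
  have supp: "supported_on I = span (set ?fs \<union> set [])"
  proof (rule span_supported_on[OF I])
    show "set ?fs \<union> set [] \<subseteq> supported_on I"
      unfolding set_map ss(1) using unit_fun_supported by fastforce
    show "unit_fun i \<in> span (set ?fs \<union> set [])" if "i \<in> I" for i
      using that unfolding set_map ss(1) by (intro span_base UnI1 imageI)
  qed (simp only: \<tau>_def id_apply)
  have gg: "good_generators ?fs []" using T0 by (simp add: good_generators_def)
  obtain fs es gs where "good_generators fs gs" and gens: "M = span (set fs \<union> set es \<union> set gs)"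
    "lattice_rank fs es gs = length ?fs + p * length ([] :: ('i \<Rightarrow> int) list)"
    by (rule finite_index_generators[OF I gg supp sub[OF M(2)] M(1) exponent])
  let ?U = "set fs \<union> set es \<union> set gs"
  have "card ?U \<le> length fs + length es + length gs"
    using card_Un_le[of "set fs \<union> set es" "set gs"] card_Un_le[of "set fs" "set es"]
      card_length[of fs] card_length[of es] card_length[of gs] by linarith
  \<comment> \<open>Every generator has weight at least one in \<open>lattice_rank\<close>, as
    \<open>p\<close> is at least 2.\<close>
  also have "\<dots> \<le> length fs + p * length es + (p - 1) * length gs"
  proof -
    have "1 \<le> p" "1 \<le> p - 1" using prime_ge_2_nat[OF p(1)] by linarith+
    from mult_le_mono1[OF this(1), of "length es"] mult_le_mono1[OF this(2), of "length gs"]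
    show ?thesis unfolding nat_mult_1 by linarith
  qed
  also have "\<dots> = length ss" using gens(2) by (simp add: lattice_rank_def)
  also have "\<dots> = card I" using ss distinct_card by metis
  finally have card: "card ?U \<le> card I" .
  have "M \<subseteq> D" if "exponent_group D" "?U \<subseteq> D" for D
    unfolding gens(1) by (rule span_minimal[OF that(2) sub[OF that(1)]])
  then show ?thesis
    using card span_superset[of ?U] unfolding gens(1) by (intro exI[of _ ?U] conjI) blast+
qed

section \<open>Invariant Laurent monomials\<close>

context group_field_action
begin

lemma act_pow:
  assumes h: "h \<in> carrier G" and v: "v \<in> L0" "act h v = rc d * v"
  shows "act (h [^] (n::nat)) v = rc (d ^ n) * v"
proof (induction n)
  case (Suc n)
  have "act (h [^] Suc n) v = act (h [^] n) (act h v)" using act_act[of "h [^] n" h v] h v(1) by simp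
  also have "\<dots> = rc d * act (h [^] n) v" using h by (simp add: v(2) act_mult act_rc)
  finally show ?case by (simp add: Suc rc_mult mult_ac)
qed (use v act_one in \<open>simp add: rc_1\<close>)

definition fixed_exponents :: "'i set \<Rightarrow> ('i \<Rightarrow> 'l) \<Rightarrow> 'a set \<Rightarrow> ('i \<Rightarrow> int) set" where
  "fixed_exponents I X S = {w \<in> supported_on I. \<forall>h\<in>S. act h (monom_int I X w) = monom_int I X w}"

lemma fixed_exponents_supported: "fixed_exponents I X S \<subseteq> supported_on I"
  by (auto simp: fixed_exponents_def)

context
  fixes I :: "'i set" and X :: "'i \<Rightarrow> 'l"
  assumes I: "finite I" and X_L0: "\<And>i. i \<in> I \<Longrightarrow> X i \<in> L0" and X_nz: "\<And>i. i \<in> I \<Longrightarrow> X i \<noteq> 0"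
begin

lemma monom_int_add: "monom_int I X (v + w) = monom_int I X v * monom_int I X w"
  unfolding monom_int_def prod.distrib[symmetric] using X_nz by (intro prod.cong) (simp_all add: power_int_add)

lemma monom_int_nz: "monom_int I X v \<noteq> 0"
  using I X_nz by (simp add: monom_int_def)

lemma monom_int_L0: "monom_int I X v \<in> L0"
  unfolding monom_int_def using X_L0 by (intro subfield_prod subfield_power_int L0)

lemma monom_int_0: "monom_int I X 0 = 1"
  by (simp add: monom_int_def)

lemma monom_int_scale: "monom_int I X (fun_scale k v) = monom_int I X v powi k"
  unfolding monom_int_def fun_scale_def
  by (simp add: power_int_mult mult.commute[of k]) (induction I rule: infinite_finite_induct; simp add: power_int_mult_distrib)

lemma monom_int_unit: "i \<in> I \<Longrightarrow> monom_int I X (unit_fun i) = X i"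
proof -
  assume i: "i \<in> I"
  have "monom_int I X (unit_fun i) = (\<Prod>j\<in>I. if j = i then X j else 1)"
    unfolding monom_int_def unit_fun_def by (intro prod.cong) auto
  then show ?thesis using i I by simp
qed

lemma monom_int_eigen:
  assumes h: "h \<in> carrier G" and eigen: "\<And>i. i \<in> I \<Longrightarrow> \<exists>d. act h (X i) = rc d * X i"
  shows "\<exists>d. act h (monom_int I X v) = rc d * monom_int I X v"
proof -
  obtain d where d: "\<And>i. i \<in> I \<Longrightarrow> act h (X i) = rc (d i) * X i" using eigen by metis
  have "act h (monom_int I X v) = (\<Prod>i\<in>I. rc (d i powi v i) * X i powi v i)"
    unfolding monom_int_def act_prod[OF h] using d
    by (intro prod.cong) (simp_all add: act_power_int[OF h] power_int_mult_distrib rc_power_int)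
  also have "\<dots> = (\<Prod>i\<in>I. rc (d i powi v i)) * monom_int I X v" by (simp add: prod.distrib monom_int_def)
  also have "(\<Prod>i\<in>I. rc (d i powi v i)) = rc (\<Prod>i\<in>I. d i powi v i)"
    by (induction I rule: infinite_finite_induct) (simp_all add: rc_1 rc_mult)
  finally show ?thesis by blast
qed

lemma fixed_exponents_closed:
  assumes "S \<subseteq> carrier G"
  shows "exponent_group (fixed_exponents I X S)"
proof -
  have S: "h \<in> carrier G" if "h \<in> S" for h using that assms by blast
  have "(\<lambda>_. 0) \<in> fixed_exponents I X S"
    using monom_int_0 S by (auto simp: fixed_exponents_def supported_on_def zero_fun_def act_1)
  moreover have "(\<lambda>i. v i + w i) \<in> fixed_exponents I X S" if "v \<in> fixed_exponents I X S" "w \<in> fixed_exponents I X S" for v w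
    using monom_int_add[of v w] S that
    by (auto simp: fixed_exponents_def supported_on_def plus_fun_def act_mult)
  moreover have "fun_scale k w \<in> fixed_exponents I X S" if "w \<in> fixed_exponents I X S" for k w
    using S that by (auto simp: fixed_exponents_def monom_int_scale act_power_int) (simp add: supported_on_def fun_scale_def)
  ultimately show ?thesis by (simp add: exponent_group_def)
qed

lemma exponent_group_monom_int:
  assumes F: "is_subfield F"
  shows "exponent_group {w. monom_int I X w \<in> F}"
  using subfield_1[OF F] subfield_mult[OF F] subfield_power_int[OF F] monom_int_add
  by (auto simp: exponent_group_def monom_int_scale plus_fun_def) (simp add: monom_int_def)

text \<open>The eigenvalues of \<open>h\<close> are \<open>q\<close>-th roots of unity. Hence the
  invariant exponents have finite index, with a quotient of exponent dividing
  \<open>q\<close>.\<close>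

lemma fixed_exponents_power:
  assumes "S \<subseteq> carrier G" and eigen: "\<And>h i. h \<in> S \<Longrightarrow> i \<in> I \<Longrightarrow> \<exists>d. act h (X i) = rc d * X i"
    and exponent: "\<And>h. h \<in> S \<Longrightarrow> h [^] (q::nat) = \<one>" and w: "w \<in> supported_on I"
  shows "fun_scale (int q) w \<in> fixed_exponents I X S"
proof -
  have "act h (monom_int I X (fun_scale (int q) w)) = monom_int I X (fun_scale (int q) w)" if hS: "h \<in> S" for h
  proof -
    have h: "h \<in> carrier G" using hS assms(1) by blast
    obtain d where d: "act h (monom_int I X w) = rc d * monom_int I X w"
      using monom_int_eigen[OF h eigen[OF hS]] by blast
    have "rc (d ^ q) * monom_int I X w = monom_int I X w"
      using act_pow[OF h monom_int_L0 d, of q] exponent[OF hS] act_one[OF monom_int_L0] by simp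
    then have "rc d ^ q = 1" using monom_int_nz by (simp add: rc_power)
    then show ?thesis by (simp add: monom_int_scale act_power[OF h] d power_mult_distrib)
  qed
  then show ?thesis using w by (auto simp: fixed_exponents_def supported_on_def fun_scale_def)
qed

lemma fixed_eq_adjoin_monomials:
  assumes H: "subgroup H G" "of_nat (card H) \<noteq> (0 :: 'k)"
    and eigen: "\<And>h i. h \<in> H \<Longrightarrow> i \<in> I \<Longrightarrow> \<exists>d. act h (X i) = rc d * X i"
    and sub: "fixed H \<subseteq> adjoin K (X ` I)"
  shows "fixed H = adjoin K (monom_int I X ` fixed_exponents I X H)"
proof (rule antisym)
  interpret H: subgroup H G by fact
  let ?A = "monom_int I X ` supported_on I"
  have A1: "1 \<in> ?A" using monom_int_0 by (intro image_eqI[of _ _ 0]) (auto simp: supported_on_def)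
  have Amult: "a * b \<in> ?A" if ab: "a \<in> ?A" "b \<in> ?A" for a b
  proof -
    obtain v w where "a = monom_int I X v" "b = monom_int I X w" "v \<in> supported_on I" "w \<in> supported_on I"
      using ab by blast
    then show ?thesis by (intro image_eqI[of _ _ "v + w"]) (auto simp: monom_int_add supported_on_def)
  qed
  have XA: "X ` I \<subseteq> ?A"
  proof (rule image_subsetI)
    fix i assume "i \<in> I"
    then show "X i \<in> ?A" using monom_int_unit
      by (intro image_eqI[of _ _ "unit_fun i"]) (auto simp: supported_on_def unit_fun_def)
  qed
  show "fixed H \<subseteq> adjoin K (monom_int I X ` fixed_exponents I X H)"
  proof
    fix x assume x: "x \<in> fixed H"
    have "adjoin K (X ` I) \<subseteq> adjoin K ?A" using XA by (intro adjoin_mono) auto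
    then have xA: "x \<in> adjoin K ?A" using sub x by blast
    have "x \<in> adjoin K {a \<in> ?A. \<forall>h\<in>H. act h a = a}"
    proof (rule fixed_eigenvectors[OF H _ A1 Amult _ xA])
      show "?A \<subseteq> L0" using monom_int_L0 by blast
      show "\<exists>d. act h a = rc d * a" if "a \<in> ?A" "h \<in> H" for a h
        using that monom_int_eigen[OF H.mem_carrier[OF that(2)] eigen[OF that(2)]] by blast
      show "act h x = x" if "h \<in> H" for h using x that by (simp add: fixed_def)
    qed
    also have "{a \<in> ?A. \<forall>h\<in>H. act h a = a} = monom_int I X ` fixed_exponents I X H"
      by (auto simp: fixed_exponents_def)
    finally show "x \<in> adjoin K (monom_int I X ` fixed_exponents I X H)" .
  qed
  have "monom_int I X ` fixed_exponents I X H \<subseteq> fixed H"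
    using monom_int_L0 by (auto simp: fixed_exponents_def fixed_def)
  then show "adjoin K (monom_int I X ` fixed_exponents I X H) \<subseteq> fixed H"
    using K_fixed[OF H.subset] by (simp add: adjoin_subset_iff[OF subfield_fixed[OF H.subset]])
qed

end

lemma diagonal_generators:
  fixes p r :: nat
  assumes S: "finite S" "S \<subseteq> L0" and eigen: "\<And>g s. g \<in> carrier G \<Longrightarrow> s \<in> S \<Longrightarrow> \<exists>d. act g s = rc d * s"
    and p: "prime p" "odd p" "of_nat (card (carrier G)) \<noteq> (0 :: 'k)"
    and exponent: "\<And>g. g \<in> carrier G \<Longrightarrow> g [^] (p ^ r) = \<one>"
    and sub: "fixed (carrier G) \<subseteq> adjoin K S"
  shows "\<exists>B. finite B \<and> card B \<le> card S \<and> fixed (carrier G) = adjoin K B"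
proof -
  \<comment> \<open>The elements index themselves; zero is left out of the index set because
    negative exponents occur.\<close>
  define X where "X = (\<lambda>s :: 'l. s)"
  let ?I = "S - {0}"
  have I: "finite ?I" and XL: "\<And>i. i \<in> ?I \<Longrightarrow> X i \<in> L0" and Xnz: "\<And>i. i \<in> ?I \<Longrightarrow> X i \<noteq> 0"
    using S by (auto simp: X_def)
  have eigen': "\<exists>d. act g (X i) = rc d * X i" if "g \<in> carrier G" "i \<in> ?I" for g i
    using eigen that unfolding X_def by blast
  have F: "is_subfield (adjoin K S)" for S by (rule is_subfield_hull)
  have "adjoin K S \<subseteq> adjoin K (X ` ?I)"
    by (subst adjoin_subset_iff[OF F])
      (use subfield_0[OF F] in \<open>auto simp: X_def intro: hull_inc\<close>)
  then have fixed: "fixed (carrier G) = adjoin K (monom_int ?I X ` fixed_exponents ?I X (carrier G))"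
    using sub by (intro fixed_eq_adjoin_monomials[OF I XL Xnz subgroup_self p(3) eigen']) auto
  let ?M = "fixed_exponents ?I X (carrier G)"
  note closed = fixed_exponents_closed[OF I XL Xnz subset_refl]
  have exp: "fun_scale (int p ^ r) w \<in> ?M" if "w \<in> supported_on ?I" for w
    using fixed_exponents_power[OF I XL Xnz subset_refl eigen' exponent that] by simp
  obtain U where U: "finite U" "card U \<le> card ?I" "U \<subseteq> ?M"
    "\<And>D. exponent_group D \<Longrightarrow> U \<subseteq> D \<Longrightarrow> ?M \<subseteq> D"
    using sublattice_generators[OF p(1,2) I fixed_exponents_supported closed exp] by blast
  let ?B = "monom_int ?I X ` U"
  have "U \<subseteq> {w. monom_int ?I X w \<in> adjoin K ?B}" by (auto intro: hull_inc)
  \<comment> \<open>The exponents whose monomials lie in the candidate field serve as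
    \<open>D\<close>, so generators of the lattice become generators of the field.\<close>
  moreover have "exponent_group {w. monom_int ?I X w \<in> adjoin K ?B}"
    by (rule exponent_group_monom_int[OF I]) (use XL Xnz F in auto)
  ultimately have "?M \<subseteq> {w. monom_int ?I X w \<in> adjoin K ?B}" using U(4) by blast
  then have "monom_int ?I X ` ?M \<subseteq> adjoin K ?B" by blast
  then have "fixed (carrier G) \<subseteq> adjoin K ?B"
    unfolding fixed by (subst adjoin_subset_iff[OF F]) (auto intro: hull_inc)
  moreover have "adjoin K ?B \<subseteq> fixed (carrier G)"
    unfolding fixed using U(3) by (intro adjoin_mono image_mono) auto
  moreover have "card ?B \<le> card S"
  proof -
    have "card ?B \<le> card U" using U(1) by (rule card_image_le)
    also have "\<dots> \<le> card S" using U(2) card_mono[of S ?I] S(1) by auto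
    finally show ?thesis .
  qed
  ultimately show ?thesis using U(1) by (intro exI[of _ ?B]) auto
qed

end

section \<open>Groups with an abelian normal subgroup of prime index\<close>

locale index_p_action = noether_action G act rc L0 x for G (structure) and act :: "'a \<Rightarrow> 'l::field \<Rightarrow> 'l"
    and rc :: "'k::field \<Rightarrow> 'l" and L0 and x +
  fixes H :: "'a set" and a :: 'a and p n e :: nat
  assumes p: "prime p" "odd p" and H: "H \<lhd> G" "\<And>g h. g \<in> H \<Longrightarrow> h \<in> H \<Longrightarrow> g \<otimes> h = h \<otimes> g"
    and a: "a \<in> carrier G" "a [^] p \<in> H"
    and coset: "\<And>g. g \<in> carrier G \<Longrightarrow> \<exists>m<p. \<exists>h\<in>H. g = a [^] m \<otimes> h"
    and order: "Coset.order G = p ^ n" "Coset.order G = p * card H"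
    and exponent: "0 < e" "\<And>g. g \<in> carrier G \<Longrightarrow> g [^] (p ^ e) = \<one>"
begin

lemma subgroup_H: "subgroup H G"
  using H(1) by (simp add: normal_imp_subgroup)

lemma H_carrier: "h \<in> H \<Longrightarrow> h \<in> carrier G"
  using subgroup.mem_carrier[OF subgroup_H] .

lemma finite_H: "finite H"
  using finite_subset[OF subgroup.subset[OF subgroup_H] finite_G] .

lemma p_pos: "0 < p"
  using p(1) prime_gt_0_nat by blast

lemma act_vs_span:
  assumes g: "g \<in> carrier G" and "\<And>s. s \<in> S \<Longrightarrow> act g s \<in> vs.span T" "v \<in> vs.span S"
  shows "act g v \<in> vs.span T"
  using assms(3)
proof (induction rule: vs.span_induct_alt)
  case base
  show ?case by (simp add: act_0[OF g] vs.span_zero)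
next
  case (step c s u)
  have "act g (rc c * s + u) = rc c * act g s + act g u"
    by (simp add: act_add[OF g] act_mult[OF g] act_rc[OF g])
  then show ?case using vs.span_add[OF vs.span_scale[OF assms(2)[OF step(1)]] step.IH] by (simp only:)
qed

lemma subspace_subfield:
  assumes "is_subfield F" "K \<subseteq> F"
  shows "vs.subspace F"
proof (rule vs.subspaceI)
  show "rc c * v \<in> F" if "v \<in> F" for c v
    using assms(2) that by (intro subfield_mult[OF assms(1)]) auto
qed (use subfield_0[OF assms(1)] subfield_add[OF assms(1)] in simp_all)

lemma span_L0: "S \<subseteq> L0 \<Longrightarrow> v \<in> vs.span S \<Longrightarrow> v \<in> L0"
  using vs.span_minimal[OF _ subspace_subfield[OF L0]] rc_L0 by blast

text \<open>A copy of the regular representation of \<open>H\<close>; its translates under the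
  powers of \<open>a\<close> contain all variables.\<close>

definition "V0 = vs.span (x ` H)"

lemma V0_L0: "v \<in> V0 \<Longrightarrow> v \<in> L0"
  unfolding V0_def by (rule span_L0) (use x_L0 H_carrier in auto)

lemma act_V0: "h \<in> H \<Longrightarrow> v \<in> V0 \<Longrightarrow> act h v \<in> V0"
  unfolding V0_def
proof (rule act_vs_span)
  fix s assume "h \<in> H" "s \<in> x ` H"
  then obtain k where "k \<in> H" "s = x k" by blast
  then have "act h s = x (h \<otimes> k)" using act_x H_carrier \<open>h \<in> H\<close> by simp
  moreover have "h \<otimes> k \<in> H" using subgroup.m_closed[OF subgroup_H] \<open>h \<in> H\<close> \<open>k \<in> H\<close> by blast
  ultimately show "act h s \<in> vs.span (x ` H)" by (auto intro: vs.span_base)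
qed (auto intro: H_carrier)

end

section \<open>Eigenvectors of the abelian subgroup and rationality with roots of unity\<close>

locale index_p_action_roots = index_p_action G act rc L0 x H a p n e for G (structure)
    and act :: "'a \<Rightarrow> 'l::field \<Rightarrow> 'l" and rc :: "'k::field \<Rightarrow> 'l" and L0 x H a p n e +
  fixes \<omega> :: 'k
  assumes \<omega>: "primitive_root_of_unity (p ^ e) \<omega>" and p_nz: "of_nat p \<noteq> (0 :: 'k)"
begin

definition eigenvectors :: "'a set \<Rightarrow> 'l set" where
  "eigenvectors S = {v \<in> V0. \<forall>h\<in>S. \<exists>d. act h v = rc d * v}"

text \<open>Fourier analysis along the powers of \<open>h\<close>: the components are eigenvectors
  of \<open>h\<close>, their sum is \<open>p ^ e\<close> times \<open>v\<close>, and commutativity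
  of \<open>H\<close> preserves the eigenvalues for \<open>S\<close>.\<close>

lemma eigenvector_split:
  assumes h: "h \<in> H" "S \<subseteq> H" and v: "v \<in> eigenvectors S"
  shows "v \<in> vs.span (eigenvectors (insert h S))"
proof -
  let ?q = "p ^ e" and ?y = "\<lambda>j :: nat. act (h [^] j) v"
  have hc: "h \<in> carrier G" using h(1) by (rule H_carrier)
  have hj: "h [^] j \<in> H" for j :: nat
    by (induction j) (use h(1) subgroup.one_closed[OF subgroup_H] subgroup.m_closed[OF subgroup_H] in auto)
  have vV: "v \<in> V0" and vL: "v \<in> L0" using v V0_L0 by (auto simp: eigenvectors_def)
  have y_V0: "?y j \<in> V0" for j using act_V0[OF hj vV] .
  have step: "act h (?y j) = rc 1 * ?y (Suc j)" for j
    using act_act[of h "h [^] j" v] hc vL nat_pow_Suc2[OF hc, of j] by (simp add: rc_1)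
  have per: "?y ?q = ?y 0" using exponent(2)[OF hc] by simp
  have "dft ?q \<omega> ?y k \<in> eigenvectors (insert h S)" for k
    unfolding eigenvectors_def
  proof (intro CollectI conjI ballI)
    show "dft ?q \<omega> ?y k \<in> V0"
      unfolding dft_def using y_V0 unfolding V0_def by (intro vs.span_sum vs.span_scale)
    fix g assume "g \<in> insert h S"
    then show "\<exists>d. act g (dft ?q \<omega> ?y k) = rc d * dft ?q \<omega> ?y k"
    proof
      assume "g = h"
      then show ?thesis using dft_eigenvector[OF \<omega> hc step per] by blast
    next
      assume gS: "g \<in> S"
      then have gH: "g \<in> H" and gc: "g \<in> carrier G" using h(2) H_carrier by auto
      obtain d where d: "act g v = rc d * v" using v gS by (auto simp: eigenvectors_def)
      have "act g (?y j) = rc d * ?y j" for j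
      proof -
        have "act g (?y j) = act (h [^] j) (act g v)"
          using act_act[OF gc H_carrier[OF hj] vL] act_act[OF H_carrier[OF hj] gc vL] H(2)[OF gH hj] by simp
        then show ?thesis by (simp add: d act_mult[OF H_carrier[OF hj]] act_rc[OF H_carrier[OF hj]])
      qed
      then have "act g (dft ?q \<omega> ?y k) = rc d * dft ?q \<omega> ?y k"
        by (simp add: dft_def act_sum[OF gc] act_mult[OF gc] act_rc[OF gc] sum_distrib_left mult_ac)
      then show ?thesis by blast
    qed
  qed
  then have "(\<Sum>k<?q. rc (\<omega> ^ (k * 0)) * dft ?q \<omega> ?y k) \<in> vs.span (eigenvectors (insert h S))"
    by (intro vs.span_sum vs.span_scale vs.span_base)
  moreover have "(\<Sum>k<?q. rc (\<omega> ^ (k * 0)) * dft ?q \<omega> ?y k) = of_nat ?q * ?y 0"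
    using p_pos by (intro dft_inverse[OF \<omega>]) simp
  moreover have "?y 0 = v" using act_one[OF vL] by simp
  ultimately have "rc (of_nat ?q) * v \<in> vs.span (eigenvectors (insert h S))" by (simp only: rc_of_nat)
  then have "rc (inverse (of_nat ?q)) * (rc (of_nat ?q) * v) \<in> vs.span (eigenvectors (insert h S))"
    by (rule vs.span_scale)
  moreover have "rc (inverse (of_nat ?q)) * (rc (of_nat ?q) * v) = v"
    using p_nz by (simp add: rc_1 flip: mult.assoc rc_mult)
  ultimately show ?thesis by (simp only:)
qed

lemma V0_eigenvectors:
  assumes "finite S" "S \<subseteq> H"
  shows "V0 \<subseteq> vs.span (eigenvectors S)"
  using assms
proof (induction S rule: finite_induct)
  case empty
  show ?case using vs.span_superset by (auto simp: eigenvectors_def)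
next
  case (insert h S)
  have "eigenvectors S \<subseteq> vs.span (eigenvectors (insert h S))"
    using eigenvector_split insert.prems by blast
  then have "vs.span (eigenvectors S) \<subseteq> vs.span (eigenvectors (insert h S))"
    by (rule vs.span_minimal) (rule vs.subspace_span)
  then show ?case using insert by blast
qed

lemma eigenbasis:
  obtains J where "finite J" "card J \<le> card H" "0 \<notin> J" "J \<subseteq> eigenvectors H" "V0 \<subseteq> vs.span J"
proof -
  obtain J where J: "J \<subseteq> eigenvectors H" "vs.independent J" "eigenvectors H \<subseteq> vs.span J"
    using vs.maximal_independent_subset by blast
  have "J \<subseteq> vs.span (x ` H)" using J(1) by (auto simp: eigenvectors_def V0_def)
  then have "finite J \<and> card J \<le> card (x ` H)"
    using vs.independent_span_bound[of "x ` H" J] finite_H J(2) by simp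
  moreover have "card (x ` H) \<le> card H" using finite_H by (rule card_image_le)
  moreover have "0 \<notin> J" using J(2) vs.dependent_zero by blast
  moreover have "V0 \<subseteq> vs.span J"
    using V0_eigenvectors[OF finite_H subset_refl] vs.span_minimal[OF J(3) vs.subspace_span] by blast
  ultimately show ?thesis using that[of J] J(1) by linarith
qed

text \<open>The \<open>p\<close>-th power of \<open>a\<close> has order at most \<open>p\<^sup>e\<^sup>-\<^sup>1\<close>, so its eigenvalues are \<open>p\<close>-th powers. Rescaling
  by the roots turns the orbit of an eigenvector into one that \<open>a\<close> permutes cyclically up to a constant factor.\<close>

lemma eigenvalue_root:
  assumes v: "v \<in> eigenvectors H" "v \<noteq> 0"
  shows "\<exists>c. c \<noteq> 0 \<and> act (a [^] p) v = rc (c ^ p) * v"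
proof -
  have vL: "v \<in> L0" using v(1) V0_L0 by (auto simp: eigenvectors_def)
  have ap: "a [^] p \<in> carrier G" using a(1) by simp
  obtain d where d: "act (a [^] p) v = rc d * v" using v(1) a(2) by (auto simp: eigenvectors_def)
  have pe: "p ^ e = p * p ^ (e - 1)" using exponent(1) by (cases e) auto
  have "(a [^] p) [^] (p ^ (e - 1)) = \<one>"
    using exponent(2)[OF a(1)] a(1) by (simp add: nat_pow_pow pe)
  then have "rc (d ^ (p ^ (e - 1))) * v = v" using act_pow[OF ap vL d, of "p ^ (e - 1)"] act_one[OF vL] by simp
  then have "rc (d ^ (p ^ (e - 1))) = rc 1" using v(2) by (simp add: rc_1)
  then have d1: "d ^ (p ^ (e - 1)) = 1" using rc_eq_0_iff[of "d ^ (p ^ (e - 1)) - 1"] by (simp add: rc_diff)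
  then have "d ^ (p ^ e) = 1" unfolding pe by (metis mult.commute power_mult power_one)
  then obtain t where t: "d = \<omega> ^ t" by (rule root_of_unity_is_power[OF \<omega>])
  have "\<omega> ^ (t * p ^ (e - 1)) = 1" using d1 by (simp add: t power_mult)
  then have "p * p ^ (e - 1) dvd t * p ^ (e - 1)" using primitive_root_power_eq_1[OF \<omega>] pe by simp
  then have "p dvd t" using p_pos by simp
  then obtain s where s: "t = p * s" by blast
  have "\<omega> \<noteq> 0" using \<omega> p_pos by (metis power_0_left primitive_root_of_unity_def zero_neq_one less_numeral_extra(3))
  moreover have "d = (\<omega> ^ s) ^ p" by (simp add: t s mult.commute flip: power_mult)
  ultimately show ?thesis using d by (intro exI[of _ "\<omega> ^ s"]) simp
qed

lemma \<zeta>: "primitive_root_of_unity p (\<omega> ^ (p ^ (e - 1)))"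
proof -
  have pe: "p ^ e = p * p ^ (e - 1)" using exponent(1) by (cases e) auto
  have "(\<omega> ^ (p ^ (e - 1))) ^ p = 1"
    using \<omega> by (simp add: primitive_root_of_unity_def pe mult.commute flip: power_mult)
  moreover have "(\<omega> ^ (p ^ (e - 1))) ^ l \<noteq> 1" if "0 < l" "l < p" for l
  proof
    assume "(\<omega> ^ (p ^ (e - 1))) ^ l = 1"
    then have "p ^ e dvd p ^ (e - 1) * l" using primitive_root_power_eq_1[OF \<omega>] by (simp flip: power_mult)
    then have "p dvd l" using p_pos by (simp add: pe mult.commute)
    then show False using that by (auto dest: dvd_imp_le)
  qed
  ultimately show ?thesis using p_pos by (simp add: primitive_root_of_unity_def)
qed

text \<open>Every \<open>g\<close> is a power of \<open>a\<close> times an element of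
  \<open>H\<close>, and \<open>H\<close> fixes \<open>S\<close> pointwise. So all of
  \<open>G\<close> acts diagonally and only invariant monomials in \<open>S\<close> remain to be
  generated.\<close>

lemma rational_if_diagonal:
  assumes S: "finite S" "card S \<le> Coset.order G" "\<And>s. s \<in> S \<Longrightarrow> \<exists>d. act a s = rc d * s"
    and SH: "fixed H = adjoin K S"
  shows "rational_over K (fixed (carrier G))"
proof -
  have S_fixed: "s \<in> fixed H" if "s \<in> S" for s
    unfolding SH using that by (rule adjoin_gen)
  have S_L0: "S \<subseteq> L0" using S_fixed by (auto simp: fixed_def)
  have eigen: "\<exists>d. act g s = rc d * s" if g: "g \<in> carrier G" and s: "s \<in> S" for g s
  proof -
    obtain m h where mh: "m < p" "h \<in> H" "g = a [^] m \<otimes> h" using coset[OF g] by blast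
    obtain d where d: "act a s = rc d * s" using S(3)[OF s] by blast
    have sL: "s \<in> L0" using S_L0 s by blast
    have "act g s = act (a [^] m) (act h s)"
      unfolding mh(3) using act_act[of "a [^] m" h s] a(1) H_carrier[OF mh(2)] sL by simp
    also have "act h s = s" using S_fixed[OF s] mh(2) by (simp add: fixed_def)
    also have "act (a [^] m) s = rc (d ^ m) * s" by (rule act_pow[OF a(1) sL d])
    finally show ?thesis by blast
  qed
  have "of_nat (card (carrier G)) \<noteq> (0 :: 'k)"
    using order(1) p_nz by (simp add: Coset.order_def)
  moreover have "fixed (carrier G) \<subseteq> adjoin K S"
    unfolding SH[symmetric] using H_carrier by (auto simp: fixed_def)
  ultimately obtain B where "finite B" "card B \<le> card S" "fixed (carrier G) = adjoin K B"
    using diagonal_generators[OF S(1) S_L0 eigen p _ exponent(2)] by blast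
  then show ?thesis using rational_if_few_generators[of B] S(2) by simp
qed

text \<open>The count: the monomials come from the rescaled translates, at most
  \<open>p * card H\<close> in number, and neither passing to the invariant sublattice nor
  diagonalizing raises this bound.\<close>

theorem rational_roots: "rational_over K (fixed (carrier G))"
proof -
  obtain J where J: "finite J" "card J \<le> card H" "0 \<notin> J" "J \<subseteq> eigenvectors H" "V0 \<subseteq> vs.span J"
    by (rule eigenbasis)
  have Jnz: "v \<noteq> 0" and JL: "v \<in> L0" if "v \<in> J" for v
    using that J(3,4) V0_L0 by (auto simp: eigenvectors_def)
  have "\<forall>v\<in>J. \<exists>c. c \<noteq> 0 \<and> act (a [^] p) v = rc (c ^ p) * v"
    using eigenvalue_root J(3,4) by blast
  then obtain c where c: "\<And>v. v \<in> J \<Longrightarrow> c v \<noteq> 0" "\<And>v. v \<in> J \<Longrightarrow> act (a [^] p) v = rc (c v ^ p) * v"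
    by metis
  have am: "a [^] m \<in> carrier G" for m :: nat using a(1) by simp
  \<comment> \<open>\<open>c v\<close> is a p-th root of the eigenvalue of \<open>a [^] p\<close>,
    so the rescaled orbit closes up after \<open>p\<close> steps, each with the same factor
    \<open>c v\<close>.\<close>
  define Y where "Y v m = rc (inverse (c v) ^ m) * act (a [^] m) v" for v and m :: nat
  have Y0: "Y v 0 = v" if "v \<in> J" for v using act_one[OF JL[OF that]] by (simp add: Y_def rc_1)
  have Yp: "Y v p = v" if v: "v \<in> J" for v
  proof -
    have "inverse (c v) ^ p * c v ^ p = 1" using c(1)[OF v] by (simp add: power_inverse)
    then show ?thesis unfolding Y_def c(2)[OF v] by (simp add: rc_1 flip: mult.assoc rc_mult)
  qed
  have act_Y: "act a (Y v m) = rc (c v) * Y v (Suc m)" if v: "v \<in> J" for v m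
  proof -
    have "act a (act (a [^] m) v) = act (a [^] Suc m) v"
      using act_act[OF a(1) am JL[OF v]] nat_pow_Suc2[OF a(1), of m] by simp
    moreover have "inverse (c v) ^ m = c v * inverse (c v) ^ Suc m" using c(1)[OF v] by simp
    then have "rc (inverse (c v) ^ m) = rc (c v) * rc (inverse (c v) ^ Suc m)" by (simp only: flip: rc_mult)
    ultimately show ?thesis unfolding Y_def act_mult[OF a(1)] act_rc[OF a(1)] by (simp only: mult.assoc)
  qed
  have Y_L0: "Y v m \<in> L0" if "v \<in> J" for v m
    unfolding Y_def using rc_L0 act_closed[OF am JL[OF that]] by (intro subfield_mult[OF L0])
  have Y_nz: "Y v m \<noteq> 0" if "v \<in> J" for v m
    unfolding Y_def using c(1)[OF that] Jnz[OF that] act_eq_0_iff[OF am] by (simp add: rc_eq_0_iff)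
  have Y_eigen: "\<exists>d. act h (Y v m) = rc d * Y v m" if v: "v \<in> J" and h: "h \<in> H" for v m h
  proof -
    have hc: "h \<in> carrier G" using H_carrier[OF h] .
    let ?k = "inv (a [^] m) \<otimes> h \<otimes> a [^] m"
    have k: "?k \<in> H" using normal.inv_op_closed1[OF H(1) am h] .
    then obtain d where d: "act ?k v = rc d * v" using v J(4) unfolding eigenvectors_def by blast
    have "h \<otimes> a [^] m = a [^] m \<otimes> ?k" using hc am by (simp flip: m_assoc)
    then have "act h (act (a [^] m) v) = act (a [^] m) (act ?k v)"
      using act_act[OF hc am JL[OF v]] act_act[OF am H_carrier[OF k] JL[OF v]] by simp
    then have "act h (Y v m) = rc d * Y v m"
      unfolding Y_def d by (simp add: act_mult[OF hc] act_rc[OF hc] act_mult[OF am] act_rc[OF am] mult_ac)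
    then show ?thesis by blast
  qed
  define I where "I = J \<times> {..<p}"
  define X where "X = (\<lambda>(v, m). Y v m)"
  have I: "finite I" unfolding I_def using J(1) by simp
  have XL: "X i \<in> L0" and Xnz: "X i \<noteq> 0" if "i \<in> I" for i
    using that Y_L0 Y_nz by (auto simp: I_def X_def)
  have eigen: "\<exists>d. act h (X i) = rc d * X i" if "h \<in> H" "i \<in> I" for h i
    using that Y_eigen by (auto simp: I_def X_def)
  have F: "is_subfield (adjoin K S)" for S by (rule is_subfield_hull)
  \<comment> \<open>A variable \<open>x g\<close> is a translate of some \<open>x h\<close> in
    \<open>V0\<close>, and \<open>x h\<close> is a combination of \<open>J\<close>.\<close>
  have L0_sub: "L0 \<subseteq> adjoin K (X ` I)"
  proof -
    have "x g \<in> adjoin K (X ` I)" if g: "g \<in> carrier G" for g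
    proof -
      obtain m h where mh: "m < p" "h \<in> H" "g = a [^] m \<otimes> h" using coset[OF g] by blast
      have "x h \<in> vs.span J" using J(5) mh(2) vs.span_base unfolding V0_def by blast
      then have "act (a [^] m) (x h) \<in> vs.span ((\<lambda>v. Y v m) ` J)"
      proof (rule act_vs_span[OF am, rotated])
        fix v assume v: "v \<in> J"
        have "act (a [^] m) v = rc (c v ^ m) * Y v m"
          unfolding Y_def using c(1)[OF v] by (simp add: rc_1 power_inverse flip: mult.assoc rc_mult)
        then show "act (a [^] m) v \<in> vs.span ((\<lambda>v. Y v m) ` J)"
          using v by (simp only:) (intro vs.span_scale vs.span_base imageI)
      qed
      moreover have "vs.span ((\<lambda>v. Y v m) ` J) \<subseteq> adjoin K (X ` I)"
      proof (rule vs.span_minimal)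
        show "(\<lambda>v. Y v m) ` J \<subseteq> adjoin K (X ` I)"
        proof (rule image_subsetI)
          fix v assume "v \<in> J"
          then have "X (v, m) \<in> adjoin K (X ` I)" using mh(1) by (intro adjoin_gen imageI) (simp add: I_def)
          then show "Y v m \<in> adjoin K (X ` I)" by (simp add: X_def)
        qed
        show "vs.subspace (adjoin K (X ` I))"
          by (rule subspace_subfield[OF F]) (rule subsetI, erule adjoin_base)
      qed
      moreover have "x g = act (a [^] m) (x h)" using act_x[OF am H_carrier[OF mh(2)]] mh(3) by simp
      ultimately show ?thesis by (simp only: subsetD)
    qed
    then show ?thesis unfolding L0_eq by (subst adjoin_subset_iff[OF F]) (auto intro: hull_inc)
  qed
  have card_nz: "of_nat (p ^ k) \<noteq> (0 :: 'k)" for k using p_nz by simp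
  have cardH: "of_nat (card H) \<noteq> (0 :: 'k)"
  proof
    assume "of_nat (card H) = (0 :: 'k)"
    then have "of_nat (p * card H) = (0 :: 'k)" by simp
    moreover have "p * card H = p ^ n" using order by simp
    ultimately show False using card_nz[of n] by (simp only:)
  qed
  let ?M = "fixed_exponents I X H"
  have fixedH: "fixed H = adjoin K (monom_int I X ` ?M)"
    by (rule fixed_eq_adjoin_monomials[where I = I and X = X, OF I XL Xnz subgroup_H cardH eigen])
      (use L0_sub in \<open>auto simp: fixed_def\<close>)
  \<comment> \<open>Adding \<open>p - 1\<close> modulo \<open>p\<close> gives the cyclic
    predecessor: \<open>\<tau>\<close> inverts the shift \<open>\<sigma>\<close> of the variables,
    because permuting variables composes exponents with the inverse. Second components from
    \<open>p\<close> on are left fixed, so that \<open>\<tau> ^^ p = id\<close> holds on the whole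
    type.\<close>
  define q where "q = p - 1"
  have q: "Suc q = p" using p_pos by (simp add: q_def)
  define \<tau> where "\<tau> = (\<lambda>(v :: 'l, m). (v, if m < p then (m + q) mod p else m))"
  define \<sigma> where "\<sigma> = (\<lambda>(v :: 'l, m). (v, if m < p then Suc m mod p else m))"
  have \<tau>_pow: "(\<tau> ^^ k) (v, m) = (v, if m < p then (m + k * q) mod p else m)" for k v m
  proof (induction k)
    case (Suc k)
    have "((m + k * q) mod p + q) mod p = (m + Suc k * q) mod p"
      unfolding mod_add_left_eq by (simp add: ac_simps)
    then show ?case using Suc p_pos by (simp add: \<tau>_def)
  qed simp
  have \<tau>_id: "\<tau> ^^ p = id"
    by (rule ext) (auto simp: \<tau>_pow)
  have \<tau>\<sigma>: "\<tau> (\<sigma> i) = i" if i: "i \<in> I" for i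
  proof -
    obtain v m where vm: "i = (v, m)" "m < p" using i by (auto simp: I_def)
    show ?thesis
    proof (cases "Suc m = p")
      case True
      then show ?thesis using q vm p_pos by (simp add: \<tau>_def \<sigma>_def)
    next
      case False
      then have "Suc m < p" "Suc m + q = m + p" using q vm(2) by auto
      moreover have "\<sigma> i = (v, Suc m)" using vm \<open>Suc m < p\<close> by (simp add: \<sigma>_def)
      ultimately have "\<tau> (\<sigma> i) = (v, (m + p) mod p)" by (simp only: \<tau>_def prod.case if_True)
      then show ?thesis using vm by simp
    qed
  qed
  have \<sigma>I: "\<sigma> ` I \<subseteq> I" using p_pos by (auto simp: \<sigma>_def I_def)
  have \<sigma>: "bij_betw \<sigma> I I"
  proof -
    have "inj_on \<sigma> I" by (rule inj_on_inverseI) (rule \<tau>\<sigma>)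
    then show ?thesis using endo_inj_surj[OF I \<sigma>I] by (simp add: bij_betw_def)
  qed
  have \<tau>I: "\<tau> i \<in> I \<longleftrightarrow> i \<in> I" for i using p_pos by (cases i) (auto simp: \<tau>_def I_def)
  \<comment> \<open>The scalar attached to a variable depends only on its orbit
    \<open>fst i\<close>, hence \<open>cc\<close> is unchanged by the shift.\<close>
  define cc where "cc w = (\<Prod>i\<in>I. c (fst i) powi w i)" for w :: "'l \<times> nat \<Rightarrow> int"
  have cI: "c (fst i) \<noteq> 0" if "i \<in> I" for i using that c(1) by (auto simp: I_def)
  have act_X: "act a (X i) = rc (c (fst i)) * X (\<sigma> i)" if i: "i \<in> I" for i
  proof -
    obtain v m where vm: "i = (v, m)" "m < p" "v \<in> J" using i by (auto simp: I_def)
    have "Y v (Suc m) = Y v (Suc m mod p)" using vm Y0 Yp by (cases "Suc m = p") auto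
    then show ?thesis using act_Y[OF vm(3), of m] vm by (simp add: X_def \<sigma>_def)
  qed
  have act_mon: "act a (monom_int I X w) = rc (cc w) * monom_int I X (\<lambda>i. w (\<tau> i))" for w
  proof -
    have "act a (monom_int I X w) = (\<Prod>i\<in>I. rc (c (fst i) powi w i) * X (\<sigma> i) powi w i)"
      unfolding monom_int_def act_prod[OF a(1)] using act_X
      by (intro prod.cong) (simp_all add: act_power_int[OF a(1)] power_int_mult_distrib rc_power_int)
    also have "\<dots> = (\<Prod>i\<in>I. rc (c (fst i) powi w i)) * (\<Prod>i\<in>I. X (\<sigma> i) powi w i)" by (rule prod.distrib)
    also have "(\<Prod>i\<in>I. rc (c (fst i) powi w i)) = rc (cc w)"
      unfolding cc_def by (induction I rule: infinite_finite_induct) (simp_all add: rc_1 rc_mult)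
    also have "(\<Prod>i\<in>I. X (\<sigma> i) powi w i) = (\<Prod>i\<in>I. X (\<sigma> i) powi w (\<tau> (\<sigma> i)))"
      using \<tau>\<sigma> by (intro prod.cong) auto
    also have "\<dots> = monom_int I X (\<lambda>i. w (\<tau> i))"
      unfolding monom_int_def by (rule prod.reindex_bij_betw[OF \<sigma>])
    finally show ?thesis .
  qed
  have cc_nz: "cc w \<noteq> 0" for w using cI I by (simp add: cc_def)
  have cc_add: "cc (v + w) = cc v * cc w" for v w
    unfolding cc_def prod.distrib[symmetric] using cI by (intro prod.cong) (simp_all add: power_int_add)
  have cc_shift: "cc (\<lambda>i. w (\<tau> i)) = cc w" for w
  proof -
    have "cc (\<lambda>i. w (\<tau> i)) = (\<Prod>i\<in>I. c (fst (\<sigma> i)) powi w (\<tau> (\<sigma> i)))"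
      unfolding cc_def by (rule prod.reindex_bij_betw[OF \<sigma>, symmetric])
    also have "\<dots> = cc w" unfolding cc_def using \<tau>\<sigma>
      by (intro prod.cong) (auto simp: \<sigma>_def split: prod.splits)
    finally show ?thesis .
  qed
  \<comment> \<open>Normality of \<open>H\<close> turns invariance under \<open>h\<close> into
    invariance under its conjugate by \<open>a\<close>, so the invariant exponents form a
    submodule.\<close>
  have M_shift: "(\<lambda>i. w (\<tau> i)) \<in> ?M" if w: "w \<in> ?M" for w
  proof -
    have wI: "w \<in> supported_on I" using w fixed_exponents_supported by blast
    have wfix: "act h (monom_int I X w) = monom_int I X w" if "h \<in> H" for h
      using w that unfolding fixed_exponents_def by blast
    have mL: "monom_int I X w \<in> L0" by (rule monom_int_L0[where I = I and X = X, OF I XL Xnz])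
    have "act h (monom_int I X (\<lambda>i. w (\<tau> i))) = monom_int I X (\<lambda>i. w (\<tau> i))" if h: "h \<in> H" for h
    proof -
      have hc: "h \<in> carrier G" using H_carrier[OF h] .
      let ?k = "inv a \<otimes> h \<otimes> a"
      have k: "?k \<in> H" using normal.inv_op_closed1[OF H(1) a(1) h] .
      have "h \<otimes> a = a \<otimes> ?k" using hc a(1) by (simp flip: m_assoc)
      then have "act h (act a (monom_int I X w)) = act a (monom_int I X w)"
        using act_act[OF hc a(1) mL] act_act[OF a(1) H_carrier[OF k] mL] wfix[OF k] by simp
      then show ?thesis
        unfolding act_mon by (simp add: act_mult[OF hc] act_rc[OF hc] rc_eq_0_iff cc_nz)
    qed
    moreover have "(\<lambda>i. w (\<tau> i)) \<in> supported_on I" using wI \<tau>I unfolding supported_on_def by blast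
    ultimately show ?thesis unfolding fixed_exponents_def by blast
  qed
  have M_exp: "fun_scale (int p ^ e) w \<in> ?M" if "w \<in> supported_on I" for w
    using fixed_exponents_power[where I = I and X = X, OF I XL Xnz subgroup.subset[OF subgroup_H] eigen exponent(2)[OF H_carrier] that]
    by simp
  have M_group: "exponent_group ?M"
    by (rule fixed_exponents_closed[where I = I and X = X, OF I XL Xnz subgroup.subset[OF subgroup_H]])
  obtain js where js: "set js = J" "distinct js" using finite_distinct_list[OF J(1)] by blast
  \<comment> \<open>One free generator per orbit; its shifts are the unit vectors
    \<open>unit_fun (v, m)\<close>.\<close>
  define es where "es = map (\<lambda>v. unit_fun (v, 0 :: nat)) js"
  have es_supp: "set [] \<union> set es \<subseteq> supported_on I"
    using p_pos js(1) by (auto simp: es_def I_def intro!: unit_fun_supported)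
  have unit_shift: "(\<lambda>i. unit_fun (v, 0) ((\<tau> ^^ m) i)) = unit_fun (v, m)" if m: "m < p" for v m
  proof
    fix i :: "'l \<times> nat"
    obtain v' m' where i: "i = (v', m')" by (cases i)
    have "(m' + m * q) mod p = 0 \<longleftrightarrow> m' = m" if m': "m' < p"
    proof
      have eq: "m' + m * q + m = m' + m * p" by (simp flip: q)
      assume "(m' + m * q) mod p = 0"
      then have "(m' + m * q + m) mod p = m" using m by (metis add_0 mod_add_left_eq mod_less)
      then show "m' = m" using m' unfolding eq by simp
    next
      assume "m' = m"
      moreover have "m + m * q = m * p" by (simp flip: q)
      ultimately show "(m' + m * q) mod p = 0" by simp
    qed
    then show "unit_fun (v, 0) ((\<tau> ^^ m) i) = unit_fun (v, m) i"
      using m by (auto simp: i \<tau>_pow unit_fun_def)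
  qed
  interpret perm_lattice \<tau> p by (rule perm_lattice.intro[OF p \<tau>_id])
  have supp: "supported_on I = span (set [] \<union> set es)"
  proof (rule span_supported_on[OF I _ es_supp])
    fix i :: "'l \<times> nat" assume "\<tau> i \<in> I" then show "i \<in> I" using \<tau>I by (simp only:)
  next
    fix i :: "'l \<times> nat" assume "i \<in> I"
    then obtain v m where i: "i = (v, m)" "v \<in> J" "m < p" unfolding I_def by (rule SigmaE) simp
    have "unit_fun (v, 0) \<in> set [] \<union> set es"
      unfolding es_def set_map js(1) using i(2) by (intro UnI2 imageI)
    then have "perm_scale \<tau> (Polynomial.monom 1 m) (unit_fun (v, 0)) \<in> span (set [] \<union> set es)"
      by (intro span_scale span_base)
    then show "unit_fun i \<in> span (set [] \<union> set es)"
      unfolding ex.poly_act_monom poly_act_funpow unit_shift[OF i(3)] i(1) .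
  qed
  have gg: "good_generators [] []" unfolding good_generators_def by (simp only: list.set ball_empty simp_thms)
  have "subspace ?M"
    by (rule poly_act_subspaceI) (use M_group M_shift in \<open>simp_all only: exponent_group_def\<close>)
  from finite_index_generators[OF I gg supp this fixed_exponents_supported M_exp]
  obtain fs' es' gs' where gens: "good_generators fs' gs'" "?M = span (set fs' \<union> set es' \<union> set gs')"
    "lattice_rank fs' es' gs' = length ([] :: ('l \<times> nat \<Rightarrow> int) list) + p * length es" .
  interpret ma: monomial_action G act rc L0 "perm_scale \<tau>" p a "monom_int I X" cc "\<omega> ^ (p ^ (e - 1))"
    by (unfold_locales; (rule a \<zeta> p_nz monom_int_add[where I = I and X = X, OF I XL Xnz] monom_int_nz[where I = I and X = X, OF I XL Xnz] cc_add cc_nz)?)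
      (simp_all only: X_act cc_shift act_mon)
  obtain S where S: "finite S" "card S \<le> lattice_rank fs' es' gs'" "\<forall>s\<in>S. \<exists>d. act a s = rc d * s"
    "adjoin K S = adjoin K (monom_int I X ` span (set fs' \<union> set es' \<union> set gs'))"
    using ma.eigenvector_generators[OF gens(1), of es'] by blast
  have SH: "fixed H = adjoin K S" unfolding fixedH S(4) gens(2) ..
  show ?thesis
  proof (rule rational_if_diagonal[OF S(1) _ _ SH])
    show "card S \<le> Coset.order G"
    proof -
      have "card S \<le> p * card J"
        using S(2) distinct_card[OF js(2)] js(1) by (simp add: gens(3) es_def)
      also have "\<dots> \<le> p * card H" using J(2) by (rule mult_le_mono2)
      finally show ?thesis using order(2) by simp
    qed
    show "\<exists>d. act a s = rc d * s" if "s \<in> S" for s using S(3) that by blast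
  qed
qed

end

section \<open>Characteristic \<open>p\<close>\<close>

lemma polys_over_pcompose:
  assumes "is_subfield F" "P \<in> polys_over F" "Q \<in> polys_over F"
  shows "pcompose P Q \<in> polys_over F"
  using assms(2)
  by (induction P) (auto simp: pcompose_pCons intro!: polys_over_intros[OF assms(1)] assms(3))

text \<open>Long division carried out explicitly keeps the quotient and the remainder over
  \<open>E\<close>.\<close>

lemma polys_over_division:
  fixes F :: "'l::field poly"
  assumes E: "is_subfield E" and F: "F \<in> polys_over E" "0 < Polynomial.degree F" and P: "P \<in> polys_over E"
  shows "\<exists>Q\<in>polys_over E. \<exists>R\<in>polys_over E. P = Q * F + R \<and> Polynomial.degree R < Polynomial.degree F"
  using P
proof (induction "Polynomial.degree P" arbitrary: P rule: less_induct)
  case less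
  note R = polys_over_intros[OF E]
  show ?case
  proof (cases "Polynomial.degree P < Polynomial.degree F")
    case True
    then show ?thesis using less.prems R(1) by (intro bexI[of _ 0] bexI[of _ P]) auto
  next
    case False
    let ?n = "Polynomial.degree P" and ?d = "Polynomial.degree F"
    have lc: "lead_coeff F \<noteq> 0" using F(2) by auto
    define M where "M = Polynomial.monom (lead_coeff P / lead_coeff F) (?n - ?d)"
    have M: "M \<in> polys_over E"
      unfolding M_def using less.prems F(1) by (intro R(7) subfield_divide[OF E]) (auto simp: polys_over_def)
    have MF: "M * F \<in> polys_over E" using M F(1) by (rule R(5))
    have degM: "Polynomial.degree (M * F) \<le> ?n"
      using degree_mult_le[of M F] degree_monom_le[of "lead_coeff P / lead_coeff F" "?n - ?d"] False
      unfolding M_def by linarith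
    have "Polynomial.coeff (M * F) ?n = lead_coeff P"
      using False lc by (simp add: M_def coeff_monom_mult)
    then have top: "Polynomial.coeff (P - M * F) ?n = 0" by simp
    have le: "Polynomial.degree (P - M * F) \<le> ?n" using degM by (intro degree_diff_le) auto
    have "P - M * F = 0 \<or> Polynomial.degree (P - M * F) < ?n"
      using top le by (metis leading_coeff_0_iff le_neq_implies_less)
    then have "Polynomial.degree (P - M * F) < ?n" using False F(2) by auto
    then obtain Q R' where QR: "Q \<in> polys_over E" "R' \<in> polys_over E" "P - M * F = Q * F + R'"
      "Polynomial.degree R' < ?d"
      using less.hyps[of "P - M * F"] R(4)[OF less.prems MF] by blast
    have "P = (M + Q) * F + R'" using QR(3) by (simp add: algebra_simps)
    then show ?thesis using QR R(3)[OF M QR(1)] by blast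
  qed
qed

context group_field_action
begin

text \<open>Miyata's lemma: the invariants of \<open>E(t)\<close> are generated over those of \<open>E\<close> by an invariant
  polynomial of minimal positive degree in \<open>t\<close>, because the quotient and the remainder of invariant
  polynomials are invariant.\<close>

lemma miyata:
  assumes E: "is_subfield E" "E \<subseteq> L0" and stable: "\<And>g y. g \<in> carrier G \<Longrightarrow> y \<in> E \<Longrightarrow> act g y \<in> E"
    and t: "t \<in> L0" "\<And>g. g \<in> carrier G \<Longrightarrow> act g t - t \<in> E" "\<not> alg_over E t"
  shows "\<exists>f. fixed (carrier G) \<inter> adjoin E {t} = adjoin (fixed (carrier G) \<inter> E) {f}"
proof -
  let ?Fix = "fixed (carrier G)"
  note R = polys_over_intros[OF E(1)]
  have inj: "P = Q" if PQ: "P \<in> polys_over E" "Q \<in> polys_over E" "poly P t = poly Q t" for P Q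
  proof (rule ccontr)
    assume "P \<noteq> Q"
    then have "P - Q \<noteq> 0" "poly (P - Q) t = 0" using PQ(3) by auto
    then show False using R(4)[OF PQ(1,2)] t(3) unfolding alg_over_def by blast
  qed
  have pL0: "poly P t \<in> L0" if "P \<in> polys_over E" for P
    using poly_in_subfield[OF L0 _ t(1)] polys_over_mono[OF E(2)] that by blast
  \<comment> \<open>The action transported to polynomials in \<open>t\<close>: it acts on the
    coefficients and then substitutes for \<open>t\<close>. As \<open>act g t\<close> differs from
    \<open>t\<close> by an element of \<open>E\<close>, this stays over \<open>E\<close> and does
    not raise the degree.\<close>
  define tw where "tw g P = pcompose (act_poly g P) [:act g t - t, 1:]" for g P
  have tw_E: "tw g P \<in> polys_over E" if g: "g \<in> carrier G" and P: "P \<in> polys_over E" for g P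
  proof -
    have "act_poly g P \<in> polys_over E"
      using P stable[OF g] by (simp add: polys_over_def act_poly_coeff[OF g])
    moreover have "[:act g t - t, 1:] \<in> polys_over E" using t(2)[OF g] R(1) subfield_1[OF E(1)] by simp
    ultimately show ?thesis unfolding tw_def by (rule polys_over_pcompose[OF E(1)])
  qed
  have tw_poly: "poly (tw g P) t = act g (poly P t)" if g: "g \<in> carrier G" for g P
    by (simp add: tw_def poly_pcompose poly_act_poly[OF g])
  have tw_deg: "Polynomial.degree (tw g P) \<le> Polynomial.degree P" if g: "g \<in> carrier G" for g P
  proof -
    have "Polynomial.degree (act_poly g P) \<le> Polynomial.degree P"
      by (rule degree_le) (simp add: act_poly_coeff[OF g] coeff_eq_0 act_0[OF g])
    then show ?thesis
      using degree_pcompose_le[of "act_poly g P" "[:act g t - t, 1:]"] by (simp add: tw_def)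
  qed
  define Inv where "Inv = {P \<in> polys_over E. poly P t \<in> ?Fix}"
  have InvI: "P \<in> Inv" if "P \<in> polys_over E" "\<And>g. g \<in> carrier G \<Longrightarrow> act g (poly P t) = poly P t" for P
    using that pL0 by (simp add: Inv_def fixed_def)
  have Inv_tw: "tw g P = P" if "g \<in> carrier G" "P \<in> Inv" for g P
    using that by (intro inj tw_E) (auto simp: Inv_def fixed_def tw_poly)
  \<comment> \<open>The norm of \<open>t\<close>, written as a monic polynomial in \<open>t\<close>;
    it supplies an invariant of positive degree.\<close>
  define F0 where "F0 = (\<Prod>g\<in>carrier G. [:act g t - t, 1:])"
  have F0: "F0 \<in> Inv"
  proof (rule InvI)
    show "F0 \<in> polys_over E"
      unfolding F0_def using t(2) R(1) subfield_1[OF E(1)] by (intro polys_over_prod[OF E(1)]) simp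
    have "poly F0 t = (\<Prod>g\<in>carrier G. act g t)" by (simp add: F0_def poly_prod)
    then show "act g (poly F0 t) = poly F0 t" if "g \<in> carrier G" for g
      using act_prod_orbit[OF subgroup_self that t(1)] by simp
  qed
  have "Polynomial.degree F0 = (\<Sum>g\<in>carrier G. Polynomial.degree [:act g t - t, 1:])"
    unfolding F0_def by (rule degree_prod_sum_eq) simp
  then have degF0: "0 < Polynomial.degree F0"
    using finite_G one_closed by (simp add: card_gt_0_iff) blast
  have "\<exists>F. (F \<in> Inv \<and> 0 < Polynomial.degree F) \<and>
      (\<forall>P. P \<in> Inv \<and> 0 < Polynomial.degree P \<longrightarrow> Polynomial.degree F \<le> Polynomial.degree P)"
    by (rule ex_has_least_nat) (use F0 degF0 in blast)
  then obtain F where F: "F \<in> Inv" "0 < Polynomial.degree F"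
    "\<And>P. P \<in> Inv \<Longrightarrow> 0 < Polynomial.degree P \<Longrightarrow> Polynomial.degree F \<le> Polynomial.degree P" by blast
  have FE: "F \<in> polys_over E" using F(1) by (simp add: Inv_def)
  let ?f = "poly F t" and ?A = "adjoin (?Fix \<inter> E) {poly F t}"
  have A: "is_subfield ?A" by (rule is_subfield_hull)
  have f: "?f \<in> ?A" by (rule adjoin_gen) simp
  have main: "poly P t \<in> ?A" if "P \<in> Inv" for P
    using that
  proof (induction "Polynomial.degree P" arbitrary: P rule: less_induct)
    case less
    have PE: "P \<in> polys_over E" using less.prems by (simp add: Inv_def)
    obtain Q S where QS: "Q \<in> polys_over E" "S \<in> polys_over E" "P = Q * F + S"
      "Polynomial.degree S < Polynomial.degree F"
      using polys_over_division[OF E(1) FE F(2) PE] by blast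
    \<comment> \<open>Uniqueness of division with remainder: a nonzero change of the quotient,
      multiplied by \<open>F\<close>, would have too large a degree.\<close>
    have inv: "tw g Q = Q \<and> tw g S = S" if g: "g \<in> carrier G" for g
    proof -
      have "poly (tw g Q * F + tw g S) t = act g (poly P t)"
        using Inv_tw[OF g F(1)] tw_poly[OF g, of F]
        by (simp add: tw_poly[OF g] QS(3) act_add[OF g] act_mult[OF g])
      also have "\<dots> = poly (Q * F + S) t" using less.prems g by (simp add: Inv_def fixed_def QS(3))
      finally have "tw g Q * F + tw g S = Q * F + S"
        using QS(1,2) FE tw_E[OF g] by (intro inj R(3) R(5)) auto
      then have eq: "(tw g Q - Q) * F = S - tw g S" by (simp add: algebra_simps)
      have "tw g Q - Q = 0"
      proof (rule ccontr)
        assume nz: "tw g Q - Q \<noteq> 0"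
        have "F \<noteq> 0" using F(2) by auto
        then have "Polynomial.degree F \<le> Polynomial.degree ((tw g Q - Q) * F)"
          using nz by (simp add: degree_mult_eq)
        also have "\<dots> \<le> max (Polynomial.degree S) (Polynomial.degree (tw g S))"
          unfolding eq by (rule degree_diff_le_max)
        also have "\<dots> < Polynomial.degree F" using QS(4) tw_deg[OF g, of S] by simp
        finally show False by simp
      qed
      then show ?thesis using eq by simp
    qed
    have QI: "Q \<in> Inv" and SI: "S \<in> Inv"
      using QS(1,2) inv tw_poly by (auto intro!: InvI) metis+
    have "Polynomial.degree S = 0" using F(3)[OF SI] QS(4) by (meson linorder_not_less not_gr0)
    then obtain c where c: "S = [:c:]" by (rule degree_eq_zeroE)
    have "c \<in> ?Fix \<inter> E" using SI QS(2) by (simp add: c Inv_def)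
    then have cA: "poly S t \<in> ?A" by (simp add: c) (rule hull_inc, simp)
    have "poly Q t \<in> ?A"
    proof (cases "Q = 0")
      case True
      then show ?thesis using subfield_0[OF A] by simp
    next
      case False
      have "F \<noteq> 0" using F(2) by auto
      then have deg: "Polynomial.degree (Q * F) = Polynomial.degree Q + Polynomial.degree F"
        using False by (simp add: degree_mult_eq)
      have "Q * F = P - S" using QS(3) by simp
      then have "Polynomial.degree Q + Polynomial.degree F \<le> max (Polynomial.degree P) (Polynomial.degree S)"
        using degree_diff_le_max[of P S] deg by simp
      then have "Polynomial.degree Q < Polynomial.degree P" using QS(4) F(2) by (simp add: max_def split: if_splits)
      then show ?thesis using less.hyps QI by blast
    qed
    then have "poly Q t * ?f + poly S t \<in> ?A" by (rule subfield_add[OF A subfield_mult[OF A _ f] cA])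
    then show ?case by (simp add: QS(3))
  qed
  have "?Fix \<inter> adjoin E {t} \<subseteq> ?A"
  proof
    fix u assume u: "u \<in> ?Fix \<inter> adjoin E {t}"
    then obtain P Q where PQ: "P \<in> polys_over E" "Q \<in> polys_over E" "Q \<noteq> 0" "u = poly P t / poly Q t"
      using adjoin_single_fraction[OF E(1) _ t(3)] by blast
    have Qt: "poly Q t \<noteq> 0" using PQ(2,3) t(3) unfolding alg_over_def by blast
    \<comment> \<open>Multiplying by the remaining conjugates of \<open>Q\<close> makes the
      denominator invariant without leaving the polynomials over \<open>E\<close>.\<close>
    define Q1 where "Q1 = (\<Prod>g\<in>carrier G - {\<one>}. tw g Q)"
    have Q1: "Q1 \<in> polys_over E" unfolding Q1_def using PQ(2) by (intro polys_over_prod[OF E(1)] tw_E) auto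
    have QQ1: "poly (Q * Q1) t = (\<Prod>g\<in>carrier G. act g (poly Q t))"
      using finite_G act_one[OF pL0[OF PQ(2)]]
      by (subst prod.remove[of _ \<one>]) (auto simp: Q1_def poly_prod tw_poly intro!: prod.cong)
    have I1: "Q * Q1 \<in> Inv"
      using act_prod_orbit[OF subgroup_self _ pL0[OF PQ(2)]] QQ1 R(5)[OF PQ(2) Q1] by (intro InvI) auto
    have nz: "poly (Q * Q1) t \<noteq> 0"
      unfolding QQ1 using finite_G Qt act_eq_0_iff by simp
    have uP: "poly (P * Q1) t = u * poly (Q * Q1) t" using PQ(4) Qt by simp
    have "P * Q1 \<in> Inv"
    proof (rule InvI)
      show "P * Q1 \<in> polys_over E" by (rule R(5)[OF PQ(1) Q1])
      fix g assume g: "g \<in> carrier G"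
      have "act g u = u" using u g unfolding fixed_def by blast
      moreover have "act g (poly (Q * Q1) t) = poly (Q * Q1) t"
        using I1 g unfolding Inv_def fixed_def by blast
      ultimately show "act g (poly (P * Q1) t) = poly (P * Q1) t"
        by (simp only: uP act_mult[OF g])
    qed
    then have "poly (P * Q1) t / poly (Q * Q1) t \<in> ?A"
      by (intro subfield_divide[OF A main main[OF I1]])
    then show "u \<in> ?A" using uP nz by simp
  qed
  moreover have "?A \<subseteq> ?Fix \<inter> adjoin E {t}"
  proof -
    have Fix: "is_subfield ?Fix" by (rule subfield_fixed) simp
    have Et: "is_subfield (adjoin E {t})" by (rule is_subfield_hull)
    have "?f \<in> ?Fix" using F(1) by (simp add: Inv_def)
    moreover have EEt: "E \<subseteq> adjoin E {t}" by (rule subsetI) (rule adjoin_base)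
    then have "?f \<in> adjoin E {t}"
      by (intro poly_in_subfield[OF Et subsetD[OF polys_over_mono FE]] adjoin_gen) simp_all
    moreover have "?Fix \<inter> E \<subseteq> adjoin E {t}" using EEt by (rule le_infI2)
    ultimately have "?A \<subseteq> ?Fix" "?A \<subseteq> adjoin E {t}"
      unfolding adjoin_subset_iff[OF Fix] adjoin_subset_iff[OF Et] by simp_all
    then show ?thesis by blast
  qed
  ultimately show ?thesis by blast
qed

end

section \<open>Invariant flags of the regular representation\<close>

context index_p_action
begin

definition "V = vs.span (x ` carrier G)"

lemma V_L0: "v \<in> V \<Longrightarrow> v \<in> L0"
  unfolding V_def by (rule span_L0) (use x_L0 in auto)

lemma act_V: "g \<in> carrier G \<Longrightarrow> v \<in> V \<Longrightarrow> act g v \<in> V"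
  unfolding V_def
proof (rule act_vs_span)
  fix s assume "g \<in> carrier G" "s \<in> x ` carrier G"
  then show "act g s \<in> vs.span (x ` carrier G)" using act_x by (auto intro!: vs.span_base)
qed

lemma V_diff: "v \<in> V \<Longrightarrow> w \<in> V \<Longrightarrow> v - w \<in> V"
  unfolding V_def by (rule vs.span_diff)

text \<open>In characteristic \<open>p\<close>, the power \<open>p ^ e\<close> of g - 1 is the power
  \<open>p ^ e\<close> of g minus 1, which is zero. The ambient field is made a module over
  \<int>[X] with X acting as \<open>g\<close>, so that \<open>T_power\<close> applies.\<close>

lemma unipotent:
  assumes char: "of_nat p = (0 :: 'l)" and g: "g \<in> carrier G" and v: "v \<in> L0"
  shows "((\<lambda>u. act g u - u) ^^ (p ^ e)) v = 0"
proof -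
  have act_int: "act g (of_int k * u) = of_int k * act g u" for k u
  proof -
    have nat: "act g (of_nat m) = of_nat m" for m
      by (induction m) (simp_all add: act_0[OF g] act_1[OF g] act_add[OF g])
    have "act g (of_int k) = of_int k" by (cases k) (simp_all add: nat act_uminus[OF g] act_diff[OF g] act_1[OF g])
    then show ?thesis by (simp add: act_mult[OF g])
  qed
  let ?s = "\<lambda>k u. of_int k * u :: 'l"
  interpret me: module_endo ?s "act g"
    by standard (simp_all only: act_add[OF g] act_int, simp_all add: algebra_simps)
  interpret mp: Modules.module "poly_act ?s (act g)" by (rule me.module_poly_act)
  have pow: "(act g ^^ m) v = act (g [^] m) v" for m
  proof (induction m)
    case (Suc m)
    then show ?case using act_act[of g "g [^] m" v] g v nat_pow_Suc2[OF g, of m] by simp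
  qed (use act_one[OF v] in simp)
  have T: "poly_act ?s (act g) T_poly u = act g u - u" for u
    unfolding me.poly_act_pCons[of "-1"] me.poly_act_const by simp
  have "((\<lambda>u. act g u - u) ^^ m) v = poly_act ?s (act g) (T_poly ^ m) v" for m
  proof (induction m)
    case (Suc m)
    have "poly_act ?s (act g) (T_poly ^ Suc m) v = poly_act ?s (act g) T_poly (poly_act ?s (act g) (T_poly ^ m) v)"
      by (simp only: mp.scale_scale power_Suc)
    then show ?case using Suc by (simp only: T funpow.simps o_apply)
  qed (simp only: mp.scale_one power_0 funpow_0)
  moreover obtain S where S: "T_poly ^ (p ^ e) = Polynomial.monom 1 (p ^ e) - 1 + of_nat p * S"
    using T_power[OF p] by blast
  have "poly_act ?s (act g) (of_nat p * S) v = of_int (int p) * poly_act ?s (act g) S v"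
  proof -
    have "of_nat p * S = smult (int p) S" by (simp add: of_nat_poly)
    then show ?thesis by (simp only: me.poly_act_smult)
  qed
  then have "poly_act ?s (act g) (T_poly ^ (p ^ e)) v = act (g [^] (p ^ e)) v - v"
    unfolding S mp.scale_left_distrib mp.scale_left_diff_distrib me.poly_act_monom pow mp.scale_one
    using char by simp
  ultimately show ?thesis using exponent(2)[OF g] act_one[OF v] by simp
qed

text \<open>Iterating the nilpotent g - 1 from \<open>v\<close> inside \<open>Q\<close>, the last
  vector before \<open>W\<close> is first entered is fixed modulo \<open>W\<close>.\<close>

lemma unipotent_step:
  assumes char: "of_nat p = (0 :: 'l)" and g: "g \<in> carrier G" and Q: "Q \<subseteq> V" "\<And>u. u \<in> Q \<Longrightarrow> act g u - u \<in> Q"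
    and v: "v \<in> Q" "v \<notin> W" and W: "0 \<in> W"
  shows "\<exists>u\<in>Q. u \<notin> W \<and> act g u - u \<in> W"
proof -
  let ?T = "\<lambda>u. act g u - u"
  have TQ: "(?T ^^ j) v \<in> Q" for j by (induction j) (use v(1) Q(2) in auto)
  have "v \<in> L0" using v(1) Q(1) V_L0 by blast
  then have "(?T ^^ (p ^ e)) v \<in> W" using unipotent[OF char g] W by simp
  then have ex: "\<exists>j. (?T ^^ j) v \<in> W" by blast
  define j where "j = (LEAST j. (?T ^^ j) v \<in> W)"
  have j: "(?T ^^ j) v \<in> W" unfolding j_def using ex by (rule LeastI_ex)
  have "j \<noteq> 0" using j v(2) by (metis funpow_0)
  then obtain i where i: "j = Suc i" by (cases j) auto
  have "(?T ^^ i) v \<notin> W" using not_less_Least[of i "\<lambda>j. (?T ^^ j) v \<in> W"] i by (simp add: j_def)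
  moreover have "?T ((?T ^^ i) v) \<in> W" using j by (simp add: i)
  ultimately show ?thesis using TQ by blast
qed

text \<open>A p-group fixes a nonzero vector of V / W. For \<open>H\<close> it is found one element
  at a time, since commuting elements preserve each other's fixed spaces. The space fixed by
  \<open>H\<close> is stable under \<open>a\<close> because \<open>H\<close> is normal, which gives
  the last step.\<close>

lemma fixed_vector_mod:
  assumes char: "of_nat p = (0 :: 'l)" and W: "vs.subspace W" "W \<subset> V"
    and stable: "\<And>g w. g \<in> carrier G \<Longrightarrow> w \<in> W \<Longrightarrow> act g w \<in> W"
  shows "\<exists>v\<in>V. v \<notin> W \<and> (\<forall>g\<in>carrier G. act g v - v \<in> W)"
proof -
  have W0: "0 \<in> W" using vs.subspace_0[OF W(1)] .
  \<comment> \<open>The preimage in \<open>V\<close> of the vectors of V / W fixed by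
    \<open>S\<close>.\<close>
  define Q where "Q S = {v \<in> V. \<forall>h\<in>S. act h v - v \<in> W}" for S
  have "finite S \<Longrightarrow> S \<subseteq> H \<Longrightarrow> \<exists>v\<in>Q S. v \<notin> W" for S
  proof (induction S rule: finite_induct)
    case empty
    then show ?case using W(2) by (auto simp: Q_def)
  next
    case (insert h S)
    have h: "h \<in> H" "h \<in> carrier G" using insert.prems H_carrier by auto
    obtain v where v: "v \<in> Q S" "v \<notin> W" using insert by auto
    have "act h u - u \<in> Q S" if u: "u \<in> Q S" for u
    proof -
      have uV: "u \<in> V" and uL: "u \<in> L0" using u V_L0 by (auto simp: Q_def)
      have "act k (act h u - u) - (act h u - u) \<in> W" if k: "k \<in> S" for k
      proof -
        have kH: "k \<in> H" "k \<in> carrier G" using k insert.prems H_carrier by auto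
        have "act k (act h u) = act h (act k u)"
          using act_act[OF kH(2) h(2) uL] act_act[OF h(2) kH(2) uL] H(2)[OF kH(1) h(1)] by simp
        then have "act k (act h u - u) - (act h u - u) = act h (act k u - u) - (act k u - u)"
          by (simp add: act_diff[OF kH(2)] act_diff[OF h(2)])
        moreover have "act k u - u \<in> W" using u k by (simp add: Q_def)
        then have "act h (act k u - u) - (act k u - u) \<in> W"
          using vs.subspace_diff[OF W(1) stable[OF h(2)]] by blast
        ultimately show ?thesis by (simp only:)
      qed
      then show ?thesis using V_diff[OF act_V[OF h(2) uV] uV] by (simp add: Q_def)
    qed
    moreover have QV: "Q S \<subseteq> V" unfolding Q_def by blast
    ultimately obtain u where u: "u \<in> Q S" "u \<notin> W" "act h u - u \<in> W"
      using unipotent_step[OF char h(2) QV _ v W0] by blast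
    then have "u \<in> Q (insert h S)" unfolding Q_def by blast
    then show ?case using u(2) by blast
  qed
  then obtain v where v: "v \<in> Q H" "v \<notin> W" using finite_H by blast
  have "act a u - u \<in> Q H" if u: "u \<in> Q H" for u
  proof -
    have uV: "u \<in> V" and uL: "u \<in> L0" using u V_L0 by (auto simp: Q_def)
    have "act h (act a u - u) - (act a u - u) \<in> W" if h: "h \<in> H" for h
    proof -
      have hc: "h \<in> carrier G" using H_carrier[OF h] .
      let ?k = "inv a \<otimes> h \<otimes> a"
      have k: "?k \<in> H" using normal.inv_op_closed1[OF H(1) a(1) h] .
      have "h \<otimes> a = a \<otimes> ?k" using hc a(1) by (simp flip: m_assoc)
      then have "act h (act a u) = act a (act ?k u)"
        using act_act[OF hc a(1) uL] act_act[OF a(1) H_carrier[OF k] uL] by simp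
      then have "act h (act a u - u) - (act a u - u) = act a (act ?k u - u) - (act h u - u)"
        by (simp add: act_diff[OF hc] act_diff[OF a(1)])
      moreover have "act ?k u - u \<in> W" "act h u - u \<in> W" using u h k unfolding Q_def by blast+
      then have "act a (act ?k u - u) - (act h u - u) \<in> W"
        using vs.subspace_diff[OF W(1) stable[OF a(1)]] by blast
      ultimately show ?thesis by (simp only:)
    qed
    then show ?thesis using V_diff[OF act_V[OF a(1) uV] uV] by (simp add: Q_def)
  qed
  moreover have QV: "Q H \<subseteq> V" unfolding Q_def by blast
  ultimately obtain u where u: "u \<in> Q H" "u \<notin> W" "act a u - u \<in> W"
    using unipotent_step[OF char a(1) QV _ v W0] by blast
  have uV: "u \<in> V" and uL: "u \<in> L0" using u(1) V_L0 by (auto simp: Q_def)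
  have am: "a [^] m \<in> carrier G" for m :: nat using a(1) by simp
  have pow: "act (a [^] m) u - u \<in> W" for m :: nat
  proof (induction m)
    case 0
    show ?case using act_one[OF uL] W0 by simp
  next
    case (Suc m)
    have "act (a [^] Suc m) u - u = act (a [^] m) (act a u - u) + (act (a [^] m) u - u)"
      using act_act[OF am a(1) uL, of m] by (simp add: act_diff[OF am])
    then show ?case using vs.subspace_add[OF W(1) stable[OF am u(3)] Suc] by (simp only:)
  qed
  have "act g u - u \<in> W" if g: "g \<in> carrier G" for g
  proof -
    obtain m h where mh: "m < p" "h \<in> H" "g = a [^] m \<otimes> h" using coset[OF g] by blast
    have "act g u - u = act (a [^] m) (act h u - u) + (act (a [^] m) u - u)"
      using act_act[OF am H_carrier[OF mh(2)] uL, of m] by (simp add: mh(3) act_diff[OF am])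
    moreover have "act h u - u \<in> W" using u(1) mh(2) by (simp add: Q_def)
    ultimately show ?thesis using vs.subspace_add[OF W(1) stable[OF am] pow] by (simp only:)
  qed
  then show ?thesis using uV u(2) by blast
qed

definition flag :: "nat \<Rightarrow> (nat \<Rightarrow> 'l) \<Rightarrow> bool" where
  "flag k v \<longleftrightarrow> (\<forall>i<k. v i \<in> V \<and> v i \<notin> vs.span (v ` {..<i})
     \<and> (\<forall>g\<in>carrier G. act g (v i) - v i \<in> vs.span (v ` {..<i})))"

lemma flag_stable:
  assumes "flag k v" "i \<le> k" "g \<in> carrier G" "w \<in> vs.span (v ` {..<i})"
  shows "act g w \<in> vs.span (v ` {..<i})"
proof (rule act_vs_span[OF assms(3) _ assms(4)])
  fix s assume "s \<in> v ` {..<i}"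
  then obtain j where j: "j < i" "s = v j" by blast
  have "act g (v j) - v j \<in> vs.span (v ` {..<j})" using assms j by (simp add: flag_def)
  then have "act g (v j) - v j \<in> vs.span (v ` {..<i})" using vs.span_mono[of "v ` {..<j}" "v ` {..<i}"] j by force
  moreover have "v j \<in> vs.span (v ` {..<i})" using j by (intro vs.span_base) auto
  ultimately have "(act g (v j) - v j) + v j \<in> vs.span (v ` {..<i})" by (rule vs.span_add)
  then show "act g s \<in> vs.span (v ` {..<i})" by (simp add: j)
qed

lemma flag_independent: "flag k v \<Longrightarrow> vs.independent (v ` {..<k}) \<and> inj_on v {..<k}"
proof (induction k)
  case 0
  show ?case by (simp add: vs.independent_empty)
next
  case (Suc k)
  then have IH: "vs.independent (v ` {..<k})" "inj_on v {..<k}" by (auto simp: flag_def)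
  have nk: "v k \<notin> vs.span (v ` {..<k})" using Suc.prems by (simp add: flag_def)
  then have "v k \<notin> v ` {..<k}" by (rule contra_subsetD[OF vs.span_superset])
  then show ?case using IH vs.independent_insertI[OF nk IH(1)] by (simp add: lessThan_Suc)
qed

lemma flag_length: "flag k v \<Longrightarrow> k \<le> Coset.order G"
proof -
  assume flag: "flag k v"
  have "v ` {..<k} \<subseteq> vs.span (x ` carrier G)" using flag by (auto simp: flag_def V_def)
  then have "card (v ` {..<k}) \<le> card (x ` carrier G)"
    using vs.independent_span_bound[of "x ` carrier G" "v ` {..<k}"] finite_G flag_independent[OF flag] by simp
  also have "\<dots> = Coset.order G" using inj_x by (simp add: card_image Coset.order_def)
  finally show ?thesis using flag_independent[OF flag] by (simp add: card_image)
qed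

text \<open>Independence bounds the length of a flag by the order of \<open>G\<close>. A flag of
  greatest length spans \<open>V\<close>, since otherwise a vector fixed modulo its span would
  prolong it.\<close>

lemma complete_flag:
  assumes char: "of_nat p = (0 :: 'l)"
  obtains k v where "flag k v" "vs.span (v ` {..<k}) = V"
proof -
  have "flag 0 (\<lambda>_. 0)" by (simp add: flag_def)
  then have "\<exists>k. (\<exists>v. flag k v) \<and> (\<forall>k'. (\<exists>v. flag k' v) \<longrightarrow> k' \<le> k)"
    using flag_length by (intro ex_has_greatest_nat[of _ _ id "Suc (Coset.order G)", unfolded id_apply]) (auto simp: less_Suc_eq_le)
  then obtain k v where kv: "flag k v" "\<And>k' v'. flag k' v' \<Longrightarrow> k' \<le> k" by blast
  let ?W = "vs.span (v ` {..<k})"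
  have sub: "?W \<subseteq> V" unfolding V_def
    using kv(1) by (intro vs.span_minimal) (auto simp: flag_def V_def)
  have "?W = V"
  proof (rule ccontr)
    assume "?W \<noteq> V"
    then obtain u where u: "u \<in> V" "u \<notin> ?W" "\<forall>g\<in>carrier G. act g u - u \<in> ?W"
      using fixed_vector_mod[OF char, of ?W] sub flag_stable[OF kv(1) order_refl] by blast
    let ?v = "v(k := u)"
    have img: "?v ` {..<i} = v ` {..<i}" if "i \<le> k" for i using that by (intro image_cong) auto
    have "flag (Suc k) ?v"
      unfolding flag_def
    proof (intro allI impI)
      fix i assume "i < Suc k"
      then consider "i < k" | "i = k" by linarith
      then show "?v i \<in> V \<and> ?v i \<notin> vs.span (?v ` {..<i}) \<and> (\<forall>g\<in>carrier G. act g (?v i) - ?v i \<in> vs.span (?v ` {..<i}))"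
      proof cases
        case 1
        then show ?thesis using kv(1) img[of i] by (simp add: flag_def)
      next
        case 2
        then show ?thesis using u img[of k] by simp
      qed
    qed
    then show False using kv(2) by fastforce
  qed
  then show ?thesis using that kv(1) by blast
qed

theorem rational_char_p:
  assumes "CHAR('k) = p"
  shows "rational_over K (fixed (carrier G))"
proof -
  have "of_nat p = (0 :: 'k)" using assms of_nat_CHAR by metis
  then have char: "of_nat p = (0 :: 'l)" using rc_of_nat[of p] rc_0 by simp
  obtain k v where kv: "flag k v" "vs.span (v ` {..<k}) = V" by (rule complete_flag[OF char])
  define E where "E i = adjoin K (v ` {..<i})" for i
  have E: "is_subfield (E i)" for i unfolding E_def by (rule is_subfield_hull)
  have KE: "K \<subseteq> E i" for i unfolding E_def by (auto intro: adjoin_base)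
  have span_E: "vs.span (v ` {..<i}) \<subseteq> E i" for i
    by (rule vs.span_minimal[OF _ subspace_subfield[OF E KE]]) (auto simp: E_def intro: hull_inc)
  have vL: "v i \<in> L0" if "i < k" for i using kv(1) that V_L0 by (simp add: flag_def)
  have EL: "E i \<subseteq> L0" if "i \<le> k" for i
    unfolding E_def using that vL rc_L0 by (subst adjoin_subset_iff[OF L0]) auto
  have x_E: "x h \<in> E k" if "h \<in> carrier G" for h
    using span_E[of k] kv(2) that vs.span_base[of "x h" "x ` carrier G"] unfolding V_def by blast
  then have "x ` carrier G \<subseteq> E k" by blast
  then have "L0 \<subseteq> E k" unfolding L0_eq using KE by (simp only: adjoin_subset_iff[OF E] simp_thms)
  then have Ek: "E k = L0" using EL by blast
  let ?B = "v ` {..<k}"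
  have inj: "inj_on v {..<k}" using flag_independent[OF kv(1)] by blast
  have "card ?B \<le> Coset.order G" using flag_length[OF kv(1)] inj by (simp add: card_image)
  moreover have "alg_over (adjoin K ?B) (x h)" if "h \<in> carrier G" for h
    using alg_over_base[OF E[of k] x_E[OF that]] unfolding E_def .
  ultimately have indep: "\<not> alg_over (adjoin K (?B - {b})) b" if "b \<in> ?B" for b
    using generators_independent(2)[of ?B b] that by blast
  \<comment> \<open>The flag generates \<open>L0\<close> with at most \<open>order G\<close>
    elements, so it is independent; this is the transcendence required at each use of
    \<open>miyata\<close>.\<close>
  have trans: "\<not> alg_over (E i) (v i)" if i: "i < k" for i
  proof
    assume alg: "alg_over (E i) (v i)"
    have "v ` {..<i} \<subseteq> ?B - {v i}" using i inj by (auto simp: inj_on_def)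
    then have "E i \<subseteq> adjoin K (?B - {v i})" unfolding E_def by (intro adjoin_mono) auto
    then show False using indep[of "v i"] i alg_over_mono[OF _ alg] by blast
  qed
  have E_stable: "act g y \<in> E i" if i: "i \<le> k" and g: "g \<in> carrier G" and y: "y \<in> E i" for i g y
  proof -
    have "is_subfield {y. act g y \<in> E i}"
      by (rule is_subfieldI)
        (auto simp: act_0[OF g] act_1[OF g] act_diff[OF g] act_mult[OF g] act_inverse[OF g] intro: subfield_intros[OF E])
    moreover have "K \<subseteq> {y. act g y \<in> E i}"
    proof (rule image_subsetI)
      fix b
      have "rc b \<in> E i" using KE by blast
      then show "rc b \<in> {y. act g y \<in> E i}" by (simp add: act_rc[OF g])
    qed
    moreover have "v ` {..<i} \<subseteq> {y. act g y \<in> E i}"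
      using flag_stable[OF kv(1) i g] span_E[of i] vs.span_base[of _ "v ` {..<i}"] by blast
    ultimately have "E i \<subseteq> {y. act g y \<in> E i}" unfolding E_def by (simp only: adjoin_subset_iff simp_thms)
    then show ?thesis using y by blast
  qed
  have "i \<le> k \<Longrightarrow> \<exists>B. finite B \<and> card B \<le> i \<and> fixed (carrier G) \<inter> E i = adjoin K B" for i
  proof (induction i)
    case 0
    have "E 0 = K" unfolding E_def using hull_same[of is_subfield, OF subfield_K] by simp
    then have "fixed (carrier G) \<inter> E 0 = adjoin K {}"
      using K_fixed[OF subset_refl] hull_same[of is_subfield, OF subfield_K] by auto
    then show ?case by (intro exI[of _ "{}"]) simp
  next
    case (Suc i)
    then obtain B where B: "finite B" "card B \<le> i" "fixed (carrier G) \<inter> E i = adjoin K B" by auto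
    have i: "i < k" using Suc.prems by simp
    have "act g (v i) - v i \<in> E i" if "g \<in> carrier G" for g
      using kv(1) i that span_E[of i] unfolding flag_def by blast
    then obtain f where f: "fixed (carrier G) \<inter> adjoin (E i) {v i} = adjoin (fixed (carrier G) \<inter> E i) {f}"
      using miyata[OF E EL[OF less_imp_le[OF i]] E_stable[OF less_imp_le[OF i]] vL[OF i] _ trans[OF i]] by blast
    have "E (Suc i) = adjoin (E i) {v i}"
      unfolding E_def lessThan_Suc image_insert by (rule adjoin_insert)
    then have "fixed (carrier G) \<inter> E (Suc i) = adjoin K (insert f B)"
      unfolding adjoin_insert[of K f B] using f B(3) by simp
    moreover have "card (insert f B) \<le> Suc i" using B(1,2) by (simp add: card_insert_if)
    ultimately show ?case using B(1) by (intro exI[of _ "insert f B"]) auto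
  qed
  then obtain B where B: "finite B" "card B \<le> k" "fixed (carrier G) \<inter> E k = adjoin K B" by blast
  have "fixed (carrier G) = adjoin K B" using B(3) unfolding Ek by (auto simp: fixed_def)
  then show ?thesis using rational_if_few_generators[of B] B(1,2) flag_length[OF kv(1)] by simp
qed

end

section \<open>The regular action\<close>

lemma
  fixes f :: "'l::field \<Rightarrow> 'l"
  assumes f: "f 1 = 1" "\<And>x y. f (x + y) = f x + f y" "\<And>x y. f (x * y) = f x * f y"
  shows field_hom_0: "f 0 = 0" and field_hom_diff: "f (x - y) = f x - f y"
    and field_hom_inverse: "f (inverse x) = inverse (f x)"
proof -
  show f0: "f 0 = 0" using f(2)[of 0 0] by (metis add_cancel_right_right add_0)
  show "f (x - y) = f x - f y" using f(2)[of "x - y" y] by simp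
  show "f (inverse x) = inverse (f x)"
  proof (cases "x = 0")
    case False
    then have "f x * f (inverse x) = 1" using f(1) f(3)[of x "inverse x"] by simp
    then show ?thesis by (simp add: inverse_unique)
  qed (simp add: f0)
qed

lemma subfield_preimage:
  fixes f :: "'l::field \<Rightarrow> 'l"
  assumes f: "f 1 = 1" "\<And>x y. f (x + y) = f x + f y" "\<And>x y. f (x * y) = f x * f y" and F: "is_subfield F"
  shows "is_subfield {x. f x \<in> F}"
  by (rule is_subfieldI)
    (simp_all add: f(1,3) field_hom_0[OF f] field_hom_diff[OF f] field_hom_inverse[OF f]
      subfield_0[OF F] subfield_1[OF F] subfield_diff[OF F] subfield_mult[OF F] subfield_inverse[OF F])

lemma subfield_equalizer:
  fixes f g :: "'l::field \<Rightarrow> 'l"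
  assumes f: "f 1 = 1" "\<And>x y. f (x + y) = f x + f y" "\<And>x y. f (x * y) = f x * f y"
    and g: "g 1 = 1" "\<And>x y. g (x + y) = g x + g y" "\<And>x y. g (x * y) = g x * g y"
  shows "is_subfield {x. f x = g x}"
  by (rule is_subfieldI)
    (simp_all add: f(1,3) field_hom_0[OF f] field_hom_diff[OF f] field_hom_inverse[OF f]
      g(1,3) field_hom_0[OF g] field_hom_diff[OF g] field_hom_inverse[OF g])

text \<open>Stability and the composition law are clear on constants and variables. They extend to
  the generated field because preimages of subfields and equalizers of field homomorphisms are
  subfields.\<close>

lemma noether_action_regular:
  fixes G :: "('g, 'b) monoid_scheme"
  assumes G: "group G" "finite (carrier G)"
  shows "noether_action G (regular_action G) (rconst :: 'k::field \<Rightarrow> ('g, 'k) ratfun) (group_ratfuns G) rvar"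
proof -
  interpret group G by fact
  let ?act = "regular_action G :: 'g \<Rightarrow> ('g, 'k) ratfun \<Rightarrow> _"
  let ?L = "group_ratfuns G :: ('g, 'k) ratfun set"
  note hom = regular_action_hom[OF G(1), where 'k = 'k]
  have L: "is_subfield ?L" unfolding group_ratfuns_def by (rule is_subfield_hull)
  have gens: "range rconst \<subseteq> ?L" "rvar ` carrier G \<subseteq> ?L"
    using hull_subset[of "range rconst \<union> rvar ` carrier G :: ('g, 'k) ratfun set" is_subfield] unfolding group_ratfuns_def by simp_all
  have sub: "?L \<subseteq> D" if "is_subfield D" "\<And>c. rconst c \<in> D" "\<And>h. h \<in> carrier G \<Longrightarrow> rvar h \<in> D" for D
    unfolding group_ratfuns_def using that by (intro hull_minimal) (simp_all add: image_subset_iff)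
  have one: "?act g 1 = 1" if "g \<in> carrier G" for g
    using hom(3)[OF that, of 1] by (simp add: rconst_hom)
  show ?thesis
  proof (intro_locales; unfold_locales)
    show "finite (carrier G)" "is_subfield ?L" by fact+
    show "(rconst 1 :: ('g, 'k) ratfun) = 1" "(rconst (c + d) :: ('g, 'k) ratfun) = rconst c + rconst d"
      "(rconst (c * d) :: ('g, 'k) ratfun) = rconst c * rconst d" for c d :: 'k
      by (fact rconst_hom)+
    show "rconst c \<in> ?L" for c using gens(1) by blast
    show "?L = adjoin (range rconst) (rvar ` carrier G)" by (rule group_ratfuns_def)
    show "\<not> alg_over (adjoin (range rconst) (rvar ` (carrier G - {h}))) (rvar h :: ('g, 'k) ratfun)" for h
      by (rule rvar_transcendental) simp
    fix g assume g: "g \<in> carrier G"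
    show "?act g (y + z) = ?act g y + ?act g z" "?act g (y * z) = ?act g y * ?act g z"
      "?act g (rconst c) = rconst c" for y z c
      using hom[OF g] by auto
    show "?act g (rvar h) = rvar (g \<otimes>\<^bsub>G\<^esub> h)" if "h \<in> carrier G" for h using hom(4)[OF g that] .
    show "?act g y \<in> ?L" if "y \<in> ?L" for y
    proof -
      have "?L \<subseteq> {y. ?act g y \<in> ?L}"
        using gens g by (intro sub subfield_preimage[OF one[OF g] hom(1,2)[OF g] L]) (auto simp: hom)
      then show ?thesis using that by blast
    qed
    show "?act g (?act h y) = ?act (g \<otimes>\<^bsub>G\<^esub> h) y" if h: "h \<in> carrier G" and y: "y \<in> ?L" for h y
    proof -
      have gh: "g \<otimes>\<^bsub>G\<^esub> h \<in> carrier G" using g h by simp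
      have "?L \<subseteq> {y. ?act g (?act h y) = ?act (g \<otimes>\<^bsub>G\<^esub> h) y}"
        using g h gh
        by (intro sub subfield_equalizer[where f = "\<lambda>y. ?act g (?act h y)"]) (simp_all add: hom one m_assoc)
      then show ?thesis using y by blast
    qed
  next
    show "?act \<one>\<^bsub>G\<^esub> y = y" if y: "y \<in> ?L" for y
    proof -
      have "?L \<subseteq> {y. ?act \<one>\<^bsub>G\<^esub> y = y}"
        by (intro sub subfield_equalizer) (simp_all add: hom one)
      then show ?thesis using y by blast
    qed
  qed
qed

text \<open>The quotient has order \<open>p\<close>, so any \<open>a\<close> outside
  \<open>H\<close> has its p-th power in \<open>H\<close> and no smaller positive power. Hence the
  \<open>p * card H\<close> products of a power of \<open>a\<close> below \<open>p\<close> with an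
  element of \<open>H\<close> are distinct and fill \<open>G\<close>.\<close>

lemma (in group) coset_representatives:
  assumes H: "H \<lhd> G" and p: "prime p" and order: "finite (carrier G)" "Coset.order G = p * card H"
  obtains a where "a \<in> carrier G" "a [^] p \<in> H" "\<And>g. g \<in> carrier G \<Longrightarrow> \<exists>m<p. \<exists>h\<in>H. g = a [^] m \<otimes> h"
proof -
  interpret H: normal H G by fact
  have subH: "subgroup H G" by (rule H.subgroup_axioms)
  have finH: "finite H" using H.subset order(1) finite_subset by blast
  have "0 < card H" using finH H.one_closed card_gt_0_iff by blast
  then have "card H < card (carrier G)"
    using order(2) prime_gt_1_nat[OF p] unfolding Coset.order_def by simp
  then have "H \<noteq> carrier G" by auto
  then obtain a where a: "a \<in> carrier G" "a \<notin> H" using H.subset by blast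
  have "card (rcosets H) * card H = p * card H" using lagrange[OF subH] order(2) by (simp add: mult.commute)
  then have cosets: "Coset.order (G Mod H) = p"
    using \<open>0 < card H\<close> by (simp add: Coset.order_def FactGroup_def)
  have Ha: "H #> a \<in> carrier (G Mod H)" using a(1) by (auto simp: carrier_FactGroup)
  have "(H #> a) [^]\<^bsub>G Mod H\<^esub> p = \<one>\<^bsub>G Mod H\<^esub>"
    using group.pow_order_eq_1[OF H.factorgroup_is_group Ha] cosets by simp
  then have "H #> (a [^] p) = H" using H.FactGroup_pow[OF a(1), of p] by simp
  then have ap: "a [^] p \<in> H" using coset_join1[OF _ _ subH] a(1) by simp
  have powH: "h [^] m \<in> H" if "h \<in> H" for h and m :: nat
    by (induction m) (use that in auto)
  \<comment> \<open>For \<open>0 < m < p\<close>, Bezout's identity \<open>m * r = p * q + 1\<close>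
    would express \<open>a\<close> through elements of \<open>H\<close>.\<close>
  have no_power: "m = 0" if m: "a [^] m \<in> H" "m < p" for m :: nat
  proof (rule ccontr)
    assume "m \<noteq> 0"
    then have "\<not> p dvd m" using m(2) by (auto dest: dvd_imp_le)
    then have "gcd m p = 1" using p by (metis coprime_commute coprime_imp_gcd_eq_1 prime_imp_coprime_nat)
    then obtain r q where rq: "m * r = p * q + 1" using bezout_nat[OF \<open>m \<noteq> 0\<close>, of p] by auto
    have "(a [^] m) [^] r = (a [^] p) [^] q \<otimes> a"
      by (simp only: nat_pow_pow[OF a(1)] rq Suc_eq_plus1[symmetric] nat_pow_Suc)
    then have "(a [^] p) [^] q \<otimes> a \<in> H" using powH[OF m(1), of r] by simp
    then have "inv ((a [^] p) [^] q) \<otimes> ((a [^] p) [^] q \<otimes> a) \<in> H"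
      by (rule H.m_closed[OF H.m_inv_closed[OF powH[OF ap]]])
    then show False using a by (simp flip: m_assoc)
  qed
  let ?f = "\<lambda>(m, h). a [^] (m :: nat) \<otimes> h"
  have inj: "m = m' \<and> h = h'" if "m \<le> m'" "m' < p" "h \<in> H" "h' \<in> H" "a [^] m \<otimes> h = a [^] m' \<otimes> h'" for m m' h h'
  proof -
    have c: "h \<in> carrier G" "h' \<in> carrier G" using that(3,4) H.mem_carrier by auto
    have "a [^] m' = a [^] m \<otimes> a [^] (m' - m)" using a(1) that(1) by (simp add: nat_pow_mult)
    then have "a [^] m \<otimes> h = a [^] m \<otimes> (a [^] (m' - m) \<otimes> h')" using that(5) a(1) c by (simp add: m_assoc)
    then have h: "h = a [^] (m' - m) \<otimes> h'" using a(1) c by simp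
    then have "a [^] (m' - m) = h \<otimes> inv h'" using a(1) c by (simp add: m_assoc)
    also have "\<dots> \<in> H" using that(3,4) by auto
    finally have "m' - m = 0" using that(2) by (intro no_power) auto
    then show ?thesis using that(1) h c by simp
  qed
  have "inj_on ?f ({..<p} \<times> H)"
  proof (rule inj_onI)
    fix x y assume *: "x \<in> {..<p} \<times> H" "y \<in> {..<p} \<times> H" "?f x = ?f y"
    show "x = y"
    proof (cases "fst x \<le> fst y")
      case True
      then show ?thesis using inj[of "fst x" "fst y" "snd x" "snd y"] * by (cases x; cases y) simp
    next
      case False
      then show ?thesis using inj[of "fst y" "fst x" "snd y" "snd x"] * by (cases x; cases y) simp
    qed
  qed
  then have "card (?f ` ({..<p} \<times> H)) = card (carrier G)"
    using order(2) by (simp add: card_image card_cartesian_product Coset.order_def)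
  moreover have "?f ` ({..<p} \<times> H) \<subseteq> carrier G" using a(1) H.mem_carrier by auto
  ultimately have "?f ` ({..<p} \<times> H) = carrier G" using order(1) by (intro card_subset_eq) auto
  then have "\<exists>m<p. \<exists>h\<in>H. g = a [^] m \<otimes> h" if "g \<in> carrier G" for g
    using that by (fastforce simp: image_iff set_eq_iff)
  then show ?thesis using that a(1) ap by blast
qed

section \<open>The exponent of the group and the final assembly\<close>

lemma (in group) pow_group_exponent:
  assumes "finite (carrier G)" "g \<in> carrier G"
  shows "g [^] group_exponent G = \<one>"
proof -
  let ?P = "\<lambda>m :: nat. 0 < m \<and> (\<forall>x\<in>carrier G. x [^] m = \<one>)"
  have "0 < Coset.order G" using assms(1) one_closed unfolding Coset.order_def card_gt_0_iff by blast
  then have "?P (Coset.order G)" using pow_order_eq_1 by blast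
  then have "?P (LEAST m. ?P m)" by (rule LeastI)
  then show ?thesis using assms(2) by (simp add: group_exponent_def)
qed

theorem theorem1p8:
  fixes G :: "('g, 'b) monoid_scheme"
    and H :: "'g set" and Hs :: "nat \<Rightarrow> 'g set"
    and p n e s :: nat and i k :: "nat \<Rightarrow> nat"
  assumes p: "prime p" "odd p"
    and G: "group G" "order G = p ^ n" "2 \<le> n" "group_exponent G = p ^ e"
    and H: "H \<lhd> G" "comm_group (G\<lparr>carrier := H\<rparr>)" "card H = p ^ (n - 1)"
    and s: "1 \<le> s"
    and decomposition: "internal_direct_product G H {1..s} Hs"
    and Hs_normal: "\<And>j. j \<in> {1..s} \<Longrightarrow> Hs j \<lhd> G"
    and Hs_iso: "\<And>j. j \<in> {1..s} \<Longrightarrow>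
      G\<lparr>carrier := Hs j\<rparr> \<cong>
        integer_mod_group (p ^ i j) \<times>\<times> product_group {..<k j} (\<lambda>_. integer_mod_group p)"
    and i: "1 \<le> i 1" "mono_on {1..s} i"
    and K: "CHAR('k::field) = p \<or>
      (CHAR('k) \<noteq> p \<and> (\<exists>\<zeta> :: 'k. primitive_root_of_unity (p ^ e) \<zeta>))"
  shows "rational_over (range rconst) (noether_field G :: ('g, 'k) ratfun set)"
proof -
  interpret group G by fact
  have "0 < p" using p(1) prime_gt_0_nat by blast
  then have fin: "finite (carrier G)"
    using G(2) card_ge_0_finite[of "carrier G"] by (simp add: Coset.order_def)
  have "p ^ n = p * p ^ (n - 1)" using G(3) by (cases n) auto
  then have index: "Coset.order G = p * card H" using G(2) H(3) by simp
  have exponent: "g [^]\<^bsub>G\<^esub> (p ^ e) = \<one>\<^bsub>G\<^esub>" if "g \<in> carrier G" for g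
    using pow_group_exponent[OF fin that] G(4) by simp
  \<comment> \<open>Exponent 1 would make \<open>G\<close> trivial, contrary to
    \<open>2 \<le> n\<close>.\<close>
  have "0 < e"
  proof (rule ccontr)
    assume "\<not> 0 < e"
    then have "g = \<one>\<^bsub>G\<^esub>" if "g \<in> carrier G" for g using exponent[OF that] that by simp
    then have "carrier G \<subseteq> {\<one>\<^bsub>G\<^esub>}" by blast
    then have "card (carrier G) \<le> 1" using card_mono[of "{\<one>\<^bsub>G\<^esub>}" "carrier G"] by simp
    moreover have "1 < p ^ n" using prime_gt_1_nat[OF p(1)] G(3) by (intro one_less_power) auto
    ultimately show False using G(2) by (simp add: Coset.order_def)
  qed
  have comm: "g \<otimes>\<^bsub>G\<^esub> h = h \<otimes>\<^bsub>G\<^esub> g" if "g \<in> H" "h \<in> H" for g h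
    using comm_monoid.m_comm[OF comm_group.axioms(1)[OF H(2)], of g h] that by simp
  obtain a where a: "a \<in> carrier G" "a [^]\<^bsub>G\<^esub> p \<in> H"
    "\<And>g. g \<in> carrier G \<Longrightarrow> \<exists>m<p. \<exists>h\<in>H. g = a [^]\<^bsub>G\<^esub> m \<otimes>\<^bsub>G\<^esub> h"
    using coset_representatives[OF H(1) p(1) fin index] by metis
  interpret index_p_action G "regular_action G" "rconst :: 'k \<Rightarrow> ('g, 'k) ratfun" "group_ratfuns G" rvar H a p n e
    by (intro index_p_action.intro noether_action_regular index_p_action_axioms.intro)
      (fact G(1) fin p H(1) comm a G(2) index \<open>0 < e\<close> exponent)+
  have fixed: "noether_field G = fixed (carrier G)"
    by (simp add: noether_field_def fixed_def)
  show ?thesis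
  proof (cases "CHAR('k) = p")
    case True
    then show ?thesis unfolding fixed by (rule rational_char_p)
  next
    case False
    then obtain \<zeta> :: 'k where \<zeta>: "primitive_root_of_unity (p ^ e) \<zeta>" using K by blast
    \<comment> \<open>Otherwise the characteristic would divide the prime \<open>p\<close> without
      being \<open>p\<close>, which leaves only the impossible value 1.\<close>
    have p_nz: "of_nat p \<noteq> (0 :: 'k)"
    proof
      assume "of_nat p = (0 :: 'k)"
      then have "CHAR('k) dvd p" by (simp add: of_nat_eq_0_iff_char_dvd)
      then have "CHAR('k) = 1" using p(1) False by (metis prime_nat_iff)
      then show False using of_nat_CHAR[where 'a = 'k] by simp
    qed
    interpret index_p_action_roots G "regular_action G" "rconst :: 'k \<Rightarrow> ('g, 'k) ratfun" "group_ratfuns G" rvar H a p n e \<zeta>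
      by unfold_locales (fact \<zeta> p_nz)+
    show ?thesis unfolding fixed by (rule rational_roots)
  qed
qed

end
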